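(* Let $n=2k>4$ be even, let $\mathcal{A}_n\subset\mathbb{C}^2$ be the conic-line arrangement consisting of a circle and the $n$ lines extending the edges of an $n$-gon inscribed in it, constructed as described in the context (with no parallel lines), and let $M_n=\pi_1(\mathbb{C}^2-\mathcal{A}_n)$. Then the group $M_n$ is not isomorphic to a direct sum of a free abelian group and free groups.
   Context: Construction of $\mathcal{A}_n$ for $n=2k$. Let $C=\{x^2+y^2=1\}$. Choose $k$ points $v_1,\dots,v_k$, numbered clockwise, on the half-circle of $C$ above the $x$-axis, such that all distances $d(v_i,v_{i+1})$ are equal. Draw a line through $v_1$ with a very positive slope $s_1$, meeting $C$ in a second point $v'_1$ below the $x$-axis, and a line through $v_k$ with a very negative slope $s_2\neq -s_1$, meeting $C$ in a second point $v'_k$ below the $x$-axis. Let $v'_2,\dots,v'_{k-1}$ be $k-2$ further points of $C$ below the $x$-axis, lying in order between $v'_1$ and $v'_k$, such that all distances $d(v'_i,v'_{i+1})$ are equal. Connect the $2k$ points, in the cyclic order $v_1,\dots,v_k,v'_k,v'_{k-1},\dots,v'_1$, by segments to obtain an $n$-gon inscribed in $C$, and extend its $n$ edges to infinite straight lines. The choices are made so that the $n$ lines are in general position (no two are parallel and no three are concurrent). $\mathcal{A}_n$ is the union in $\mathbb{C}^2$ of the complexifications of $C$ and these $n$ lines. Its points of multiplicity larger than 2 are exactly the $n$ vertices of the polygon, each a triple point lying on two lines and $C$; its graph is a cycle of length $n$. "Direct sum" of groups means direct product of finitely many groups, i.e. a group of the form $\mathbb{Z}^r\oplus\bigoplus_{i=1}^{v}\mathbb{F}_{m_i}$,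 where $\mathbb{F}_m$ is the free group on $m$ generators. *)

theory Defs
  imports
    "HOL-Analysis.Analysis"
    "HOL-Algebra.Product_Groups"
    "HOL-Algebra.Free_Abelian_Groups"
begin

section \<open>The fundamental group\<close>

definition loops_at :: "'a::topological_space set \<Rightarrow> 'a \<Rightarrow> (real \<Rightarrow> 'a) set" where
  "loops_at S p = {g. path g \<and> path_image g \<subseteq> S \<and> pathstart g = p \<and> pathfinish g = p}"

definition fundamental_group ::
    "'a::real_normed_vector set \<Rightarrow> 'a \<Rightarrow> (real \<Rightarrow> 'a) set monoid" where
  "fundamental_group S p =
     \<lparr>carrier = loops_at S p // {(g, h). homotopic_paths S g h},
      monoid.mult = (\<lambda>X Y. {h. \<exists>f\<in>X. \<exists>g\<in>Y. homotopic_paths S (f +++ g) h}),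
      one = {h. homotopic_paths S (linepath p p) h}\<rparr>"

lemma homotopy_class_mult:
  assumes "f \<in> loops_at S p" "g \<in> loops_at S p"
  shows "Collect (homotopic_paths S f) \<otimes>\<^bsub>fundamental_group S p\<^esub> Collect (homotopic_paths S g)
           = Collect (homotopic_paths S (f +++ g))"
proof -
  have "homotopic_paths S (f +++ g) h"
    if "homotopic_paths S f f'" "homotopic_paths S g g'" "homotopic_paths S (f' +++ g') h"
    for f' g' h
    using that assms homotopic_paths_join[OF that(1,2)]
    by (auto simp: loops_at_def intro: homotopic_paths_trans)
  moreover have "homotopic_paths S f f" "homotopic_paths S g g"
    using assms by (auto simp: loops_at_def)
  ultimately show ?thesis
    unfolding fundamental_group_def by (simp, blast)
qed

lemma carrier_fundamental_group:
  "carrier (fundamental_group S p) = (\<lambda>g. Collect (homotopic_paths S g)) ` loops_at S p"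
  by (auto simp: fundamental_group_def quotient_def)

lemma group_fundamental_group:
  assumes "p \<in> S"
  shows "group (fundamental_group S p)"
proof -
  let ?G = "fundamental_group S p" and ?c = "\<lambda>g. Collect (homotopic_paths S g)"
  have one: "\<one>\<^bsub>?G\<^esub> = ?c (linepath p p)" "linepath p p \<in> loops_at S p"
    using assms by (auto simp: fundamental_group_def loops_at_def)
  have join: "f +++ g \<in> loops_at S p" if "f \<in> loops_at S p" "g \<in> loops_at S p" for f g
    using that by (auto simp: loops_at_def path_image_join)
  have eq: "?c f = ?c g" if "homotopic_paths S f g" for f g
    using that by (auto intro: homotopic_paths_trans simp: homotopic_paths_sym_eq)
  have rev: "reversepath f \<in> loops_at S p"
    "?c (reversepath f) \<otimes>\<^bsub>?G\<^esub> ?c f = \<one>\<^bsub>?G\<^esub>" if "f \<in> loops_at S p" for f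
  proof -
    show r: "reversepath f \<in> loops_at S p"
      using that by (auto simp: loops_at_def)
    have "homotopic_paths S (reversepath f +++ f) (linepath p p)"
      using that homotopic_paths_linv[of f S] by (auto simp: loops_at_def)
    then show "?c (reversepath f) \<otimes>\<^bsub>?G\<^esub> ?c f = \<one>\<^bsub>?G\<^esub>"
      using eq by (simp add: homotopy_class_mult r that one(1))
  qed
  show ?thesis
  proof (rule groupI)
    show "\<one>\<^bsub>?G\<^esub> \<in> carrier ?G"
      using one by (auto simp: carrier_fundamental_group)
    show "x \<otimes>\<^bsub>?G\<^esub> y \<in> carrier ?G" if "x \<in> carrier ?G" "y \<in> carrier ?G" for x y
      using that join by (auto simp: carrier_fundamental_group homotopy_class_mult)
    show "(x \<otimes>\<^bsub>?G\<^esub> y) \<otimes>\<^bsub>?G\<^esub> z = x \<otimes>\<^bsub>?G\<^esub> (y \<otimes>\<^bsub>?G\<^esub> z)"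
      if xyz: "x \<in> carrier ?G" "y \<in> carrier ?G" "z \<in> carrier ?G" for x y z
    proof -
      obtain f g h where fgh: "f \<in> loops_at S p" "g \<in> loops_at S p" "h \<in> loops_at S p"
        and e: "x = ?c f" "y = ?c g" "z = ?c h"
        using xyz by (auto simp: carrier_fundamental_group)
      have "homotopic_paths S (f +++ (g +++ h)) ((f +++ g) +++ h)"
        using fgh by (intro homotopic_paths_assoc) (auto simp: loops_at_def)
      from eq[OF this] show ?thesis
        by (simp add: e homotopy_class_mult fgh join)
    qed
    show "\<one>\<^bsub>?G\<^esub> \<otimes>\<^bsub>?G\<^esub> x = x" if x: "x \<in> carrier ?G" for x
    proof -
      obtain f where f: "f \<in> loops_at S p" "x = ?c f"
        using x by (auto simp: carrier_fundamental_group)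
      have "homotopic_paths S (linepath p p +++ f) f"
        using f by (intro homotopic_paths_lid') (auto simp: loops_at_def)
      from eq[OF this] show ?thesis
        by (simp add: f one homotopy_class_mult)
    qed
    show "\<exists>y\<in>carrier ?G. y \<otimes>\<^bsub>?G\<^esub> x = \<one>\<^bsub>?G\<^esub>" if x: "x \<in> carrier ?G" for x
    proof -
      obtain f where f: "f \<in> loops_at S p" "x = ?c f"
        using x by (auto simp: carrier_fundamental_group)
      then show ?thesis
        using rev[OF f(1)] by (auto simp: carrier_fundamental_group)
    qed
  qed
qed


section \<open>Free groups\<close>

text \<open>Words are lists of letters; the letter \<open>(x, True)\<close> stands for the generator \<open>x\<close>,
  and \<open>(x, False)\<close> for its inverse.\<close>

type_synonym 'a letter = "'a \<times> bool"

definition inv_letter :: "'a letter \<Rightarrow> 'a letter" where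
  "inv_letter a = (fst a, \<not> snd a)"

fun reduced :: "'a letter list \<Rightarrow> bool" where
  "reduced (a # b # w) \<longleftrightarrow> b \<noteq> inv_letter a \<and> reduced (b # w)"
| "reduced _ \<longleftrightarrow> True"

fun reduce_Cons :: "'a letter \<Rightarrow> 'a letter list \<Rightarrow> 'a letter list" where
  "reduce_Cons a [] = [a]"
| "reduce_Cons a (b # w) = (if b = inv_letter a then w else a # b # w)"

definition free_group :: "'a set \<Rightarrow> 'a letter list monoid" where
  "free_group A =
     \<lparr>carrier = {w. reduced w \<and> fst ` set w \<subseteq> A},
      monoid.mult = (\<lambda>u w. foldr reduce_Cons u w),
      one = []\<rparr>"

lemma inv_letter_inv_letter [simp]: "inv_letter (inv_letter a) = a"
  by (simp add: inv_letter_def)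

lemma fst_inv_letter [simp]: "fst (inv_letter a) = fst a"
  by (simp add: inv_letter_def)

lemma inv_letter_neq [simp]: "inv_letter a \<noteq> a" "a \<noteq> inv_letter a"
  by (cases a; simp add: inv_letter_def)+

lemma reduced_tl: "reduced (a # w) \<Longrightarrow> reduced w"
  by (cases w) auto

lemma reduced_reduce_Cons: "reduced w \<Longrightarrow> reduced (reduce_Cons a w)"
  by (cases w) (auto dest: reduced_tl)

lemma reduced_foldr: "reduced w \<Longrightarrow> reduced (foldr reduce_Cons u w)"
  by (induction u) (auto simp: reduced_reduce_Cons)

lemma set_reduce_Cons: "set (reduce_Cons a w) \<subseteq> insert a (set w)"
  by (cases w) auto

lemma set_foldr_reduce_Cons: "set (foldr reduce_Cons u w) \<subseteq> set u \<union> set w"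
  using set_reduce_Cons by (induction u) fastforce+

lemma reduce_Cons_inv:
  assumes "reduced w"
  shows "reduce_Cons (inv_letter a) (reduce_Cons a w) = w"
proof (cases w)
  case (Cons b v)
  then show ?thesis using assms by (cases v) auto
qed simp

lemma foldr_reduce_Cons_swap:
  assumes "reduced w"
  shows "foldr reduce_Cons (reduce_Cons a u) w = reduce_Cons a (foldr reduce_Cons u w)"
proof (cases u)
  case (Cons b v)
  then show ?thesis
    using reduce_Cons_inv[OF reduced_foldr[OF assms], of "inv_letter a" v] by auto
qed simp

lemma foldr_reduce_Cons_assoc:
  assumes "reduced w"
  shows "foldr reduce_Cons (foldr reduce_Cons u v) w = foldr reduce_Cons u (foldr reduce_Cons v w)"
  using assms by (induction u) (simp_all add: foldr_reduce_Cons_swap)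

lemma foldr_reduce_Cons_Nil: "reduced u \<Longrightarrow> foldr reduce_Cons u [] = u"
proof (induction u)
  case (Cons a u)
  then show ?case by (cases u) (auto dest: reduced_tl)
qed simp

lemma foldr_reduce_Cons_inverse:
  "reduced w \<Longrightarrow> foldr reduce_Cons (map inv_letter (rev u)) (foldr reduce_Cons u w) = w"
  by (induction u) (simp_all add: reduce_Cons_inv reduced_foldr)

lemma group_free_group: "group (free_group A)"
proof (rule groupI)
  let ?G = "free_group A"
  show "\<one>\<^bsub>?G\<^esub> \<in> carrier ?G"
    by (simp add: free_group_def)
  show "x \<otimes>\<^bsub>?G\<^esub> y \<in> carrier ?G" if "x \<in> carrier ?G" "y \<in> carrier ?G" for x y
    using that set_foldr_reduce_Cons[of x y]
    by (fastforce simp: free_group_def reduced_foldr)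
  show "(x \<otimes>\<^bsub>?G\<^esub> y) \<otimes>\<^bsub>?G\<^esub> z = x \<otimes>\<^bsub>?G\<^esub> (y \<otimes>\<^bsub>?G\<^esub> z)"
    if "x \<in> carrier ?G" "y \<in> carrier ?G" "z \<in> carrier ?G" for x y z
    using that by (simp add: free_group_def foldr_reduce_Cons_assoc)
  show "\<one>\<^bsub>?G\<^esub> \<otimes>\<^bsub>?G\<^esub> x = x" for x
    by (simp add: free_group_def)
  show "\<exists>y\<in>carrier ?G. y \<otimes>\<^bsub>?G\<^esub> x = \<one>\<^bsub>?G\<^esub>" if x: "x \<in> carrier ?G" for x
  proof -
    define y where "y = foldr reduce_Cons (map inv_letter (rev x)) []"
    have "set y \<subseteq> inv_letter ` set x"
      using set_foldr_reduce_Cons[of "map inv_letter (rev x)" "[]"] by (simp add: y_def)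
    then have "y \<in> carrier ?G"
      using x by (fastforce simp: free_group_def y_def reduced_foldr)
    moreover have "y \<otimes>\<^bsub>?G\<^esub> x = \<one>\<^bsub>?G\<^esub>"
      using x foldr_reduce_Cons_inverse[of "[]" x]
      by (simp add: free_group_def y_def foldr_reduce_Cons_assoc foldr_reduce_Cons_Nil)
    ultimately show ?thesis by blast
  qed
qed

text \<open>The groups \<open>\<int>\<^sup>r \<oplus> \<Oplus>\<^sub>i \<F>\<^sub>m\<^sub>(\<^sub>i\<^sub>)\<close>, \<open>i < v\<close>.\<close>

definition free_abelian_sum_free ::
    "nat \<Rightarrow> nat \<Rightarrow> (nat \<Rightarrow> nat) \<Rightarrow> ((nat \<Rightarrow>\<^sub>0 int) \<times> (nat \<Rightarrow> nat letter list)) monoid" where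
  "free_abelian_sum_free r v m =
     free_Abelian_group {..<r} \<times>\<times> product_group {..<v} (\<lambda>i. free_group {..<m i})"


section \<open>The arrangement\<close>

text \<open>Over \<^typ>\<open>real\<close> these are the circle and the line through two points; the same equations
  over \<^typ>\<open>complex\<close> give their complexifications.\<close>

definition conic :: "('a::field \<times> 'a) set" where
  "conic = {(x, y). x\<^sup>2 + y\<^sup>2 = 1}"

definition line_through :: "'a::field \<times> 'a \<Rightarrow> 'a \<times> 'a \<Rightarrow> ('a \<times> 'a) set" where
  "line_through p q =
     {(x, y). (x - fst p) * (snd q - snd p) = (y - snd p) * (fst q - fst p)}"

definition complex_point :: "real \<times> real \<Rightarrow> complex \<times> complex" where
  "complex_point p = (of_real (fst p), of_real (snd p))"

text \<open>The points \<open>v\<^sub>1, \<dots>, v\<^sub>k, v'\<^sub>k, \<dots>, v'\<^sub>1\<close> in cyclic order, indexed from 0 modulo \<open>2 * k\<close>.\<close>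

definition vertex ::
    "nat \<Rightarrow> (nat \<Rightarrow> real \<times> real) \<Rightarrow> (nat \<Rightarrow> real \<times> real) \<Rightarrow> nat \<Rightarrow> real \<times> real" where
  "vertex k v v' j =
     (let i = j mod (2 * k) in if i < k then v (i + 1) else v' (2 * k - i))"

definition edge_line ::
    "nat \<Rightarrow> (nat \<Rightarrow> real \<times> real) \<Rightarrow> (nat \<Rightarrow> real \<times> real) \<Rightarrow> nat \<Rightarrow> (real \<times> real) set" where
  "edge_line k v v' j = line_through (vertex k v v' j) (vertex k v v' (j + 1))"

definition complex_edge_line ::
    "nat \<Rightarrow> (nat \<Rightarrow> real \<times> real) \<Rightarrow> (nat \<Rightarrow> real \<times> real) \<Rightarrow> nat \<Rightarrow> (complex \<times> complex) set" where
  "complex_edge_line k v v' j =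
     line_through (complex_point (vertex k v v' j)) (complex_point (vertex k v v' (j + 1)))"

definition general_position :: "'i set \<Rightarrow> ('i \<Rightarrow> (real \<times> real) set) \<Rightarrow> bool" where
  "general_position I L \<longleftrightarrow>
     (\<forall>i\<in>I. \<forall>j\<in>I. i \<noteq> j \<longrightarrow> \<not> affine_parallel (L i) (L j)) \<and>
     (\<forall>i\<in>I. \<forall>j\<in>I. \<forall>l\<in>I. i \<noteq> j \<and> j \<noteq> l \<and> i \<noteq> l \<longrightarrow> L i \<inter> L j \<inter> L l = {})"

text \<open>On the upper half-circle, clockwise order is the order of increasing abscissa; on the lower
  half-circle, the points from \<open>v'\<^sub>1\<close> to \<open>v'\<^sub>k\<close> are also ordered by increasing abscissa. A slope
  counts as very positive (very negative) if it is positive (negative) and the line meets the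
  circle again below the \<open>x\<close>-axis.\<close>

definition inscribed_polygon ::
    "nat \<Rightarrow> (nat \<Rightarrow> real \<times> real) \<Rightarrow> (nat \<Rightarrow> real \<times> real) \<Rightarrow> real \<Rightarrow> real \<Rightarrow> bool" where
  "inscribed_polygon k v v' s1 s2 \<longleftrightarrow>
     (\<forall>i\<in>{1..k}. v i \<in> conic \<and> snd (v i) > 0) \<and>
     (\<forall>i\<in>{1..<k}. fst (v i) < fst (v (i + 1))) \<and>
     (\<exists>d. \<forall>i\<in>{1..<k}. dist (v i) (v (i + 1)) = d) \<and>
     s1 > 0 \<and> s2 < 0 \<and> s2 \<noteq> - s1 \<and>
     snd (v' 1) - snd (v 1) = s1 * (fst (v' 1) - fst (v 1)) \<and>
     snd (v' k) - snd (v k) = s2 * (fst (v' k) - fst (v k)) \<and>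
     (\<forall>i\<in>{1..k}. v' i \<in> conic \<and> snd (v' i) < 0) \<and>
     (\<forall>i\<in>{1..<k}. fst (v' i) < fst (v' (i + 1))) \<and>
     (\<exists>d'. \<forall>i\<in>{1..<k}. dist (v' i) (v' (i + 1)) = d') \<and>
     general_position {..<2 * k} (edge_line k v v')"

definition arrangement ::
    "nat \<Rightarrow> (nat \<Rightarrow> real \<times> real) \<Rightarrow> (nat \<Rightarrow> real \<times> real) \<Rightarrow> (complex \<times> complex) set" where
  "arrangement k v v' = conic \<union> (\<Union>j<2 * k. complex_edge_line k v v' j)"

end

theory Submission
  imports Defs "HOL-Complex_Analysis.Complex_Analysis"
begin

text \<open>
  In \<open>\<int>\<^sup>r \<times> \<Prod> F\<^sub>m\<close> two commuting elements have, in every free factor, proportional vectors of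
  exponent sums. Consequently a biadditive form that vanishes on commuting pairs also vanishes
  on any pair of elements whose images under all pairs of homomorphisms to \<open>\<int>\<close> that are
  proportional on commuting pairs are again proportional. The fundamental group of the arrangement
  violates this for the meridians of two adjacent edges.

  Let \<open>(\<xi>, \<xi>')\<close> be such a pair of homomorphisms and \<open>x\<^sub>j \<in> \<int>\<^sup>2\<close> its value on a meridian of edge \<open>j\<close>,
  \<open>x\<^sub>N\<close> its value on a meridian of the conic. Tori near a double point of the edges \<open>i\<close> and \<open>j\<close>
  give \<open>x\<^sub>i \<parallel> x\<^sub>j\<close>, tori near the vertex of the edges \<open>i\<close> and \<open>i + 1\<close> give \<open>x\<^sub>i \<parallel> x\<^sub>i\<^sub>+\<^sub>1 + x\<^sub>N\<close> and
  \<open>x\<^sub>i\<^sub>+\<^sub>1 \<parallel> x\<^sub>i + x\<^sub>N\<close>. When there are at least six edges these relations force \<open>x\<^sub>0 \<parallel> x\<^sub>1\<close>.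

  On the other hand the equations \<open>f\<^sub>i\<close> of the edges and \<open>Q\<close> of the conic satisfy
  \<open>\<Sum>\<^sub>i (-1)\<^sup>i dlog f\<^sub>i \<and> dlog (f\<^sub>i\<^sub>+\<^sub>1 / Q) = 0\<close> because the number of edges is even. Hence the logarithms
  of the equations develop into a Heisenberg group, and the commutator form of the holonomy vanishes
  on commuting pairs. Its value on the meridians of the edges \<open>0\<close> and \<open>1\<close> is \<open>(2 \<pi> \<i>)\<^sup>2\<close>.
\<close>

section \<open>Isotropic forms on products of free groups\<close>

text \<open>On a product of a free abelian group and free groups, every isotropic form is a
  combination of decomposable ones, the wedges of two exponent sums of one free factor. The form of
  the arrangement is of a different kind: all decomposable integral isotropic forms vanish on the
  meridians of edges 0 and 1, and it does not. The obstacle is to control homomorphisms to \<int>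
  without a presentation of the fundamental group. Such homomorphisms are constant on conjugacy
  classes, so they are evaluated on free loops. Base points then disappear, all meridians of one
  curve receive the same value, and the commutation relations come from explicit tori: a meridian
  circle of an edge times a small loop in that edge. Six edges are asked for because the linear
  algebra needs an edge, here edge 3, that is adjacent to neither edge 0 nor edge 1; a quadrilateral
  has none.\<close>

definition isotropic_pair :: "('a, 'b) monoid_scheme \<Rightarrow> ('a \<Rightarrow> int) \<Rightarrow> ('a \<Rightarrow> int) \<Rightarrow> bool" where
  "isotropic_pair G \<xi> \<xi>' \<longleftrightarrow>
     (\<forall>g\<in>carrier G. \<forall>h\<in>carrier G. \<xi> (g \<otimes>\<^bsub>G\<^esub> h) = \<xi> g + \<xi> h) \<and>
     (\<forall>g\<in>carrier G. \<forall>h\<in>carrier G. \<xi>' (g \<otimes>\<^bsub>G\<^esub> h) = \<xi>' g + \<xi>' h) \<and>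
     (\<forall>g\<in>carrier G. \<forall>h\<in>carrier G. g \<otimes>\<^bsub>G\<^esub> h = h \<otimes>\<^bsub>G\<^esub> g \<longrightarrow> \<xi> g * \<xi>' h = \<xi>' g * \<xi> h)"

definition isotropic_form :: "('a, 'b) monoid_scheme \<Rightarrow> ('a \<Rightarrow> 'a \<Rightarrow> complex) \<Rightarrow> bool" where
  "isotropic_form G \<beta> \<longleftrightarrow>
     (\<forall>g\<in>carrier G. \<forall>h\<in>carrier G. \<forall>k\<in>carrier G.
        \<beta> (g \<otimes>\<^bsub>G\<^esub> h) k = \<beta> g k + \<beta> h k \<and> \<beta> k (g \<otimes>\<^bsub>G\<^esub> h) = \<beta> k g + \<beta> k h) \<and>
     (\<forall>g\<in>carrier G. \<forall>h\<in>carrier G. g \<otimes>\<^bsub>G\<^esub> h = h \<otimes>\<^bsub>G\<^esub> g \<longrightarrow> \<beta> g h = 0)"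

section \<open>Exponent sums and a second-order invariant of words\<close>

definition letter_exp :: "'a \<Rightarrow> 'a letter \<Rightarrow> int" where
  "letter_exp j a = (if fst a = j then if snd a then 1 else -1 else 0)"

definition exp_sum :: "'a \<Rightarrow> 'a letter list \<Rightarrow> int" where
  "exp_sum j w = (\<Sum>a\<leftarrow>w. letter_exp j a)"

text \<open>Signed count of pairs formed by an occurrence of \<open>i\<close> and a later occurrence
  of \<open>j\<close>. For \<open>i \<noteq> j\<close> it is the coefficient of X_i X_j in the
  Magnus expansion.\<close>

fun pair_count :: "'a \<Rightarrow> 'a \<Rightarrow> 'a letter list \<Rightarrow> int" where
  "pair_count i j [] = 0"
| "pair_count i j (a # w) = pair_count i j w + letter_exp i a * exp_sum j w"

lemma exp_sum_simps [simp]: "exp_sum j [] = 0" "exp_sum j (a # w) = letter_exp j a + exp_sum j w"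
  by (auto simp: exp_sum_def)

lemma letter_exp_inv_letter [simp]: "letter_exp j (inv_letter a) = - letter_exp j a"
  by (simp add: letter_exp_def inv_letter_def)

lemma exp_sum_reduce_Cons: "exp_sum j (reduce_Cons a w) = letter_exp j a + exp_sum j w"
  by (cases w) auto

lemma exp_sum_mult: "exp_sum j (foldr reduce_Cons u w) = exp_sum j u + exp_sum j w"
  by (induction u) (auto simp: exp_sum_reduce_Cons)

lemma pair_count_reduce_Cons:
  assumes "i \<noteq> j"
  shows "pair_count i j (reduce_Cons a w) = pair_count i j w + letter_exp i a * exp_sum j w"
proof (cases w)
  case (Cons b v)
  \<comment> \<open>Cancelling \<open>a\<close> against its inverse removes a pair that counts as
    minus this product, so \<open>i \<noteq> j\<close> is what makes the count invariant under
    reduction.\<close>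
  have "letter_exp i a * letter_exp j a = 0"
    using assms by (simp add: letter_exp_def)
  then show ?thesis using Cons by (auto simp: algebra_simps)
qed simp

lemma pair_count_mult:
  assumes "i \<noteq> j"
  shows "pair_count i j (foldr reduce_Cons u w) = pair_count i j u + pair_count i j w + exp_sum i u * exp_sum j w"
  by (induction u) (auto simp: pair_count_reduce_Cons assms exp_sum_mult algebra_simps)

text \<open>The function \<^const>\<open>pair_count\<close> is the corner entry of a homomorphism to the integral
  Heisenberg group with the two exponent sums as its other entries.\<close>

lemma exp_sum_commuting:
  assumes "foldr reduce_Cons u w = foldr reduce_Cons w u"
  shows "exp_sum i u * exp_sum j w = exp_sum j u * exp_sum i w"
  using pair_count_mult[of i j u w] pair_count_mult[of i j w u] assms
  by (cases "i = j") (auto simp: algebra_simps)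

lemma isotropic_formD:
  assumes "isotropic_form G \<beta>"
  shows "\<lbrakk>g \<in> carrier G; h \<in> carrier G; k \<in> carrier G\<rbrakk> \<Longrightarrow> \<beta> (g \<otimes>\<^bsub>G\<^esub> h) k = \<beta> g k + \<beta> h k"
    and "\<lbrakk>g \<in> carrier G; h \<in> carrier G; k \<in> carrier G\<rbrakk> \<Longrightarrow> \<beta> k (g \<otimes>\<^bsub>G\<^esub> h) = \<beta> k g + \<beta> k h"
    and "\<lbrakk>g \<in> carrier G; h \<in> carrier G; g \<otimes>\<^bsub>G\<^esub> h = h \<otimes>\<^bsub>G\<^esub> g\<rbrakk> \<Longrightarrow> \<beta> g h = 0"
  using assms unfolding isotropic_form_def by simp_all

lemma isotropic_pairD:
  assumes "isotropic_pair G \<xi> \<xi>'" "g \<in> carrier G" "h \<in> carrier G"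
  shows "\<xi> (g \<otimes>\<^bsub>G\<^esub> h) = \<xi> g + \<xi> h" and "\<xi>' (g \<otimes>\<^bsub>G\<^esub> h) = \<xi>' g + \<xi>' h"
    and "g \<otimes>\<^bsub>G\<^esub> h = h \<otimes>\<^bsub>G\<^esub> g \<Longrightarrow> \<xi> g * \<xi>' h = \<xi>' g * \<xi> h"
  using assms unfolding isotropic_pair_def by simp_all

text \<open>Every element commutes with itself, so the form is zero on the diagonal; polarising at
  \<open>g \<otimes> h\<close> gives antisymmetry.\<close>

lemma isotropic_form_antisym:
  assumes form: "isotropic_form G \<beta>" and "group G" and gh: "g \<in> carrier G" "h \<in> carrier G"
  shows "\<beta> g h = - \<beta> h g"
proof -
  interpret group G by fact
  note D = isotropic_formD[OF form]
  have c: "g \<otimes>\<^bsub>G\<^esub> h \<in> carrier G" using gh by simp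
  have "0 = \<beta> (g \<otimes>\<^bsub>G\<^esub> h) (g \<otimes>\<^bsub>G\<^esub> h)"
    using D(3)[OF c c refl] by simp
  also have "\<dots> = (\<beta> g g + \<beta> g h) + (\<beta> h g + \<beta> h h)"
    unfolding D(1)[OF gh c] D(2)[OF gh gh(1)] D(2)[OF gh gh(2)] ..
  also have "\<dots> = \<beta> g h + \<beta> h g"
    using D(3)[OF gh(1) gh(1) refl] D(3)[OF gh(2) gh(2) refl] by simp
  finally show ?thesis by (simp add: eq_neg_iff_add_eq_0)
qed

lemma additive_one:
  fixes f :: "'a \<Rightarrow> 'c::ab_group_add"
  assumes "group G" "\<And>g h. g \<in> carrier G \<Longrightarrow> h \<in> carrier G \<Longrightarrow> f (g \<otimes>\<^bsub>G\<^esub> h) = f g + f h"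
  shows "f \<one>\<^bsub>G\<^esub> = 0"
proof -
  interpret group G by fact
  have "f (\<one>\<^bsub>G\<^esub> \<otimes>\<^bsub>G\<^esub> \<one>\<^bsub>G\<^esub>) = f \<one>\<^bsub>G\<^esub> + f \<one>\<^bsub>G\<^esub>" by (rule assms) auto
  then show ?thesis by simp
qed

lemma free_group_additive:
  fixes f :: "nat letter list \<Rightarrow> complex"
  assumes f: "\<And>g h. g \<in> carrier (free_group {..<m}) \<Longrightarrow> h \<in> carrier (free_group {..<m})
                \<Longrightarrow> f (g \<otimes>\<^bsub>free_group {..<m}\<^esub> h) = f g + f h"
    and w: "w \<in> carrier (free_group {..<m})"
  shows "f w = (\<Sum>j<m. of_int (exp_sum j w) * f [(j, True)])"
proof -
  let ?G = "free_group {..<m}"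
  have one: "f [] = 0"
    using additive_one[OF group_free_group, of "{..<m}" f] f by (simp add: free_group_def)
  have letter: "f [a] = (\<Sum>j<m. of_int (letter_exp j a) * f [(j, True)])" if am: "fst a < m" for a
  proof -
    obtain i s where a: "a = (i, s)" "i < m" using am by (cases a) simp
    have mem: "[(i, False)] \<in> carrier ?G" "[(i, True)] \<in> carrier ?G"
      using a(2) by (simp_all add: free_group_def)
    have "[(i, False)] \<otimes>\<^bsub>?G\<^esub> [(i, True)] = []"
      by (simp add: free_group_def inv_letter_def)
    then have "f [(i, False)] + f [(i, True)] = 0"
      using f[OF mem] one by simp
    then have "f [(i, False)] = - f [(i, True)]"
      by (simp add: eq_neg_iff_add_eq_0)
    then have "f [a] = of_int (letter_exp i a) * f [(i, True)]"
      by (cases s) (simp_all add: a(1) letter_exp_def)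
    also have "\<dots> = (\<Sum>j<m. if j = i then of_int (letter_exp i a) * f [(i, True)] else 0)"
      using a(2) by simp
    also have "\<dots> = (\<Sum>j<m. of_int (letter_exp j a) * f [(j, True)])"
      by (intro sum.cong) (simp_all add: a(1) letter_exp_def)
    finally show ?thesis .
  qed
  show ?thesis using w
  proof (induction w)
    case Nil
    then show ?case using one by simp
  next
    case (Cons a w)
    have w: "w \<in> carrier ?G" and a: "fst a < m" and red: "reduced (a # w)"
      using Cons.prems by (auto simp: free_group_def dest: reduced_tl)
    have "[a] \<otimes>\<^bsub>?G\<^esub> w = a # w"
      using red by (cases w) (auto simp: free_group_def)
    then have "f (a # w) = f [a] + f w"
      using f[of "[a]" w] w a by (simp add: free_group_def)
    then show ?case
      using Cons.IH[OF w] letter[OF a]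
      by (simp add: sum.distrib distrib_right)
  qed
qed

text \<open>After expansion over the generators the coefficients are symmetric in (i, j) by
  \<open>par\<close>, while the values on generators are antisymmetric by \<open>anti\<close>. The
  double sum therefore equals its own negative.\<close>

lemma isotropic_form_free_group:
  fixes m :: nat
  assumes bil: "\<And>g h k. g \<in> carrier (free_group {..<m}) \<Longrightarrow> h \<in> carrier (free_group {..<m})
                \<Longrightarrow> k \<in> carrier (free_group {..<m}) \<Longrightarrow>
      \<beta> (g \<otimes>\<^bsub>free_group {..<m}\<^esub> h) k = \<beta> g k + \<beta> h k \<and>
      \<beta> k (g \<otimes>\<^bsub>free_group {..<m}\<^esub> h) = \<beta> k g + \<beta> k h"
    and anti: "\<And>i j. i < m \<Longrightarrow> j < m \<Longrightarrow> \<beta> [(i, True)] [(j, True)] = - \<beta> [(j, True)] [(i, True)]"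
    and u: "u \<in> carrier (free_group {..<m})" and w: "w \<in> carrier (free_group {..<m})"
    and par: "\<And>i j. i < m \<Longrightarrow> j < m \<Longrightarrow> exp_sum i u * exp_sum j w = exp_sum j u * exp_sum i w"
  shows "\<beta> u w = (0::complex)"
proof -
  let ?s = "\<Sum>i<m. \<Sum>j<m. of_int (exp_sum i u * exp_sum j w) * \<beta> [(i, True)] [(j, True)]"
  have gen: "[(i, True)] \<in> carrier (free_group {..<m})" if "i < m" for i
    using that by (simp add: free_group_def)
  have "\<beta> u w = (\<Sum>i<m. of_int (exp_sum i u) * \<beta> [(i, True)] w)"
    by (rule free_group_additive[OF bil[THEN conjunct1, OF _ _ w] u])
  also have "\<dots> = (\<Sum>i<m. of_int (exp_sum i u) * (\<Sum>j<m. of_int (exp_sum j w) * \<beta> [(i, True)] [(j, True)]))"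
  proof (intro sum.cong refl arg_cong2[of _ _ _ _ "(*)"])
    fix i assume "i \<in> {..<m}"
    then have i: "[(i, True)] \<in> carrier (free_group {..<m})" using gen by simp
    show "\<beta> [(i, True)] w = (\<Sum>j<m. of_int (exp_sum j w) * \<beta> [(i, True)] [(j, True)])"
      by (rule free_group_additive[OF bil[THEN conjunct2, OF _ _ i] w])
  qed
  also have "\<dots> = ?s"
    by (simp add: sum_distrib_left mult.assoc)
  finally have 1: "\<beta> u w = ?s" .
  have "?s = (\<Sum>j<m. \<Sum>i<m. of_int (exp_sum i u * exp_sum j w) * \<beta> [(i, True)] [(j, True)])"
    by (rule sum.swap)
  also have "\<dots> = (\<Sum>j<m. \<Sum>i<m. - (of_int (exp_sum j u * exp_sum i w) * \<beta> [(j, True)] [(i, True)]))"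
  proof (intro sum.cong refl)
    fix i j assume "j \<in> {..<m}" "i \<in> {..<m}"
    then have ij: "i < m" "j < m" by simp_all
    show "of_int (exp_sum i u * exp_sum j w) * \<beta> [(i, True)] [(j, True)] =
        - (of_int (exp_sum j u * exp_sum i w) * \<beta> [(j, True)] [(i, True)])"
      unfolding par[OF ij] anti[OF ij] by simp
  qed
  also have "\<dots> = - ?s"
    by (simp add: sum_negf)
  finally show ?thesis using 1 by simp
qed

text \<open>Different free factors commute and the abelian part is central, so only the terms
  pairing two components in the same free factor survive. The exponent sums of that factor form
  isotropic pairs, and \<open>pairs\<close> applied to them yields the proportionality that kills
  these terms.\<close>

lemma isotropic_form_free_abelian_sum_free:
  fixes r v :: nat and m :: "nat \<Rightarrow> nat"
  defines "S \<equiv> free_abelian_sum_free r v m"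
  assumes iso: "isotropic_form S \<beta>" and x: "x \<in> carrier S" and y: "y \<in> carrier S"
    and pairs: "\<And>\<xi> \<xi>'. isotropic_pair S \<xi> \<xi>' \<Longrightarrow> \<xi> x * \<xi>' y = \<xi>' x * \<xi> y"
  shows "\<beta> x y = 0"
proof -
  let ?F = "\<lambda>l. free_group {..<m l}"
  let ?A = "free_Abelian_group {..<r}"
  let ?P = "product_group {..<v} ?F"
  interpret A: comm_group ?A by (rule abelian_free_Abelian_group)
  interpret P: group ?P by (simp add: group_free_group)
  have S: "S = ?A \<times>\<times> ?P" by (simp add: S_def free_abelian_sum_free_def)
  interpret S: group S unfolding S by (intro DirProd_group A.group_axioms P.group_axioms)
  have bil: "\<beta> (g \<otimes>\<^bsub>S\<^esub> h) k = \<beta> g k + \<beta> h k" "\<beta> k (g \<otimes>\<^bsub>S\<^esub> h) = \<beta> k g + \<beta> k h"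
    if "g \<in> carrier S" "h \<in> carrier S" "k \<in> carrier S" for g h k
    using that by (rule isotropic_formD[OF iso])+
  have comm: "\<beta> g h = 0" if "g \<in> carrier S" "h \<in> carrier S" "g \<otimes>\<^bsub>S\<^esub> h = h \<otimes>\<^bsub>S\<^esub> g" for g h
    using that by (rule isotropic_formD(3)[OF iso])
  define fac where "fac l w = (\<one>\<^bsub>?A\<^esub>, \<lambda>i\<in>{..<v}. if i = l then w else [])"
    for l and w :: "nat letter list"
  \<comment> \<open>\<open>tup n s\<close> keeps the abelian component and the first
    \<open>n\<close> free components. It interpolates between the central element
    \<open>tup 0 s\<close> and \<open>s = tup v s\<close>, one factor per induction step.\<close>
  define tup where "tup n s = (fst s, \<lambda>i\<in>{..<v}. if i < n then snd s i else [])"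
    for n and s :: "(nat \<Rightarrow>\<^sub>0 int) \<times> (nat \<Rightarrow> nat letter list)"
  have oneF: "[] \<in> carrier (?F l)" "\<And>w. foldr reduce_Cons [] w = (w :: nat letter list)" for l
    by (auto simp: free_group_def)
  have carrier_S: "carrier S = carrier ?A \<times> (\<Pi>\<^sub>E i\<in>{..<v}. carrier (?F i))"
    by (simp add: S)
  have fac_in: "fac l w \<in> carrier S" if "w \<in> carrier (?F l)" for l w
    using that oneF by (auto simp: S fac_def DirProd_def)
  have tup_in: "tup n s \<in> carrier S" if "s \<in> carrier S" for n s
    using that oneF by (auto simp: S tup_def DirProd_def PiE_iff)
  have coord: "snd s l \<in> carrier (?F l)" if "s \<in> carrier S" "l < v" for s l
    using that by (simp only: carrier_S mem_Times_iff PiE_iff lessThan_iff)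
  have rid: "foldr reduce_Cons w [] = w" if "w \<in> carrier (?F l)" for w l
    using that by (simp add: free_group_def foldr_reduce_Cons_Nil)
  have mult_S: "g \<otimes>\<^bsub>S\<^esub> h = (fst g \<otimes>\<^bsub>?A\<^esub> fst h, \<lambda>i\<in>{..<v}. foldr reduce_Cons (snd g i) (snd h i))" for g h
    by (cases g; cases h) (simp add: S DirProd_def product_group_def free_group_def)
  have fac_mult: "fac l (u \<otimes>\<^bsub>?F l\<^esub> w) = fac l u \<otimes>\<^bsub>S\<^esub> fac l w"
    if "u \<in> carrier (?F l)" "w \<in> carrier (?F l)" for l u w
    by (auto simp: fac_def mult_S free_group_def intro!: restrict_ext)
  have fac_comm: "fac l u \<otimes>\<^bsub>S\<^esub> fac l' w = fac l' w \<otimes>\<^bsub>S\<^esub> fac l u"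
    if "u \<in> carrier (?F l)" "w \<in> carrier (?F l')" "l \<noteq> l'" for l l' u w
    using rid[OF that(1)] rid[OF that(2)] that(3)
    by (auto simp: fac_def mult_S intro!: restrict_ext)
  have tup0: "tup 0 s \<otimes>\<^bsub>S\<^esub> t = t \<otimes>\<^bsub>S\<^esub> tup 0 s" if "s \<in> carrier S" "t \<in> carrier S" for s t
  proof -
    have "fst s \<in> carrier ?A" "fst t \<in> carrier ?A"
      using that by (simp_all only: carrier_S mem_Times_iff)
    then show ?thesis
      using rid[OF coord[OF that(2)]] A.m_comm
      by (simp add: tup_def mult_S cong: restrict_cong)
  qed
  have tup_Suc: "tup (Suc n) s = tup n s \<otimes>\<^bsub>S\<^esub> fac n (snd s n)" if "s \<in> carrier S" "n < v" for s n
  proof -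
    have "fst s \<in> carrier ?A"
      using that by (simp_all only: carrier_S mem_Times_iff)
    then show ?thesis
      using rid[OF coord[OF that(1)]] A.r_one
      by (auto simp: tup_def fac_def mult_S intro!: restrict_ext)
  qed
  have tup_v: "tup v s = s" if "s \<in> carrier S" for s
  proof -
    have "snd s \<in> extensional {..<v}"
      using that by (auto simp: S DirProd_def PiE_def)
    then have "(\<lambda>i\<in>{..<v}. if i < v then snd s i else []) = snd s"
      by (auto simp: fun_eq_iff extensional_def)
    then show ?thesis by (simp add: tup_def)
  qed
  have left: "\<beta> (tup n s) t = (\<Sum>l<n. \<beta> (fac l (snd s l)) t)"
    if "s \<in> carrier S" "t \<in> carrier S" "n \<le> v" for n s t
    using that(3)
  proof (induction n)
    case 0
    show ?case using comm[OF tup_in[OF that(1)] that(2) tup0[OF that(1,2)]] by simp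
  next
    case (Suc n)
    then have n: "n < v" by simp
    show ?case
      unfolding tup_Suc[OF that(1) n] bil(1)[OF tup_in[OF that(1)] fac_in[OF coord[OF that(1) n]] that(2)]
      using Suc.IH n by simp
  qed
  have right: "\<beta> t (tup n s) = (\<Sum>l<n. \<beta> t (fac l (snd s l)))"
    if "s \<in> carrier S" "t \<in> carrier S" "n \<le> v" for n s t
    using that(3)
  proof (induction n)
    case 0
    show ?case using comm[OF that(2) tup_in[OF that(1)] tup0[OF that(1,2), symmetric]] by simp
  next
    case (Suc n)
    then have n: "n < v" by simp
    show ?case
      unfolding tup_Suc[OF that(1) n] bil(2)[OF tup_in[OF that(1)] fac_in[OF coord[OF that(1) n]] that(2)]
      using Suc.IH n by simp
  qed
  have diag: "\<beta> (fac l (snd x l)) (fac l (snd y l)) = 0" if l: "l < v" for l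
  proof (rule isotropic_form_free_group[where m = "m l" and \<beta> = "\<lambda>u w. \<beta> (fac l u) (fac l w)"])
    show "\<beta> (fac l [(i, True)]) (fac l [(j, True)]) = - \<beta> (fac l [(j, True)]) (fac l [(i, True)])"
      if "i < m l" "j < m l" for i j
      using that by (intro isotropic_form_antisym[OF iso S.group_axioms] fac_in) (auto simp: free_group_def)
    show "exp_sum i (snd x l) * exp_sum j (snd y l) = exp_sum j (snd x l) * exp_sum i (snd y l)" for i j
    proof -
      have mul: "snd (g \<otimes>\<^bsub>S\<^esub> h) l = foldr reduce_Cons (snd g l) (snd h l)" for g h
        using l by (simp add: mult_S)
      have "isotropic_pair S (\<lambda>s. exp_sum i (snd s l)) (\<lambda>s. exp_sum j (snd s l))"
        unfolding isotropic_pair_def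
      proof (intro conjI ballI impI)
        fix g h assume "g \<otimes>\<^bsub>S\<^esub> h = h \<otimes>\<^bsub>S\<^esub> g"
        then have "foldr reduce_Cons (snd g l) (snd h l) = foldr reduce_Cons (snd h l) (snd g l)"
          by (metis mul)
        from exp_sum_commuting[OF this]
        show "exp_sum i (snd g l) * exp_sum j (snd h l) = exp_sum j (snd g l) * exp_sum i (snd h l)" .
      qed (simp_all add: mul exp_sum_mult)
      from pairs[OF this] show ?thesis .
    qed
    fix g h k assume *: "g \<in> carrier (?F l)" "h \<in> carrier (?F l)" "k \<in> carrier (?F l)"
    show "\<beta> (fac l (g \<otimes>\<^bsub>?F l\<^esub> h)) (fac l k) = \<beta> (fac l g) (fac l k) + \<beta> (fac l h) (fac l k) \<and>
        \<beta> (fac l k) (fac l (g \<otimes>\<^bsub>?F l\<^esub> h)) = \<beta> (fac l k) (fac l g) + \<beta> (fac l k) (fac l h)"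
      unfolding fac_mult[OF *(1,2)] by (intro conjI bil fac_in *)
  qed (rule coord[OF x l] coord[OF y l])+
  have "\<beta> x y = (\<Sum>l<v. \<beta> (fac l (snd x l)) y)"
    using left[OF x y order_refl] by (simp only: tup_v[OF x])
  also have "\<dots> = (\<Sum>l<v. \<Sum>l'<v. \<beta> (fac l (snd x l)) (fac l' (snd y l')))"
  proof (rule sum.cong[OF refl])
    fix l assume "l \<in> {..<v}"
    then have "l < v" by simp
    from right[OF y fac_in[OF coord[OF x this]] order_refl]
    show "\<beta> (fac l (snd x l)) y = (\<Sum>l'<v. \<beta> (fac l (snd x l)) (fac l' (snd y l')))"
      by (simp only: tup_v[OF y])
  qed
  also have "\<dots> = 0"
  proof (intro sum.neutral ballI)
    fix l l' assume "l \<in> {..<v}" "l' \<in> {..<v}"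
    then have *: "l < v" "l' < v" by simp_all
    show "\<beta> (fac l (snd x l)) (fac l' (snd y l')) = 0"
    proof (cases "l = l'")
      case True
      then show ?thesis using diag[OF *(1)] by simp
    next
      case False
      note c = coord[OF x *(1)] coord[OF y *(2)]
      show ?thesis by (rule comm[OF fac_in[OF c(1)] fac_in[OF c(2)] fac_comm[OF c False]])
    qed
  qed
  finally show ?thesis .
qed

lemma isotropic_form_iso_free_abelian_sum_free:
  assumes G: "group G" and iso: "G \<cong> free_abelian_sum_free r v m"
    and form: "isotropic_form G \<beta>" and x: "x \<in> carrier G" and y: "y \<in> carrier G"
    and pairs: "\<And>\<xi> \<xi>'. isotropic_pair G \<xi> \<xi>' \<Longrightarrow> \<xi> x * \<xi>' y = \<xi>' x * \<xi> y"
  shows "\<beta> x y = 0"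
proof -
  let ?S = "free_abelian_sum_free r v m"
  interpret G: group G by fact
  obtain \<phi> where \<phi>: "\<phi> \<in> iso G ?S" using iso by (auto simp: is_iso_def)
  define \<psi> where "\<psi> = inv_into (carrier G) \<phi>"
  have \<psi>: "\<psi> \<in> iso ?S G" unfolding \<psi>_def by (rule G.iso_set_sym[OF \<phi>])
  have hom: "\<phi> (g \<otimes>\<^bsub>G\<^esub> h) = \<phi> g \<otimes>\<^bsub>?S\<^esub> \<phi> h" "\<phi> g \<in> carrier ?S"
    if "g \<in> carrier G" "h \<in> carrier G" for g h
    using \<phi> that by (auto simp: iso_def hom_def)
  have hom': "\<psi> (s \<otimes>\<^bsub>?S\<^esub> t) = \<psi> s \<otimes>\<^bsub>G\<^esub> \<psi> t" "\<psi> s \<in> carrier G"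
    if "s \<in> carrier ?S" "t \<in> carrier ?S" for s t
    using \<psi> that by (auto simp: iso_def hom_def)
  have inv: "\<psi> (\<phi> g) = g" if "g \<in> carrier G" for g
    using \<phi> that by (auto simp: \<psi>_def iso_def bij_betw_def)
  have "\<beta> (\<psi> (\<phi> x)) (\<psi> (\<phi> y)) = 0"
  proof (rule isotropic_form_free_abelian_sum_free[where \<beta> = "\<lambda>s t. \<beta> (\<psi> s) (\<psi> t)"])
    show "isotropic_form ?S (\<lambda>s t. \<beta> (\<psi> s) (\<psi> t))"
      unfolding isotropic_form_def
    proof (intro conjI ballI impI)
      fix g h assume *: "g \<in> carrier ?S" "h \<in> carrier ?S"
      { assume "g \<otimes>\<^bsub>?S\<^esub> h = h \<otimes>\<^bsub>?S\<^esub> g"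
        then have "\<psi> g \<otimes>\<^bsub>G\<^esub> \<psi> h = \<psi> h \<otimes>\<^bsub>G\<^esub> \<psi> g"
          by (simp only: hom'(1)[OF *, symmetric] hom'(1)[OF *(2) *(1), symmetric])
        then show "\<beta> (\<psi> g) (\<psi> h) = 0"
          by (rule isotropic_formD(3)[OF form hom'(2)[OF *] hom'(2)[OF *(2) *(2)]]) }
      fix k assume k: "k \<in> carrier ?S"
      note c = hom'(2)[OF *] hom'(2)[OF *(2) k] hom'(2)[OF k k]
      show "\<beta> (\<psi> (g \<otimes>\<^bsub>?S\<^esub> h)) (\<psi> k) = \<beta> (\<psi> g) (\<psi> k) + \<beta> (\<psi> h) (\<psi> k)"
        unfolding hom'(1)[OF *] by (rule isotropic_formD(1)[OF form c])
      show "\<beta> (\<psi> k) (\<psi> (g \<otimes>\<^bsub>?S\<^esub> h)) = \<beta> (\<psi> k) (\<psi> g) + \<beta> (\<psi> k) (\<psi> h)"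
        unfolding hom'(1)[OF *] by (rule isotropic_formD(2)[OF form c])
    qed
    fix \<xi> \<xi>' assume pair: "isotropic_pair ?S \<xi> \<xi>'"
    have pG: "isotropic_pair G (\<lambda>g. \<xi> (\<phi> g)) (\<lambda>g. \<xi>' (\<phi> g))"
      unfolding isotropic_pair_def
    proof (intro conjI ballI impI)
      fix g h assume *: "g \<in> carrier G" "h \<in> carrier G"
      note c = hom(2)[OF *] hom(2)[OF *(2) *(2)]
      show "\<xi> (\<phi> (g \<otimes>\<^bsub>G\<^esub> h)) = \<xi> (\<phi> g) + \<xi> (\<phi> h)"
        "\<xi>' (\<phi> (g \<otimes>\<^bsub>G\<^esub> h)) = \<xi>' (\<phi> g) + \<xi>' (\<phi> h)"
        unfolding hom(1)[OF *] by (rule isotropic_pairD[OF pair c])+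
      assume "g \<otimes>\<^bsub>G\<^esub> h = h \<otimes>\<^bsub>G\<^esub> g"
      then have "\<phi> g \<otimes>\<^bsub>?S\<^esub> \<phi> h = \<phi> h \<otimes>\<^bsub>?S\<^esub> \<phi> g"
        by (simp only: hom(1)[OF *, symmetric] hom(1)[OF *(2) *(1), symmetric])
      then show "\<xi> (\<phi> g) * \<xi>' (\<phi> h) = \<xi>' (\<phi> g) * \<xi> (\<phi> h)"
        by (rule isotropic_pairD[OF pair c])
    qed
    show "\<xi> (\<phi> x) * \<xi>' (\<phi> y) = \<xi>' (\<phi> x) * \<xi> (\<phi> y)"
      by (rule pairs[OF pG])
  qed (rule hom(2)[OF x x] hom(2)[OF y y])+
  then show ?thesis using inv x y by simp
qed

section \<open>Holonomy of a locally defined transport\<close>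

text \<open>A flat connection in discrete form: \<open>\<Theta> p q\<close> stands for parallel
  transport over a short step from \<open>p\<close> to \<open>q\<close> and carries no information
  for distant points. Flatness is the cocycle rule on small balls.\<close>

locale transport = group H for H :: "('h, 'k) monoid_scheme" (structure) +
  fixes M :: "'a::real_normed_vector set" and \<Theta> :: "'a \<Rightarrow> 'a \<Rightarrow> 'h"
  assumes transport_closed [simp]: "\<Theta> p q \<in> carrier H"
    and transport_cocycle: "x \<in> M \<Longrightarrow> \<exists>e>0. \<forall>p\<in>ball x e \<inter> M. \<forall>q\<in>ball x e \<inter> M. \<forall>s\<in>ball x e \<inter> M.
           \<Theta> p q \<otimes> \<Theta> q s = \<Theta> p s"
begin

text \<open>A horizontal lift of the path. The group carries no topology, so the local product rule
  takes the place of continuity; general intervals are allowed so that bisection can be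
  used.\<close>

definition lift_on :: "(real \<Rightarrow> 'a) \<Rightarrow> real \<Rightarrow> real \<Rightarrow> (real \<Rightarrow> 'h) \<Rightarrow> bool" where
  "lift_on \<gamma> a b h \<longleftrightarrow> (\<forall>t\<in>{a..b}. h t \<in> carrier H) \<and>
     (\<forall>t\<in>{a..b}. \<exists>e>0. \<forall>s\<in>{a..b}. \<forall>s'\<in>{a..b}. \<bar>s - t\<bar> < e \<longrightarrow> \<bar>s' - t\<bar> < e \<longrightarrow>
        h s' = h s \<otimes> \<Theta> (\<gamma> s) (\<gamma> s'))"

lemma lift_onD:
  assumes "lift_on \<gamma> a b h" "t \<in> {a..b}"
  obtains e where "e > 0"
    "\<forall>s\<in>{a..b}. \<forall>s'\<in>{a..b}. \<bar>s - t\<bar> < e \<longrightarrow> \<bar>s' - t\<bar> < e \<longrightarrow> h s' = h s \<otimes> \<Theta> (\<gamma> s) (\<gamma> s')"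
proof -
  have "\<exists>e>0. \<forall>s\<in>{a..b}. \<forall>s'\<in>{a..b}. \<bar>s - t\<bar> < e \<longrightarrow> \<bar>s' - t\<bar> < e \<longrightarrow>
        h s' = h s \<otimes> \<Theta> (\<gamma> s) (\<gamma> s')"
    using assms unfolding lift_on_def by simp
  then show ?thesis using that by blast
qed

lemma lift_on_closed: "lift_on \<gamma> a b h \<Longrightarrow> t \<in> {a..b} \<Longrightarrow> h t \<in> carrier H"
  by (simp add: lift_on_def)

lemma cocycle_along_path:
  fixes a b t :: real
  assumes "continuous_on {a..b} \<gamma>" "\<gamma> ` {a..b} \<subseteq> M" "t \<in> {a..b}"
  obtains e where "e > 0"
    "\<forall>r\<in>{a..b}. \<forall>s\<in>{a..b}. \<forall>s'\<in>{a..b}. \<bar>r - t\<bar> < e \<longrightarrow> \<bar>s - t\<bar> < e \<longrightarrow> \<bar>s' - t\<bar> < e \<longrightarrow>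
            \<Theta> (\<gamma> r) (\<gamma> s) \<otimes> \<Theta> (\<gamma> s) (\<gamma> s') = \<Theta> (\<gamma> r) (\<gamma> s')"
proof -
  obtain d where d: "d > 0" "\<forall>p\<in>ball (\<gamma> t) d \<inter> M. \<forall>q\<in>ball (\<gamma> t) d \<inter> M. \<forall>s\<in>ball (\<gamma> t) d \<inter> M.
           \<Theta> p q \<otimes> \<Theta> q s = \<Theta> p s"
    using transport_cocycle[of "\<gamma> t"] assms by blast
  obtain e where e: "e > 0" "\<And>s::real. s \<in> {a..b} \<Longrightarrow> dist s t < e \<Longrightarrow> dist (\<gamma> s) (\<gamma> t) < d"
    using assms(1,3) d(1) unfolding continuous_on_iff by metis
  have mem: "\<gamma> s \<in> ball (\<gamma> t) d \<inter> M" if "s \<in> {a..b}" "\<bar>s - t\<bar> < e" for s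
    using e(2)[OF that(1)] that assms(2) by (auto simp: dist_commute dist_real_def)
  show ?thesis
  proof (rule that[OF e(1)], intro ballI impI)
    fix r s s' assume *: "r \<in> {a..b}" "s \<in> {a..b}" "s' \<in> {a..b}"
      "\<bar>r - t\<bar> < e" "\<bar>s - t\<bar> < e" "\<bar>s' - t\<bar> < e"
    show "\<Theta> (\<gamma> r) (\<gamma> s) \<otimes> \<Theta> (\<gamma> s) (\<gamma> s') = \<Theta> (\<gamma> r) (\<gamma> s')"
      by (rule d(2)[rule_format, OF mem mem mem]) (fact *)+
  qed
qed

lemma cocycle_refl:
  assumes "x \<in> M" shows "\<Theta> x x = \<one>"
proof -
  obtain e where "e > 0" "\<forall>p\<in>ball x e \<inter> M. \<forall>q\<in>ball x e \<inter> M. \<forall>s\<in>ball x e \<inter> M. \<Theta> p q \<otimes> \<Theta> q s = \<Theta> p s"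
    using transport_cocycle[OF assms] by blast
  with assms have "\<Theta> x x \<otimes> \<Theta> x x = \<Theta> x x" by (meson IntI centre_in_ball)
  then show ?thesis by (metis r_cancel_one transport_closed)
qed

text \<open>Transport acts on the right, so left translation maps lifts to lifts; the second lift is
  translated to agree with the first at \<open>b\<close>. Only steps that jump across
  \<open>b\<close> need the cocycle rule, with \<open>\<gamma> b\<close> as the intermediate
  point.\<close>

lemma lift_on_glue:
  assumes \<gamma>: "continuous_on {a..c} \<gamma>" "\<gamma> ` {a..c} \<subseteq> M" and abc: "a \<le> b" "b \<le> c"
    and h: "lift_on \<gamma> a b h" and h': "lift_on \<gamma> b c h'"
  shows "lift_on \<gamma> a c (\<lambda>t. if t \<le> b then h t else h b \<otimes> inv (h' b) \<otimes> h' t)"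
    (is "lift_on _ _ _ ?g")
proof -
  have hc: "h t \<in> carrier H" if "t \<in> {a..b}" for t using lift_on_closed[OF h that] .
  have hc': "h' t \<in> carrier H" if "t \<in> {b..c}" for t using lift_on_closed[OF h' that] .
  have hb: "h b \<in> carrier H" "h' b \<in> carrier H" using hc hc' abc by auto
  define k where "k = h b \<otimes> inv (h' b)"
  have k: "k \<in> carrier H" "k \<otimes> h' b = h b" using hb by (auto simp: k_def m_assoc)
  have loc: "\<exists>e>0. \<forall>s\<in>{a..c}. \<forall>s'\<in>{a..c}. \<bar>s - t\<bar> < e \<longrightarrow> \<bar>s' - t\<bar> < e \<longrightarrow>
        ?g s' = ?g s \<otimes> \<Theta> (\<gamma> s) (\<gamma> s')" if t: "t \<in> {a..c}" for t
  proof -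
    consider "t < b" | "t > b" | "t = b" by linarith
    then show ?thesis
    proof cases
      case 1
      then have t': "t \<in> {a..b}" using t by auto
      obtain e where e: "e > 0" "\<forall>s\<in>{a..b}. \<forall>s'\<in>{a..b}. \<bar>s - t\<bar> < e \<longrightarrow> \<bar>s' - t\<bar> < e \<longrightarrow> h s' = h s \<otimes> \<Theta> (\<gamma> s) (\<gamma> s')"
        using lift_onD[OF h t'] .
      show ?thesis
      proof (intro exI[of _ "min e (b - t)"] conjI ballI impI)
        fix s s' assume "s \<in> {a..c}" "s' \<in> {a..c}" "\<bar>s - t\<bar> < min e (b - t)" "\<bar>s' - t\<bar> < min e (b - t)"
        then show "?g s' = ?g s \<otimes> \<Theta> (\<gamma> s) (\<gamma> s')"
          using e(2)[rule_format, of s s'] by auto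
      qed (use e(1) 1 in simp)
    next
      case 2
      then have t': "t \<in> {b..c}" using t by auto
      obtain e where e: "e > 0" "\<forall>s\<in>{b..c}. \<forall>s'\<in>{b..c}. \<bar>s - t\<bar> < e \<longrightarrow> \<bar>s' - t\<bar> < e \<longrightarrow> h' s' = h' s \<otimes> \<Theta> (\<gamma> s) (\<gamma> s')"
        using lift_onD[OF h' t'] .
      show ?thesis
      proof (intro exI[of _ "min e (t - b)"] conjI ballI impI)
        fix s s' assume that: "s \<in> {a..c}" "s' \<in> {a..c}" "\<bar>s - t\<bar> < min e (t - b)" "\<bar>s' - t\<bar> < min e (t - b)"
        then have *: "s \<in> {b..c}" "s' \<in> {b..c}" "\<not> s \<le> b" "\<not> s' \<le> b" by auto
        have "h' s' = h' s \<otimes> \<Theta> (\<gamma> s) (\<gamma> s')"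
          using e(2)[rule_format, OF *(1,2)] that by simp
        then show "?g s' = ?g s \<otimes> \<Theta> (\<gamma> s) (\<gamma> s')"
          using * hc'[OF *(1)] k(1) by (simp add: k_def[symmetric] m_assoc)
      qed (use e(1) 2 in simp)
    next
      case 3
      have tb: "t \<in> {a..b}" "t \<in> {b..c}" using 3 abc by auto
      obtain e1 where e1: "e1 > 0" "\<forall>s\<in>{a..b}. \<forall>s'\<in>{a..b}. \<bar>s - t\<bar> < e1 \<longrightarrow> \<bar>s' - t\<bar> < e1 \<longrightarrow> h s' = h s \<otimes> \<Theta> (\<gamma> s) (\<gamma> s')"
        using lift_onD[OF h tb(1)] .
      obtain e2 where e2: "e2 > 0" "\<forall>s\<in>{b..c}. \<forall>s'\<in>{b..c}. \<bar>s - t\<bar> < e2 \<longrightarrow> \<bar>s' - t\<bar> < e2 \<longrightarrow> h' s' = h' s \<otimes> \<Theta> (\<gamma> s) (\<gamma> s')"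
        using lift_onD[OF h' tb(2)] .
      obtain e3 where e3: "e3 > 0"
        "\<forall>r\<in>{a..c}. \<forall>s\<in>{a..c}. \<forall>s'\<in>{a..c}. \<bar>r - t\<bar> < e3 \<longrightarrow> \<bar>s - t\<bar> < e3 \<longrightarrow> \<bar>s' - t\<bar> < e3 \<longrightarrow>
            \<Theta> (\<gamma> r) (\<gamma> s) \<otimes> \<Theta> (\<gamma> s) (\<gamma> s') = \<Theta> (\<gamma> r) (\<gamma> s')"
        using cocycle_along_path[OF \<gamma> t] .
      have step: "?g s' = ?g s \<otimes> \<Theta> (\<gamma> s) (\<gamma> s')"
        if s: "s \<in> {a..c}" "s' \<in> {a..c}" "\<bar>s - t\<bar> < min e1 (min e2 e3)" "\<bar>s' - t\<bar> < min e1 (min e2 e3)" for s s'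
      proof -
        have coc: "\<Theta> (\<gamma> s) (\<gamma> b) \<otimes> \<Theta> (\<gamma> b) (\<gamma> s') = \<Theta> (\<gamma> s) (\<gamma> s')"
          using e3(2)[rule_format, of s b s'] s e3(1) 3 abc by auto
        consider "s \<le> b" "s' \<le> b" | "s \<le> b" "b < s'" | "b < s" "s' \<le> b" | "b < s" "b < s'" by linarith
        then show ?thesis
        proof cases
          case 1
          then show ?thesis using e1(2)[rule_format, of s s'] s by auto
        next
          case 2
          have "h b = h s \<otimes> \<Theta> (\<gamma> s) (\<gamma> b)" "h' s' = h' b \<otimes> \<Theta> (\<gamma> b) (\<gamma> s')"
            using e1(2)[rule_format, of s b] e2(2)[rule_format, of b s'] s 2 3 abc e1(1) e2(1) by auto
          moreover have "h s \<in> carrier H" using hc s 2 by auto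
          moreover have "k \<otimes> (h' b \<otimes> \<Theta> (\<gamma> b) (\<gamma> s')) = h b \<otimes> \<Theta> (\<gamma> b) (\<gamma> s')"
            using k hb by (simp add: m_assoc[symmetric])
          ultimately have "k \<otimes> h' s' = h s \<otimes> \<Theta> (\<gamma> s) (\<gamma> s')"
            by (simp add: m_assoc coc)
          then show ?thesis using 2 by (simp add: k_def)
        next
          case 3
          have e: "h' b = h' s \<otimes> \<Theta> (\<gamma> s) (\<gamma> b)" "h s' = h b \<otimes> \<Theta> (\<gamma> b) (\<gamma> s')"
            using e2(2)[rule_format, of s b] e1(2)[rule_format, of b s'] s 3 \<open>t = b\<close> abc e1(1) e2(1) by auto
          have c: "h' s \<in> carrier H" using hc' s 3 by auto
          have "h s' = k \<otimes> (h' s \<otimes> \<Theta> (\<gamma> s) (\<gamma> b)) \<otimes> \<Theta> (\<gamma> b) (\<gamma> s')"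
            using e k(2) by simp
          also have "\<dots> = k \<otimes> h' s \<otimes> \<Theta> (\<gamma> s) (\<gamma> s')"
            using k(1) c by (simp add: m_assoc coc)
          finally show ?thesis using 3 by (simp add: k_def)
        next
          case 4
          then have *: "s \<in> {b..c}" "s' \<in> {b..c}" "\<not> s \<le> b" "\<not> s' \<le> b" using s by auto
          have "h' s' = h' s \<otimes> \<Theta> (\<gamma> s) (\<gamma> s')"
            using e2(2)[rule_format, OF *(1,2)] s by simp
          then show ?thesis
            using * hc'[OF *(1)] k(1) by (simp add: k_def[symmetric] m_assoc)
        qed
      qed
      show ?thesis
        by (intro exI[of _ "min e1 (min e2 e3)"] conjI ballI impI step) (use e1(1) e2(1) e3(1) in simp)
    qed
  qed
  have "?g t \<in> carrier H" if "t \<in> {a..c}" for t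
    using hc[of t] hc'[of t] hb that by auto
  with loc show ?thesis unfolding lift_on_def by simp
qed

lemma lift_on_exists:
  assumes \<gamma>: "continuous_on {0..1} \<gamma>" "\<gamma> ` {0..1} \<subseteq> M"
  shows "\<exists>h. lift_on \<gamma> 0 1 h"
proof -
  have "0 \<le> (0::real) \<longrightarrow> (1::real) \<le> 1 \<longrightarrow> (\<exists>h. lift_on \<gamma> 0 1 h)"
  proof (rule Bolzano[where P = "\<lambda>a b. 0 \<le> a \<longrightarrow> b \<le> 1 \<longrightarrow> (\<exists>h. lift_on \<gamma> a b h)"])
    fix a b c :: real
    assume *: "0 \<le> a \<longrightarrow> b \<le> 1 \<longrightarrow> (\<exists>h. lift_on \<gamma> a b h)" "0 \<le> b \<longrightarrow> c \<le> 1 \<longrightarrow> (\<exists>h. lift_on \<gamma> b c h)"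
      "a \<le> b" "b \<le> c"
    show "0 \<le> a \<longrightarrow> c \<le> 1 \<longrightarrow> (\<exists>h. lift_on \<gamma> a c h)"
    proof (intro impI)
      assume ac: "0 \<le> a" "c \<le> 1"
      obtain h h' where "lift_on \<gamma> a b h" "lift_on \<gamma> b c h'" using * ac by force
      moreover have sub: "{a..c} \<subseteq> {0..1}" using ac by auto
      have "continuous_on {a..c} \<gamma>" "\<gamma> ` {a..c} \<subseteq> M"
        using continuous_on_subset[OF \<gamma>(1) sub] \<gamma>(2) sub by auto
      ultimately show "\<exists>h. lift_on \<gamma> a c h" using lift_on_glue *(3,4) by blast
    qed
  next
    fix x :: real assume x: "0 \<le> x" "x \<le> 1"
    then have x': "x \<in> {0..1}" by simp
    obtain e where e: "e > 0"
      "\<forall>r\<in>{0..1}. \<forall>s\<in>{0..1}. \<forall>s'\<in>{0..1}. \<bar>r - x\<bar> < e \<longrightarrow> \<bar>s - x\<bar> < e \<longrightarrow> \<bar>s' - x\<bar> < e \<longrightarrow>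
            \<Theta> (\<gamma> r) (\<gamma> s) \<otimes> \<Theta> (\<gamma> s) (\<gamma> s') = \<Theta> (\<gamma> r) (\<gamma> s')"
      using cocycle_along_path[OF \<gamma> x'] .
    have "\<exists>h. lift_on \<gamma> a b h" if ab: "a \<le> x" "x \<le> b" "b - a < e" "0 \<le> a" "b \<le> 1" for a b
    proof -
      \<comment> \<open>On an interval this short, transport from the left end is itself a lift. The
        cocycle rule holds on the whole interval, so any radius, such as 1, serves in
        \<open>lift_on\<close>.\<close>
      have step: "\<Theta> (\<gamma> a) (\<gamma> s') = \<Theta> (\<gamma> a) (\<gamma> s) \<otimes> \<Theta> (\<gamma> s) (\<gamma> s')" if "s \<in> {a..b}" "s' \<in> {a..b}" for s s'
        by (rule e(2)[rule_format, symmetric]) (use that ab x in auto)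
      have "lift_on \<gamma> a b (\<lambda>t. \<Theta> (\<gamma> a) (\<gamma> t))"
        unfolding lift_on_def by (intro conjI ballI impI exI[of _ "1::real"] transport_closed zero_less_one step)
      then show ?thesis by blast
    qed
    then show "\<exists>d>0. \<forall>a b. a \<le> x \<and> x \<le> b \<and> b - a < d \<longrightarrow> 0 \<le> a \<longrightarrow> b \<le> 1 \<longrightarrow> (\<exists>h. lift_on \<gamma> a b h)"
      using e(1) by blast
  qed simp
  then show ?thesis by simp
qed

text \<open>The increment of a lift is insensitive to left translation, multiplies when intervals
  are joined, and is a single value of \<open>\<Theta>\<close> on short intervals. Bisection then
  forces any two lifts to have equal increments.\<close>

lemma lift_on_unique:
  assumes h: "lift_on \<gamma> 0 1 h" and h': "lift_on \<gamma> 0 1 h'"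
  shows "inv (h 0) \<otimes> h 1 = inv (h' 0) \<otimes> h' 1"
proof -
  have "0 \<le> (0::real) \<longrightarrow> (1::real) \<le> 1 \<longrightarrow> inv (h 0) \<otimes> h 1 = inv (h' 0) \<otimes> h' 1"
  proof (rule Bolzano[where P = "\<lambda>a b. 0 \<le> a \<longrightarrow> b \<le> 1 \<longrightarrow> inv (h a) \<otimes> h b = inv (h' a) \<otimes> h' b"])
    fix a b c :: real
    assume *: "0 \<le> a \<longrightarrow> b \<le> 1 \<longrightarrow> inv (h a) \<otimes> h b = inv (h' a) \<otimes> h' b"
      "0 \<le> b \<longrightarrow> c \<le> 1 \<longrightarrow> inv (h b) \<otimes> h c = inv (h' b) \<otimes> h' c" "a \<le> b" "b \<le> c"
    show "0 \<le> a \<longrightarrow> c \<le> 1 \<longrightarrow> inv (h a) \<otimes> h c = inv (h' a) \<otimes> h' c"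
    proof (intro impI)
      assume ac: "0 \<le> a" "c \<le> 1"
      have split: "inv (f a) \<otimes> f c = (inv (f a) \<otimes> f b) \<otimes> (inv (f b) \<otimes> f c)"
        if f: "lift_on \<gamma> 0 1 f" for f
      proof -
        have "f a \<in> carrier H" "f b \<in> carrier H" "f c \<in> carrier H"
          using lift_on_closed[OF f] ac *(3,4) by auto
        then show ?thesis by (simp add: m_assoc[symmetric]) (simp add: m_assoc)
      qed
      have "inv (h a) \<otimes> h b = inv (h' a) \<otimes> h' b" "inv (h b) \<otimes> h c = inv (h' b) \<otimes> h' c"
        using * ac by simp_all
      then show "inv (h a) \<otimes> h c = inv (h' a) \<otimes> h' c"
        by (simp only: split[OF h] split[OF h'])
    qed
  next
    fix x :: real assume x: "0 \<le> x" "x \<le> 1"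
    then have x': "x \<in> {0..1}" by simp
    obtain e where e: "e > 0" "\<forall>s\<in>{0..1}. \<forall>s'\<in>{0..1}. \<bar>s - x\<bar> < e \<longrightarrow> \<bar>s' - x\<bar> < e \<longrightarrow> h s' = h s \<otimes> \<Theta> (\<gamma> s) (\<gamma> s')"
      using lift_onD[OF h x'] .
    obtain e' where e': "e' > 0" "\<forall>s\<in>{0..1}. \<forall>s'\<in>{0..1}. \<bar>s - x\<bar> < e' \<longrightarrow> \<bar>s' - x\<bar> < e' \<longrightarrow>
          h' s' = h' s \<otimes> \<Theta> (\<gamma> s) (\<gamma> s')"
      using lift_onD[OF h' x'] .
    have step: "inv (h a) \<otimes> h b = inv (h' a) \<otimes> h' b"
      if ab: "a \<le> x" "x \<le> b" "b - a < min e e'" "0 \<le> a" "b \<le> 1" for a b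
    proof -
      have "h b = h a \<otimes> \<Theta> (\<gamma> a) (\<gamma> b)" "h' b = h' a \<otimes> \<Theta> (\<gamma> a) (\<gamma> b)"
        using e(2)[rule_format, of a b] e'(2)[rule_format, of a b] ab x by auto
      moreover have "h a \<in> carrier H" "h' a \<in> carrier H"
        using lift_on_closed[OF h, of a] lift_on_closed[OF h', of a] ab x by auto
      ultimately show ?thesis by (simp add: m_assoc[symmetric])
    qed
    show "\<exists>d>0. \<forall>a b. a \<le> x \<and> x \<le> b \<and> b - a < d \<longrightarrow>
        0 \<le> a \<longrightarrow> b \<le> 1 \<longrightarrow> inv (h a) \<otimes> h b = inv (h' a) \<otimes> h' b"
      using e(1) e'(1) step by (metis min_less_iff_conj)
  qed simp
  then show ?thesis by simp
qed

definition holonomy :: "(real \<Rightarrow> 'a) \<Rightarrow> 'h" where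
  "holonomy \<gamma> = (SOME g. \<exists>h. lift_on \<gamma> 0 1 h \<and> g = inv (h 0) \<otimes> h 1)"

lemma holonomy_eq:
  assumes "lift_on \<gamma> 0 1 h"
  shows "holonomy \<gamma> = inv (h 0) \<otimes> h 1"
  unfolding holonomy_def
  by (rule someI2[of _ "inv (h 0) \<otimes> h 1"]) (use assms lift_on_unique in blast)+

lemma path_lift_exists:
  assumes "path \<gamma>" "path_image \<gamma> \<subseteq> M"
  obtains h where "lift_on \<gamma> 0 1 h"
  using lift_on_exists[of \<gamma>] assms by (auto simp: path_def path_image_def)

lemma holonomy_closed:
  assumes "path \<gamma>" "path_image \<gamma> \<subseteq> M"
  shows "holonomy \<gamma> \<in> carrier H"
proof -
  obtain h where h: "lift_on \<gamma> 0 1 h" using path_lift_exists[OF assms] .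
  then show ?thesis using lift_on_closed[OF h] holonomy_eq[OF h] by auto
qed

lemma lift_on_reparametrize:
  assumes h: "lift_on \<gamma> 0 1 h" and m: "m > 0" "m * a + d = 0" "m * b + d = 1"
    and eq: "\<And>t. t \<in> {a..b} \<Longrightarrow> \<gamma>' t = \<gamma> (m * t + d)"
  shows "lift_on \<gamma>' a b (\<lambda>t. h (m * t + d))"
proof -
  have mem: "m * t + d \<in> {0..1}" if "t \<in> {a..b}" for t
  proof -
    have "m * a \<le> m * t" "m * t \<le> m * b" using that m(1) by auto
    then have "0 \<le> m * t + d" "m * t + d \<le> 1" using m(2,3) by linarith+
    then show ?thesis by simp
  qed
  have loc: "\<exists>e>0. \<forall>s\<in>{a..b}. \<forall>s'\<in>{a..b}. \<bar>s - t\<bar> < e \<longrightarrow> \<bar>s' - t\<bar> < e \<longrightarrow>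
        h (m * s' + d) = h (m * s + d) \<otimes> \<Theta> (\<gamma>' s) (\<gamma>' s')" if t: "t \<in> {a..b}" for t
  proof -
    obtain e where e: "e > 0" "\<forall>s\<in>{0..1}. \<forall>s'\<in>{0..1}. \<bar>s - (m * t + d)\<bar> < e \<longrightarrow> \<bar>s' - (m * t + d)\<bar> < e \<longrightarrow> h s' = h s \<otimes> \<Theta> (\<gamma> s) (\<gamma> s')"
      using lift_onD[OF h mem[OF t]] .
    have small: "\<bar>(m * s + d) - (m * t + d)\<bar> < e" if "\<bar>s - t\<bar> < e / m" for s
    proof -
      have "\<bar>(m * s + d) - (m * t + d)\<bar> = m * \<bar>s - t\<bar>"
        using m(1) abs_mult[of m "s - t"] by (simp add: right_diff_distrib)
      also have "\<dots> < m * (e / m)" using that m(1) by (intro mult_strict_left_mono)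
      finally show ?thesis using m(1) by simp
    qed
    show ?thesis
    proof (intro exI[of _ "e / m"] conjI ballI impI)
      fix s s' assume s: "s \<in> {a..b}" "s' \<in> {a..b}" "\<bar>s - t\<bar> < e / m" "\<bar>s' - t\<bar> < e / m"
      show "h (m * s' + d) = h (m * s + d) \<otimes> \<Theta> (\<gamma>' s) (\<gamma>' s')"
        unfolding eq[OF s(1)] eq[OF s(2)]
        by (rule e(2)[rule_format, OF mem[OF s(1)] mem[OF s(2)] small[OF s(3)] small[OF s(4)]])
    qed (use e(1) m(1) in simp)
  qed
  have "h (m * t + d) \<in> carrier H" if "t \<in> {a..b}" for t
    by (rule lift_on_closed[OF h mem[OF that]])
  with loc show ?thesis unfolding lift_on_def by simp
qed

lemma holonomy_join:
  assumes f: "path f" "path_image f \<subseteq> M" and g: "path g" "path_image g \<subseteq> M"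
    and fg: "pathfinish f = pathstart g"
  shows "holonomy (f +++ g) = holonomy f \<otimes> holonomy g"
proof -
  obtain h where h: "lift_on f 0 1 h" using path_lift_exists[OF f] .
  obtain k where k: "lift_on g 0 1 k" using path_lift_exists[OF g] .
  have 1: "lift_on (f +++ g) 0 (1/2) (\<lambda>t. h (2 * t + 0))"
    by (rule lift_on_reparametrize[OF h]) (auto simp: joinpaths_def)
  have 2: "lift_on (f +++ g) (1/2) 1 (\<lambda>t. k (2 * t + (-1)))"
  proof (rule lift_on_reparametrize[OF k])
    show "(f +++ g) t = g (2 * t + (-1))" if "t \<in> {1/2..1}" for t
    proof (cases "t = 1/2")
      case True
      show ?thesis unfolding True using fg by (simp add: joinpaths_def pathfinish_def pathstart_def)
    next
      case False
      then show ?thesis using that by (simp add: joinpaths_def)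
    qed
  qed auto
  have fgM: "path (f +++ g)" "path_image (f +++ g) \<subseteq> M"
    using f g fg by (auto simp: path_image_join)
  have "lift_on (f +++ g) 0 1 (\<lambda>t. if t \<le> 1/2 then h (2 * t + 0) else
      h (2 * (1/2) + 0) \<otimes> inv (k (2 * (1/2) + (-1))) \<otimes> k (2 * t + (-1)))"
    by (rule lift_on_glue[OF _ _ _ _ 1 2]) (use fgM in \<open>auto simp: path_def path_image_def\<close>)
  from holonomy_eq[OF this]
  have "holonomy (f +++ g) = inv (h 0) \<otimes> (h 1 \<otimes> inv (k 0) \<otimes> k 1)" by simp
  then show ?thesis
    using lift_on_closed[OF h] lift_on_closed[OF k] holonomy_eq[OF h] holonomy_eq[OF k]
    by (simp add: m_assoc)
qed

text \<open>Stepping across from \<open>\<gamma> t\<close> to \<open>\<gamma>' t\<close> carries a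
  lift of one path to a lift of the other: the small square formed by two steps along the paths and
  two steps across commutes by the cocycle rule.\<close>

lemma lift_on_nearby:
  assumes h: "lift_on \<gamma> 0 1 h" and \<gamma>: "path \<gamma>" "path_image \<gamma> \<subseteq> M" and \<gamma>': "path \<gamma>'" "path_image \<gamma>' \<subseteq> M"
    and coc: "\<And>t p q s. \<lbrakk>t \<in> {0..1}; p \<in> ball (\<gamma> t) d \<inter> M; q \<in> ball (\<gamma> t) d \<inter> M; s \<in> ball (\<gamma> t) d \<inter> M\<rbrakk>
           \<Longrightarrow> \<Theta> p q \<otimes> \<Theta> q s = \<Theta> p s"
    and near: "\<And>t. t \<in> {0..1} \<Longrightarrow> dist (\<gamma> t) (\<gamma>' t) < d"
  shows "lift_on \<gamma>' 0 1 (\<lambda>t. h t \<otimes> \<Theta> (\<gamma> t) (\<gamma>' t))"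
proof -
  have hc: "h t \<in> carrier H" if "t \<in> {0..1}" for t using lift_on_closed[OF h that] .
  have M: "\<gamma> t \<in> M" "\<gamma>' t \<in> M" if "t \<in> {0..1}" for t
    using \<gamma> \<gamma>' that by (auto simp: path_image_def)
  have loc: "\<exists>e>0. \<forall>s\<in>{0..1}. \<forall>s'\<in>{0..1}. \<bar>s - t\<bar> < e \<longrightarrow> \<bar>s' - t\<bar> < e \<longrightarrow>
        h s' \<otimes> \<Theta> (\<gamma> s') (\<gamma>' s') = h s \<otimes> \<Theta> (\<gamma> s) (\<gamma>' s) \<otimes> \<Theta> (\<gamma>' s) (\<gamma>' s')"
    if t: "t \<in> {0..1}" for t
  proof -
    obtain e1 where e1: "e1 > 0" "\<forall>s\<in>{0..1}. \<forall>s'\<in>{0..1}. \<bar>s - t\<bar> < e1 \<longrightarrow> \<bar>s' - t\<bar> < e1 \<longrightarrow> h s' = h s \<otimes> \<Theta> (\<gamma> s) (\<gamma> s')"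
      using lift_onD[OF h t] .
    have "d > 0" using near[OF t] by (metis dual_order.strict_trans2 zero_le_dist)
    then obtain e2 where e2: "e2 > 0" "\<And>s::real. s \<in> {0..1} \<Longrightarrow> dist s t < e2 \<Longrightarrow> dist (\<gamma> s) (\<gamma> t) < d"
      using \<gamma>(1) t unfolding path_def continuous_on_iff by metis
    have "d - dist (\<gamma> t) (\<gamma>' t) > 0" using near[OF t] by simp
    then obtain e3 where e3: "e3 > 0"
      "\<And>s::real. s \<in> {0..1} \<Longrightarrow> dist s t < e3 \<Longrightarrow> dist (\<gamma>' s) (\<gamma>' t) < d - dist (\<gamma> t) (\<gamma>' t)"
      using \<gamma>'(1) t unfolding path_def continuous_on_iff by metis
    define e where "e = min e1 (min e2 e3)"
    have b: "\<gamma> s \<in> ball (\<gamma> t) d \<inter> M" "\<gamma>' s \<in> ball (\<gamma> t) d \<inter> M" if s: "s \<in> {0..1}" "\<bar>s - t\<bar> < e" for s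
    proof -
      have st: "dist s t < e2" "dist s t < e3" using s by (auto simp: e_def dist_real_def)
      show "\<gamma> s \<in> ball (\<gamma> t) d \<inter> M" using e2(2)[OF s(1) st(1)] M[OF s(1)] by (auto simp: dist_commute)
      have "dist (\<gamma> t) (\<gamma>' s) \<le> dist (\<gamma> t) (\<gamma>' t) + dist (\<gamma>' s) (\<gamma>' t)"
        by (metis dist_commute dist_triangle)
      also have "\<dots> < d" using e3(2)[OF s(1) st(2)] by simp
      finally show "\<gamma>' s \<in> ball (\<gamma> t) d \<inter> M" using M[OF s(1)] by auto
    qed
    have step: "h s' \<otimes> \<Theta> (\<gamma> s') (\<gamma>' s') = h s \<otimes> \<Theta> (\<gamma> s) (\<gamma>' s) \<otimes> \<Theta> (\<gamma>' s) (\<gamma>' s')"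
      if s: "s \<in> {0..1}" "s' \<in> {0..1}" "\<bar>s - t\<bar> < e" "\<bar>s' - t\<bar> < e" for s s'
    proof -
      have "h s' = h s \<otimes> \<Theta> (\<gamma> s) (\<gamma> s')"
        using e1(2)[rule_format, OF s(1,2)] s(3,4) by (simp add: e_def)
      moreover have "\<Theta> (\<gamma> s) (\<gamma> s') \<otimes> \<Theta> (\<gamma> s') (\<gamma>' s') = \<Theta> (\<gamma> s) (\<gamma>' s) \<otimes> \<Theta> (\<gamma>' s) (\<gamma>' s')"
        using coc[OF t b(1)[OF s(1,3)] b(1)[OF s(2,4)] b(2)[OF s(2,4)]]
          coc[OF t b(1)[OF s(1,3)] b(2)[OF s(1,3)] b(2)[OF s(2,4)]] by simp
      ultimately show ?thesis using hc[OF s(1)] by (simp add: m_assoc)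
    qed
    show ?thesis
      by (intro exI[of _ e] conjI ballI impI step) (use e1(1) e2(1) e3(1) in \<open>simp add: e_def\<close>)
  qed
  with hc show ?thesis unfolding lift_on_def by simp
qed

lemma cocycle_Lebesgue:
  assumes K: "compact K" "K \<subseteq> M"
  obtains d where "d > 0" "\<forall>x\<in>K. \<forall>p\<in>ball x d \<inter> M. \<forall>q\<in>ball x d \<inter> M. \<forall>s\<in>ball x d \<inter> M.
      \<Theta> p q \<otimes> \<Theta> q s = \<Theta> p s"
proof -
  define good where "good U \<longleftrightarrow> open U \<and>
    (\<forall>p\<in>U \<inter> M. \<forall>q\<in>U \<inter> M. \<forall>s\<in>U \<inter> M. \<Theta> p q \<otimes> \<Theta> q s = \<Theta> p s)" for U
  have "K \<subseteq> \<Union>(Collect good)"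
  proof
    fix x assume "x \<in> K"
    then obtain e where "e > 0" "good (ball x e)"
      using transport_cocycle[of x] K(2) by (auto simp: good_def)
    then show "x \<in> \<Union>(Collect good)" by (metis UnionI centre_in_ball mem_Collect_eq)
  qed
  then obtain d where d: "d > 0" "\<And>x. x \<in> K \<Longrightarrow> \<exists>U\<in>Collect good. ball x d \<subseteq> U"
    using Heine_Borel_lemma[OF K(1), of "Collect good"] by (auto simp: good_def)
  show ?thesis
  proof (rule that[OF d(1)], intro ballI)
    fix x p q s assume *: "x \<in> K" "p \<in> ball x d \<inter> M" "q \<in> ball x d \<inter> M" "s \<in> ball x d \<inter> M"
    obtain U where "good U" "ball x d \<subseteq> U" using d(2)[OF *(1)] by auto
    then have "p \<in> U \<inter> M" "q \<in> U \<inter> M" "s \<in> U \<inter> M" using * by auto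
    then show "\<Theta> p q \<otimes> \<Theta> q s = \<Theta> p s" using \<open>good U\<close> unfolding good_def by simp
  qed
qed

text \<open>By a Lebesgue number, close stages of the homotopy are related by
  \<open>lift_on_nearby\<close>. The ends stay fixed, so the crossing factors there are
  \<open>\<Theta> x x = \<one>\<close> and the holonomy is locally constant in the homotopy
  parameter.\<close>

lemma holonomy_homotopic:
  assumes "homotopic_paths M f g"
  shows "holonomy f = holonomy g"
proof -
  obtain k :: "real \<times> real \<Rightarrow> 'a" where k: "continuous_on ({0..1} \<times> {0..1}) k" "k \<in> ({0..1} \<times> {0..1}) \<rightarrow> M"
    and k0: "\<forall>x\<in>{0..1}. k (0, x) = f x" and k1: "\<forall>x\<in>{0..1}. k (1, x) = g x"
    and ends: "\<forall>t\<in>{0..1}. k (t, 0) = f 0 \<and> k (t, 1) = f 1"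
    using assms unfolding homotopic_paths by (auto simp: pathstart_def pathfinish_def)
  let ?K = "k ` ({0..1} \<times> {0..1})"
  have KM: "?K \<subseteq> M" using k(2) by auto
  have comp: "compact ({0..1::real} \<times> {0..1::real})" by (intro compact_Times compact_Icc)
  obtain d where d: "d > 0" "\<forall>x\<in>?K. \<forall>p\<in>ball x d \<inter> M. \<forall>q\<in>ball x d \<inter> M. \<forall>s\<in>ball x d \<inter> M.
      \<Theta> p q \<otimes> \<Theta> q s = \<Theta> p s"
    using cocycle_Lebesgue[OF compact_continuous_image[OF k(1) comp] KM] .
  obtain e where e: "e > 0" "\<And>x y. \<lbrakk>x \<in> {0..1} \<times> {0..1}; y \<in> {0..1} \<times> {0..1}; dist y x < e\<rbrakk> \<Longrightarrow> dist (k y) (k x) < d"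
    using compact_uniformly_continuous[OF k(1) comp] d(1) unfolding uniformly_continuous_on_def by metis
  define \<gamma> where "\<gamma> s = (\<lambda>x. k (s, x))" for s
  have \<gamma>: "path (\<gamma> s)" "path_image (\<gamma> s) \<subseteq> M" if "s \<in> {0..1}" for s
  proof -
    show "path (\<gamma> s)" unfolding path_def \<gamma>_def
      by (rule continuous_on_compose2[OF k(1)]) (use that in \<open>auto intro!: continuous_intros\<close>)
    show "path_image (\<gamma> s) \<subseteq> M" using k(2) that by (auto simp: path_image_def \<gamma>_def)
  qed
  have step: "holonomy (\<gamma> a) = holonomy (\<gamma> b)" if ab: "a \<in> {0..1}" "b \<in> {0..1}" "\<bar>b - a\<bar> < e" for a b
  proof -
    obtain h where h: "lift_on (\<gamma> a) 0 1 h" using path_lift_exists[OF \<gamma>[OF ab(1)]] .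
    have near: "dist (\<gamma> a t) (\<gamma> b t) < d" if "t \<in> {0..1}" for t
      using e(2)[of "(b, t)" "(a, t)"] ab that by (auto simp: \<gamma>_def dist_Pair_Pair dist_real_def)
    have l: "lift_on (\<gamma> b) 0 1 (\<lambda>t. h t \<otimes> \<Theta> (\<gamma> a t) (\<gamma> b t))"
    proof (rule lift_on_nearby[OF h \<gamma>[OF ab(1)] \<gamma>[OF ab(2)] _ near])
      fix t p q s assume *: "t \<in> {0..1}" "p \<in> ball (\<gamma> a t) d \<inter> M" "q \<in> ball (\<gamma> a t) d \<inter> M" "s \<in> ball (\<gamma> a t) d \<inter> M"
      have "\<gamma> a t \<in> ?K" using * ab by (auto simp: \<gamma>_def)
      from d(2)[rule_format, OF this *(2-4)] show "\<Theta> p q \<otimes> \<Theta> q s = \<Theta> p s" .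
    qed
    have "\<gamma> b 0 = \<gamma> a 0" "\<gamma> b 1 = \<gamma> a 1"
      using ends[rule_format, OF ab(1)] ends[rule_format, OF ab(2)] by (auto simp: \<gamma>_def)
    moreover have "\<gamma> a 0 \<in> M" "\<gamma> a 1 \<in> M"
      using \<gamma>(2)[OF ab(1)] by (auto simp: path_image_def)
    ultimately show ?thesis
      using holonomy_eq[OF h] holonomy_eq[OF l] lift_on_closed[OF h] by (simp add: cocycle_refl)
  qed
  have "0 \<le> (0::real) \<longrightarrow> (1::real) \<le> 1 \<longrightarrow> holonomy (\<gamma> 0) = holonomy (\<gamma> 1)"
  proof (rule Bolzano[where P = "\<lambda>a b. 0 \<le> a \<longrightarrow> b \<le> 1 \<longrightarrow> holonomy (\<gamma> a) = holonomy (\<gamma> b)"])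
    fix x :: real
    show "\<exists>d>0. \<forall>a b. a \<le> x \<and> x \<le> b \<and> b - a < d \<longrightarrow> 0 \<le> a \<longrightarrow> b \<le> 1 \<longrightarrow> holonomy (\<gamma> a) = holonomy (\<gamma> b)"
      using step e(1) by (intro exI[of _ e]) auto
  qed auto
  \<comment> \<open>The stages of the homotopy agree with \<open>f\<close> and \<open>g\<close> only
    on the unit interval, which is all that the holonomy reads.\<close>
  moreover have cong: "holonomy (\<gamma> s) = holonomy f'" if "s \<in> {0..1}" "\<And>x. x \<in> {0..1} \<Longrightarrow> k (s, x) = f' x" for s f'
    unfolding holonomy_def lift_on_def \<gamma>_def using that(2) by simp
  moreover have "holonomy (\<gamma> 0) = holonomy f" by (rule cong) (use k0 in auto)
  moreover have "holonomy (\<gamma> 1) = holonomy g" by (rule cong) (use k1 in auto)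
  ultimately show ?thesis by simp
qed

definition class_holonomy :: "(real \<Rightarrow> 'a) set \<Rightarrow> 'h" where
  "class_holonomy X = holonomy (SOME f. f \<in> X)"

lemma class_holonomy_eq:
  assumes "f \<in> loops_at M p"
  shows "class_holonomy (Collect (homotopic_paths M f)) = holonomy f"
  unfolding class_holonomy_def
proof (rule someI2[of _ f])
  show "f \<in> Collect (homotopic_paths M f)" using assms by (auto simp: loops_at_def)
  show "holonomy g = holonomy f" if "g \<in> Collect (homotopic_paths M f)" for g
    using holonomy_homotopic[of f g] that by simp
qed

lemma class_holonomy_hom: "class_holonomy \<in> hom (fundamental_group M p) H"
proof (rule homI)
  fix X assume "X \<in> carrier (fundamental_group M p)"
  then obtain f where f: "f \<in> loops_at M p" "X = Collect (homotopic_paths M f)"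
    by (auto simp: carrier_fundamental_group)
  then show "class_holonomy X \<in> carrier H"
    using holonomy_closed[of f] by (auto simp: class_holonomy_eq[OF f(1)] loops_at_def)
  fix Y assume "Y \<in> carrier (fundamental_group M p)"
  then obtain g where g: "g \<in> loops_at M p" "Y = Collect (homotopic_paths M g)"
    by (auto simp: carrier_fundamental_group)
  have fg: "f +++ g \<in> loops_at M p" using f g by (auto simp: loops_at_def path_image_join)
  show "class_holonomy (X \<otimes>\<^bsub>fundamental_group M p\<^esub> Y) = class_holonomy X \<otimes> class_holonomy Y"
    unfolding f(2) g(2) homotopy_class_mult[OF f(1) g(1)]
      class_holonomy_eq[OF f(1)] class_holonomy_eq[OF g(1)] class_holonomy_eq[OF fg]
    by (rule holonomy_join) (use f g in \<open>auto simp: loops_at_def\<close>)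
qed

end

section \<open>Heisenberg holonomy of an inscribed polygon\<close>

lemma two_variable_primitive:
  fixes A1 A2 X :: "complex \<Rightarrow> complex \<Rightarrow> complex"
  assumes U: "open U" "convex U" and V: "open V" "convex V" and u0: "u0 \<in> U" and v0: "v0 \<in> V"
    and A1u: "\<And>v. v \<in> V \<Longrightarrow> (\<lambda>u. A1 u v) holomorphic_on U"
    and A2v: "\<And>u. u \<in> U \<Longrightarrow> A2 u holomorphic_on V"
    and dA1: "\<And>u v. u \<in> U \<Longrightarrow> v \<in> V \<Longrightarrow> (A1 u has_field_derivative X u v) (at v)"
    and dA2: "\<And>u v. u \<in> U \<Longrightarrow> v \<in> V \<Longrightarrow> ((\<lambda>u. A2 u v) has_field_derivative X u v) (at u)"
    and X: "continuous_on (U \<times> V) (\<lambda>(u, v). X u v)"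
  shows "\<exists>J. \<forall>u\<in>U. \<forall>v\<in>V. ((\<lambda>u. J u v) has_field_derivative A1 u v) (at u) \<and>
    (J u has_field_derivative A2 u v) (at v)"
proof -
  obtain P where P: "\<And>u. u \<in> U \<Longrightarrow> (P has_field_derivative A1 u v0) (at u within U)"
    using holomorphic_convex_primitive'[OF U(2,1) A1u[OF v0]] by blast
  \<comment> \<open>The primitive integrates A1 du + A2 dv from (u0, v0) to (u, v0) and on to (u,
    v): \<open>P\<close> is the first leg up to a constant, \<open>G\<close> the second. The common
    mixed derivative \<open>X\<close> expresses that the form is closed.\<close>
  define G where "G u v = contour_integral (linepath v0 v) (A2 u)" for u v
  have seg: "closed_segment v0 v \<subseteq> V" if "v \<in> V" for v
    using that v0 V(2) closed_segment_subset by blast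
  have Gv: "(G u has_field_derivative A2 u v) (at v)" if uv: "u \<in> U" "v \<in> V" for u v
  proof -
    obtain g where g: "\<And>v. v \<in> V \<Longrightarrow> (g has_field_derivative A2 u v) (at v within V)"
      using holomorphic_convex_primitive'[OF V(2,1) A2v[OF uv(1)]] by blast
    have Gg: "G u x = g x - g v0" if "x \<in> V" for x
      unfolding G_def using contour_integral_primitive[OF g valid_path_linepath] seg[OF that] that
      by (intro contour_integral_unique) force
    have "((\<lambda>x. g x - g v0) has_field_derivative A2 u v - 0) (at v)"
      using g[OF uv(2)] at_within_open[OF uv(2) V(1)] by (intro derivative_intros) auto
    then have "((\<lambda>x. g x - g v0) has_field_derivative A2 u v) (at v)" by simp
    then show ?thesis
      by (rule has_field_derivative_transform_within_open[OF _ V(1) uv(2)]) (simp add: Gg)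
  qed
  have Gu: "((\<lambda>u. G u v) has_field_derivative A1 u v - A1 u v0) (at u)" if uv: "u \<in> U" "v \<in> V" for u v
  proof -
    have lp: "linepath v0 v t \<in> V" if "t \<in> {0..1}" for t
      using seg[OF uv(2)] that by (auto simp: linepath_in_path)
    have cX: "continuous_on (U \<times> cbox 0 1) (\<lambda>(u, t). X u (linepath v0 v t) * (v - v0))"
    proof -
      have "continuous_on (U \<times> cbox 0 (1::real)) (\<lambda>z. (case (fst z, linepath v0 v (snd z)) of (u, v) \<Rightarrow> X u v))"
        by (rule continuous_on_compose2[OF X]) (use lp in \<open>auto intro!: continuous_intros simp: linepath_def\<close>)
      then show ?thesis by (auto simp: case_prod_unfold intro!: continuous_intros)
    qed
    have int: "(\<lambda>t. A2 u (linepath v0 v t) * (v - v0)) integrable_on cbox 0 1" if "u \<in> U" for u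
    proof (rule integrable_continuous)
      have "continuous_on {0..1} (\<lambda>t. A2 u (linepath v0 v t))"
        by (rule continuous_on_compose2[OF holomorphic_on_imp_continuous_on[OF A2v[OF that]] continuous_on_linepath])
           (use lp in auto)
      then show "continuous_on (cbox 0 1) (\<lambda>t. A2 u (linepath v0 v t) * (v - v0))"
        by (simp add: continuous_on_mult_right)
    qed
    \<comment> \<open>Differentiation under the integral sign replaces \<open>A2\<close> by
      \<open>X\<close>, and integrating \<open>X\<close> in v gives the increment of
      \<open>A1 u\<close>. This is exactly what the derivative of \<open>P\<close>, taken at v0, is
      lacking at v.\<close>
    have "((\<lambda>u. integral (cbox 0 1) (\<lambda>t. A2 u (linepath v0 v t) * (v - v0))) has_field_derivative
       integral (cbox 0 1) (\<lambda>t. X u (linepath v0 v t) * (v - v0))) (at u within U)"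
    proof (rule leibniz_rule_field_derivative[OF _ int cX uv(1) U(2)])
      fix x t assume "x \<in> U" "t \<in> cbox 0 (1::real)"
      then have "linepath v0 v t \<in> V" "x \<in> U" using lp by auto
      then have "((\<lambda>u. A2 u (linepath v0 v t)) has_field_derivative X x (linepath v0 v t)) (at x within U)"
        by (intro has_field_derivative_at_within[OF dA2])
      then show "((\<lambda>u. A2 u (linepath v0 v t) * (v - v0)) has_field_derivative
          X x (linepath v0 v t) * (v - v0)) (at x within U)"
        by (rule DERIV_cmult_right)
    qed auto
    moreover have "integral (cbox 0 1) (\<lambda>t. X u (linepath v0 v t) * (v - v0)) = A1 u v - A1 u v0"
    proof -
      have "(X u has_contour_integral A1 u (pathfinish (linepath v0 v)) - A1 u (pathstart (linepath v0 v))) (linepath v0 v)"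
      proof (rule contour_integral_primitive[where S = V])
        show "(A1 u has_field_derivative X u x) (at x within V)" if "x \<in> V" for x
          by (rule has_field_derivative_at_within[OF dA1[OF uv(1) that]])
      qed (use seg[OF uv(2)] in auto)
      then show ?thesis
        using contour_integral_unique by (fastforce simp: contour_integral_integral vector_derivative_linepath_at has_contour_integral_linepath)
    qed
    moreover have "G u = (\<lambda>v. integral (cbox 0 1) (\<lambda>t. A2 u (linepath v0 v t) * (v - v0)))" for u
      by (auto simp: G_def contour_integral_integral)
    ultimately show ?thesis
      using at_within_open[OF uv(1) U(1)] by simp
  qed
  show ?thesis
  proof (intro exI[of _ "\<lambda>u v. P u + G u v"] ballI conjI)
    fix u v assume uv: "u \<in> U" "v \<in> V"
    have "((\<lambda>u. P u + G u v) has_field_derivative A1 u v0 + (A1 u v - A1 u v0)) (at u)"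
      using P[OF uv(1)] Gu[OF uv] at_within_open[OF uv(1) U(1)] by (intro derivative_intros) auto
    then show "((\<lambda>u. P u + G u v) has_field_derivative A1 u v) (at u)" by simp
    have "((\<lambda>v. P u + G u v) has_field_derivative 0 + A2 u v) (at v)"
      using Gv[OF uv] by (intro derivative_intros) auto
    then show "((\<lambda>v. P u + G u v) has_field_derivative A2 u v) (at v)" by simp
  qed
qed

lemma constant_of_zero_partials:
  fixes f :: "complex \<Rightarrow> complex \<Rightarrow> complex"
  assumes U: "open U" "convex U" and V: "open V" "convex V"
    and fu: "\<And>u v. u \<in> U \<Longrightarrow> v \<in> V \<Longrightarrow> ((\<lambda>u. f u v) has_field_derivative 0) (at u)"
    and fv: "\<And>u v. u \<in> U \<Longrightarrow> v \<in> V \<Longrightarrow> (f u has_field_derivative 0) (at v)"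
    and p: "u \<in> U" "v \<in> V" and q: "u' \<in> U" "v' \<in> V"
  shows "f u v = f u' v'"
proof -
  obtain c where "\<And>x. x \<in> U \<Longrightarrow> f x v = c"
    using has_field_derivative_zero_constant[OF U(2), of "\<lambda>u. f u v"] fu p(2)
    by (metis has_field_derivative_at_within)
  moreover obtain d where "\<And>y. y \<in> V \<Longrightarrow> f u' y = d"
    using has_field_derivative_zero_constant[OF V(2), of "f u'"] fv q(1)
    by (metis has_field_derivative_at_within)
  ultimately show ?thesis using p q by metis
qed

section \<open>A Heisenberg group built from the cycle of edges\<close>

definition heis_form :: "nat \<Rightarrow> (nat \<Rightarrow> complex) \<Rightarrow> (nat \<Rightarrow> complex) \<Rightarrow> complex" where
  "heis_form N a b = (\<Sum>i<N. (-1) ^ i * a i * (b (Suc i mod N) - b N))"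

text \<open>The central extension of the additive group of sequences by \<complex> with the bilinear
  cocycle \<open>heis_form\<close>, which reads only the coordinates up to \<open>N\<close>. Two
  elements commute exactly when the cocycle is symmetric on their first components.\<close>

definition heis :: "nat \<Rightarrow> ((nat \<Rightarrow> complex) \<times> complex) monoid" where
  "heis N = \<lparr>carrier = UNIV,
     monoid.mult = (\<lambda>x y. (\<lambda>i. fst x i + fst y i, snd x + snd y + heis_form N (fst x) (fst y))),
     one = (\<lambda>i. 0, 0)\<rparr>"

lemma heis_form_linear:
  "heis_form N (\<lambda>i. a i + a' i) b = heis_form N a b + heis_form N a' b"
  "heis_form N a (\<lambda>i. b i + b' i) = heis_form N a b + heis_form N a b'"
  "heis_form N (\<lambda>i. - a i) b = - heis_form N a b"
  "heis_form N (\<lambda>i. 0) b = 0" "heis_form N a (\<lambda>i. 0) = 0"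
  by (simp_all add: heis_form_def sum.distrib[symmetric] sum_negf[symmetric] algebra_simps)

lemma group_heis: "group (heis N)"
proof (rule groupI)
  show "\<exists>y\<in>carrier (heis N). y \<otimes>\<^bsub>heis N\<^esub> x = \<one>\<^bsub>heis N\<^esub>" for x
    by (rule bexI[of _ "(\<lambda>i. - fst x i, - snd x + heis_form N (fst x) (fst x))"])
       (auto simp: heis_def heis_form_linear)
qed (auto simp: heis_def heis_form_linear)

lemma fst_heis_mult: "fst (x \<otimes>\<^bsub>heis N\<^esub> y) i = fst x i + fst y i"
  by (simp add: heis_def)

lemma snd_heis_mult: "snd (x \<otimes>\<^bsub>heis N\<^esub> y) = snd x + snd y + heis_form N (fst x) (fst y)"
  by (simp add: heis_def)

lemma carrier_heis [simp]: "carrier (heis N) = UNIV"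
  by (simp add: heis_def)

lemma fst_heis_inv: "fst (inv\<^bsub>heis N\<^esub> x) i = - fst x i"
proof -
  interpret group "heis N" by (rule group_heis)
  have "fst (inv\<^bsub>heis N\<^esub> x \<otimes>\<^bsub>heis N\<^esub> x) i = 0"
    by (subst l_inv) (simp_all add: heis_def)
  then show ?thesis unfolding fst_heis_mult by (simp add: eq_neg_iff_add_eq_0)
qed

text \<open>Each \<open>g j\<close> occurs twice, at \<open>i = j\<close> and at the cyclic
  predecessor of \<open>j\<close>, with opposite signs. For even \<open>N\<close> this remains true
  across the wrap-around, and the constants cancel as well.\<close>

lemma cyclic_alternating_sum:
  fixes g :: "nat \<Rightarrow> complex"
  assumes "even N" "N > 0"
  shows "(\<Sum>i<N. (-1) ^ i * (1 - g i - g (Suc i mod N))) = 0"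
proof -
  obtain m where N: "N = Suc m" using assms(2) by (cases N) auto
  have m: "odd m" using assms(1) N by simp
  have one: "(\<Sum>i<N. (-1) ^ i) = (0::complex)"
  proof -
    have "(\<Sum>i<2 * k. (-1) ^ i) = (0::complex)" for k by (induction k) auto
    then show ?thesis using assms(1) by (metis evenE)
  qed
  have 1: "(\<Sum>i<N. (-1) ^ i * g i) = g 0 - (\<Sum>i<m. (-1) ^ i * g (Suc i))"
    unfolding N by (subst sum.lessThan_Suc_shift) (simp add: sum_negf)
  have 2: "(\<Sum>i<N. (-1) ^ i * g (Suc i mod N)) = (\<Sum>i<m. (-1) ^ i * g (Suc i)) - g 0"
    unfolding N using m by simp
  have "(\<Sum>i<N. (-1) ^ i * (1 - g i - g (Suc i mod N))) =
      (\<Sum>i<N. (-1) ^ i) - (\<Sum>i<N. (-1) ^ i * g i) - (\<Sum>i<N. (-1) ^ i * g (Suc i mod N))"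
    by (simp add: right_diff_distrib sum_subtractf)
  then show ?thesis using one 1 2 by simp
qed

text \<open>In the coordinates \<open>u = x + iy\<close>, \<open>v = x - iy\<close> the conic is \<open>uv = 1\<close>, the vertex \<open>t\<close> is the
  point \<open>(t, 1/t)\<close>, and the index \<open>N\<close> stands for the conic.\<close>

locale inscribed =
  fixes N :: nat and t :: "nat \<Rightarrow> complex"
  assumes even_N: "even N" and N_ge: "N \<ge> 6"
    and periodic: "t (j mod N) = t j"
    and t_nonzero: "t j \<noteq> 0"
    and t_inj: "\<lbrakk>i < N; j < N; t i = t j\<rbrakk> \<Longrightarrow> i = j"
    and not_parallel: "\<lbrakk>i < N; j < N; t i * t (Suc i) = t j * t (Suc j)\<rbrakk> \<Longrightarrow> i = j"
begin

section \<open>Logarithmic derivatives of the edge and conic equations\<close>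

definition eqn :: "nat \<Rightarrow> complex \<times> complex \<Rightarrow> complex" where
  "eqn j q = (if j < N then fst q + t j * t (Suc j) * snd q - (t j + t (Suc j)) else fst q * snd q - 1)"

definition compl :: "(complex \<times> complex) set" where
  "compl = {q. \<forall>j\<le>N. eqn j q \<noteq> 0}"

definition logu :: "nat \<Rightarrow> complex \<times> complex \<Rightarrow> complex" where
  "logu j q = (if j < N then 1 else snd q) / eqn j q"

definition logv :: "nat \<Rightarrow> complex \<times> complex \<Rightarrow> complex" where
  "logv j q = (if j < N then t j * t (Suc j) else fst q) / eqn j q"

text \<open>The mixed second derivative of the logarithm of an equation. For the conic Q = uv - 1
  the numerator is Q - uv = -1.\<close>

definition loguv :: "nat \<Rightarrow> complex \<times> complex \<Rightarrow> complex" where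
  "loguv j q = - (if j < N then t j * t (Suc j) else 1) / (eqn j q)\<^sup>2"

text \<open>\<open>formu\<close> and \<open>formv\<close> are the components of the equation dJ =
  heis_form(l, dl). It is preserved by left translation, since translating by (a, c) replaces l by a
  + l and J by c + J + heis_form(a, l).\<close>

definition formu :: "complex \<times> complex \<Rightarrow> (nat \<Rightarrow> complex) \<Rightarrow> complex" where
  "formu q l = heis_form N l (\<lambda>j. logu j q)"

definition formv :: "complex \<times> complex \<Rightarrow> (nat \<Rightarrow> complex) \<Rightarrow> complex" where
  "formv q l = heis_form N l (\<lambda>j. logv j q)"

lemma t_Suc_mod: "t (Suc (j mod N)) = t (Suc j)"
  by (metis mod_Suc_eq periodic)

lemma eqn_Suc_mod: "eqn (Suc i mod N) q = fst q + t (Suc i) * t (Suc (Suc i)) * snd q - (t (Suc i) + t (Suc (Suc i)))"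
  using N_ge by (simp add: eqn_def periodic t_Suc_mod)

lemma eqn_derivs:
  "((\<lambda>u. eqn j (u, v)) has_field_derivative (if j < N then 1 else v)) (at u)"
  "((\<lambda>v. eqn j (u, v)) has_field_derivative (if j < N then t j * t (Suc j) else u)) (at v)"
  by (auto simp: eqn_def intro!: derivative_eq_intros)

lemma continuous_eqn [continuous_intros]: "continuous_on S f \<Longrightarrow> continuous_on S (\<lambda>x. eqn j (f x))"
  by (cases "j < N") (auto simp: eqn_def intro!: continuous_intros)

lemma logu_deriv:
  assumes "eqn j (u, v) \<noteq> 0"
  shows "((\<lambda>v. logu j (u, v)) has_field_derivative loguv j (u, v)) (at v)"
proof (cases "j < N")
  case True
  have "((\<lambda>v. 1 / eqn j (u, v)) has_field_derivative - (t j * t (Suc j)) / (eqn j (u, v))\<^sup>2) (at v)"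
    using eqn_derivs(2)[of j u v] assms True
    by (auto intro!: derivative_eq_intros simp: power2_eq_square)
  then show ?thesis using True by (simp add: logu_def loguv_def)
next
  case False
  have "((\<lambda>v. v / eqn j (u, v)) has_field_derivative (1 * eqn j (u, v) - v * u) / (eqn j (u, v) * eqn j (u, v))) (at v)"
    using eqn_derivs(2)[of j u v] assms False by (intro DERIV_divide DERIV_ident) auto
  moreover have "1 * eqn j (u, v) - v * u = -1" using False by (simp add: eqn_def)
  ultimately show ?thesis using False by (simp add: logu_def loguv_def power2_eq_square)
qed

lemma logv_deriv:
  assumes "eqn j (u, v) \<noteq> 0"
  shows "((\<lambda>u. logv j (u, v)) has_field_derivative loguv j (u, v)) (at u)"
proof (cases "j < N")
  case True
  have "((\<lambda>u. (t j * t (Suc j)) / eqn j (u, v)) has_field_derivative - (t j * t (Suc j)) / (eqn j (u, v))\<^sup>2) (at u)"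
    using eqn_derivs(1)[of j v u] assms True
    by (auto intro!: derivative_eq_intros simp: power2_eq_square)
  then show ?thesis using True by (simp add: logv_def loguv_def)
next
  case False
  have "((\<lambda>u. u / eqn j (u, v)) has_field_derivative (1 * eqn j (u, v) - u * v) / (eqn j (u, v) * eqn j (u, v))) (at u)"
    using eqn_derivs(1)[of j v u] assms False by (intro DERIV_divide DERIV_ident) auto
  moreover have "1 * eqn j (u, v) - u * v = -1" using False by (simp add: eqn_def)
  ultimately show ?thesis using False by (simp add: logv_def loguv_def power2_eq_square)
qed

text \<open>The two sides are the two mixed products in the exterior square of the form
  \<open>\<Sum>\<^sub>i (-1)\<^sup>i dlog f\<^sub>i \<and> dlog (f\<^sub>i\<^sub>+\<^sub>1 / Q)\<close>, which vanishes because
  \<open>(w\<^sub>i\<^sub>+\<^sub>1 - w\<^sub>i) Q = (u - t\<^sub>i) f\<^sub>i\<^sub>+\<^sub>1 - (u - t\<^sub>i\<^sub>+\<^sub>2) f\<^sub>i\<close> where \<open>w\<^sub>i = t\<^sub>i t\<^sub>i\<^sub>+\<^sub>1\<close>.\<close>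

lemma log_form_relation:
  assumes q: "q \<in> compl"
  shows "heis_form N (\<lambda>j. logv j q) (\<lambda>j. logu j q) = heis_form N (\<lambda>j. logu j q) (\<lambda>j. logv j q)"
proof -
  obtain u v where uv: "q = (u, v)" by (cases q)
  define Q where "Q = u * v - 1"
  \<comment> \<open>The choice of \<open>g\<close> turns each summand into (1 - g i - g (i + 1)) / Q
    with the index taken cyclically, so that the alternating sum cancels around the polygon.\<close>
  define g where "g i = (u - t (Suc i)) / eqn i q" for i
  have nz: "eqn j q \<noteq> 0" if "j \<le> N" for j using q that by (simp add: compl_def)
  have QN: "Q \<noteq> 0" "eqn N q = Q" using nz[of N] by (auto simp: eqn_def Q_def uv)
  have g_mod: "g (Suc i mod N) = (u - t (Suc (Suc i))) / eqn (Suc i mod N) q" for i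
    by (simp add: g_def t_Suc_mod)
  have summand: "logu i q * (logv (Suc i mod N) q - logv N q) - logv i q * (logu (Suc i mod N) q - logu N q)
      = (1 - g i - g (Suc i mod N)) / Q" if i: "i < N" for i
  proof -
    define a b c where abc: "a = t i" "b = t (Suc i)" "c = t (Suc (Suc i))"
    define e f where ef: "e = eqn i q" "f = eqn (Suc i mod N) q"
    have m: "Suc i mod N < N" using N_ge by simp
    have e: "e = u + a * b * v - (a + b)" using i by (simp add: ef eqn_def uv abc)
    have f: "f = u + b * c * v - (b + c)" by (simp add: ef eqn_Suc_mod uv abc)
    have nz': "e \<noteq> 0" "f \<noteq> 0" using nz[of i] nz[of "Suc i mod N"] i m by (auto simp: ef)
    have l: "logu i q = 1 / e" "logv i q = a * b / e" "logu (Suc i mod N) q = 1 / f"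
      "logv (Suc i mod N) q = b * c / f" "logu N q = v / Q" "logv N q = u / Q"
      "g i = (u - b) / e" "g (Suc i mod N) = (u - c) / f"
      using i m QN by (simp_all add: logu_def logv_def ef abc uv periodic t_Suc_mod g_mod) (simp_all add: g_def ef abc uv)
    have poly: "(b * c * Q - u * f) - a * b * (Q - v * f) = e * f - (u - b) * f - (u - c) * e"
      unfolding e f Q_def by algebra
    have "logu i q * (logv (Suc i mod N) q - logv N q) - logv i q * (logu (Suc i mod N) q - logu N q)
        = ((b * c * Q - u * f) - a * b * (Q - v * f)) / (e * f * Q)"
      unfolding l using nz' QN(1) by (simp add: field_simps)
    also have "\<dots> = (1 - g i - g (Suc i mod N)) / Q"
      unfolding poly l using nz' QN(1) by (simp add: field_simps)
    finally show ?thesis .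
  qed
  have "heis_form N (\<lambda>j. logu j q) (\<lambda>j. logv j q) - heis_form N (\<lambda>j. logv j q) (\<lambda>j. logu j q)
      = (\<Sum>i<N. (-1) ^ i * (logu i q * (logv (Suc i mod N) q - logv N q) - logv i q * (logu (Suc i mod N) q - logu N q)))"
    by (simp add: heis_form_def sum_subtractf[symmetric] right_diff_distrib mult.assoc)
  also have "\<dots> = (\<Sum>i<N. (-1) ^ i * (1 - g i - g (Suc i mod N))) / Q"
    unfolding sum_divide_distrib using summand by (intro sum.cong) auto
  also have "\<dots> = 0"
    using cyclic_alternating_sum[OF even_N, of g] N_ge by simp
  finally show ?thesis by simp
qed

text \<open>Here \<open>l\<close> consists of logarithms of the equations, and \<open>(l, J)\<close> is a local primitive of the
  Heisenberg-valued connection form.\<close>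

definition developing :: "complex set \<Rightarrow> complex set \<Rightarrow> (complex \<Rightarrow> complex \<Rightarrow> nat \<Rightarrow> complex) \<Rightarrow> (complex \<Rightarrow> complex \<Rightarrow> complex) \<Rightarrow> bool" where
  "developing U V l J \<longleftrightarrow> open U \<and> convex U \<and> open V \<and> convex V \<and> U \<times> V \<subseteq> compl \<and>
     (\<forall>j. continuous_on (U \<times> V) (\<lambda>(u, v). l u v j)) \<and>
     (\<forall>u\<in>U. \<forall>v\<in>V. (\<forall>j>N. l u v j = 0) \<and>
       (\<forall>j\<le>N. exp (l u v j) = eqn j (u, v) \<and> ((\<lambda>u. l u v j) has_field_derivative logu j (u, v)) (at u) \<and>
          ((\<lambda>v. l u v j) has_field_derivative logv j (u, v)) (at v)) \<and>
       ((\<lambda>u. J u v) has_field_derivative formu (u, v) (l u v)) (at u) \<and>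
       ((\<lambda>v. J u v) has_field_derivative formv (u, v) (l u v)) (at v))"

text \<open>Near a point of the complement all equations have holomorphic logarithms
  \<open>l\<close>. The form heis_form(l, dl) is closed by \<open>log_form_relation\<close>, hence
  has a primitive \<open>J\<close> on a product of balls.\<close>

lemma developing_exists:
  assumes "(u0, v0) \<in> compl"
  obtains r l J where "r > 0" "developing (ball u0 r) (ball v0 r) l J"
proof -
  \<comment> \<open>Dividing by the value at the centre moves each equation near 1, away from the
    branch cut of \<open>Ln\<close>; the summand \<open>Ln (c j)\<close> later restores the correct
    exponential.\<close>
  define c where "c j = eqn j (u0, v0)" for j
  have c: "c j \<noteq> 0" if "j \<le> N" for j using assms that by (auto simp: compl_def c_def)
  have "\<exists>r>0. \<forall>u\<in>ball u0 r. \<forall>v\<in>ball v0 r. norm (eqn j (u, v) / c j - 1) < 1" if j: "j \<le> N" for j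
  proof -
    have "continuous_on UNIV (\<lambda>q. eqn j q / c j - 1)" using c[OF j] by (intro continuous_intros) auto
    then have op: "open ((\<lambda>q. eqn j q / c j - 1) -` ball 0 1)"
      by (intro open_vimage) auto
    have mem: "(u0, v0) \<in> (\<lambda>q. eqn j q / c j - 1) -` ball 0 1" using c[OF j] by (auto simp: c_def)
    obtain A B where AB0: "open A" "open B" "(u0, v0) \<in> A \<times> B" "A \<times> B \<subseteq> (\<lambda>q. eqn j q / c j - 1) -` ball 0 1"
      using open_prod_elim[OF op mem] .
    then have AB: "open A" "open B" "u0 \<in> A" "v0 \<in> B" "A \<times> B \<subseteq> (\<lambda>q. eqn j q / c j - 1) -` ball 0 1"
      by auto
    obtain r1 r2 where r: "r1 > 0" "r2 > 0" "ball u0 r1 \<subseteq> A" "ball v0 r2 \<subseteq> B"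
      using AB(1-4) by (meson open_contains_ball)
    show ?thesis
    proof (intro exI[of _ "min r1 r2"] conjI ballI)
      fix u v assume "u \<in> ball u0 (min r1 r2)" "v \<in> ball v0 (min r1 r2)"
      then have "(u, v) \<in> A \<times> B" using r by auto
      then show "norm (eqn j (u, v) / c j - 1) < 1" using AB(5) by fastforce
    qed (use r in auto)
  qed
  then obtain r where r: "\<And>j. j \<le> N \<Longrightarrow> r j > 0"
    "\<And>j u v. j \<le> N \<Longrightarrow> u \<in> ball u0 (r j) \<Longrightarrow> v \<in> ball v0 (r j) \<Longrightarrow> norm (eqn j (u, v) / c j - 1) < 1"
    by metis
  define R where "R = Min (r ` {..N})"
  have R: "R > 0" "R \<le> r j" if "j \<le> N" for j
    using r(1) that by (auto simp: R_def)
  have R0: "R > 0" using R(1)[of 0] by simp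
  let ?U = "ball u0 R" and ?V = "ball v0 R"
  have near: "norm (eqn j (u, v) / c j - 1) < 1" if "j \<le> N" "u \<in> ?U" "v \<in> ?V" for j u v
    using r(2)[OF that(1)] that R(2)[OF that(1)] by auto
  have slit: "eqn j (u, v) / c j \<notin> \<real>\<^sub>\<le>\<^sub>0" if "j \<le> N" "u \<in> ?U" "v \<in> ?V" for j u v
  proof
    assume "eqn j (u, v) / c j \<in> \<real>\<^sub>\<le>\<^sub>0"
    then have "Re (eqn j (u, v) / c j) \<le> 0" by (auto simp: complex_nonpos_Reals_iff)
    then have "1 \<le> \<bar>Re (eqn j (u, v) / c j - 1)\<bar>" by simp
    also have "\<dots> \<le> norm (eqn j (u, v) / c j - 1)" by (rule abs_Re_le_cmod)
    finally show False using near[OF that] by simp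
  qed
  have nz: "eqn j (u, v) \<noteq> 0" if "j \<le> N" "u \<in> ?U" "v \<in> ?V" for j u v
    using slit[OF that] by auto
  define l where "l u v j = (if j \<le> N then Ln (eqn j (u, v) / c j) + Ln (c j) else 0)" for u v j
  have lu: "((\<lambda>u. l u v j) has_field_derivative logu j (u, v)) (at u)"
    if "j \<le> N" "u \<in> ?U" "v \<in> ?V" for j u v
  proof -
    have "inverse (eqn j (u, v) / c j) * ((if j < N then 1 else v) / c j) + 0 = logu j (u, v)"
      using c[OF that(1)] nz[OF that] by (simp add: logu_def)
    moreover have "(\<lambda>u. l u v j) = (\<lambda>u. Ln (eqn j (u, v) / c j) + Ln (c j))"
      using that(1) by (simp add: l_def)
    moreover have "((\<lambda>u. Ln (eqn j (u, v) / c j) + Ln (c j)) has_field_derivative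
        inverse (eqn j (u, v) / c j) * ((if j < N then 1 else v) / c j) + 0) (at u)"
      by (intro DERIV_add DERIV_const DERIV_chain2[where f = Ln and g = "\<lambda>u. eqn j (u, v) / c j"]
          has_field_derivative_Ln[OF slit[OF that]] DERIV_cdivide eqn_derivs)
    ultimately show ?thesis by simp
  qed
  have lv: "((\<lambda>v. l u v j) has_field_derivative logv j (u, v)) (at v)"
    if "j \<le> N" "u \<in> ?U" "v \<in> ?V" for j u v
  proof -
    have "inverse (eqn j (u, v) / c j) * ((if j < N then t j * t (Suc j) else u) / c j) + 0 = logv j (u, v)"
      using c[OF that(1)] nz[OF that] by (simp add: logv_def)
    moreover have "(\<lambda>v. l u v j) = (\<lambda>v. Ln (eqn j (u, v) / c j) + Ln (c j))"
      using that(1) by (simp add: l_def)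
    moreover have "((\<lambda>v. Ln (eqn j (u, v) / c j) + Ln (c j)) has_field_derivative
        inverse (eqn j (u, v) / c j) * ((if j < N then t j * t (Suc j) else u) / c j) + 0) (at v)"
      by (intro DERIV_add DERIV_const DERIV_chain2[where f = Ln and g = "\<lambda>v. eqn j (u, v) / c j"]
          has_field_derivative_Ln[OF slit[OF that]] DERIV_cdivide eqn_derivs)
    ultimately show ?thesis by simp
  qed
  have lc: "continuous_on (?U \<times> ?V) (\<lambda>(u, v). l u v j)" for j
  proof (cases "j \<le> N")
    case True
    have "continuous_on (?U \<times> ?V) (\<lambda>q. Ln (eqn j q / c j) + Ln (c j))"
      using c[OF True] slit[OF True] by (intro continuous_intros) auto
    then show ?thesis using True by (simp add: l_def case_prod_unfold)
  qed (simp add: l_def case_prod_unfold)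
  have lexp: "exp (l u v j) = eqn j (u, v)" if "j \<le> N" "u \<in> ?U" "v \<in> ?V" for j u v
    using that c nz[OF that] by (simp add: l_def exp_add)
  have sub: "?U \<times> ?V \<subseteq> compl" using nz by (auto simp: compl_def)
  have idx: "i \<le> N" "Suc i mod N \<le> N" if "i < N" for i using that N_ge by (auto simp: less_imp_le)
  define X where "X u v = (\<Sum>i<N. (-1) ^ i * (logv i (u, v) * (logu (Suc i mod N) (u, v) - logu N (u, v))
      + (loguv (Suc i mod N) (u, v) - loguv N (u, v)) * l u v i))" for u v
  \<comment> \<open>\<open>X\<close> is written as the v-derivative of \<open>formu\<close>, the
    right side here is the u-derivative of \<open>formv\<close>. Their terms in \<open>loguv\<close>
    coincide, and the remaining terms are the two sides of \<open>log_form_relation\<close>.\<close>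
  have X': "X u v = (\<Sum>i<N. (-1) ^ i * (logu i (u, v) * (logv (Suc i mod N) (u, v) - logv N (u, v))
      + (loguv (Suc i mod N) (u, v) - loguv N (u, v)) * l u v i))" if "u \<in> ?U" "v \<in> ?V" for u v
  proof -
    have "(u, v) \<in> compl" using that sub by blast
    then show ?thesis
      using log_form_relation[of "(u, v)"]
      by (simp add: X_def heis_form_def distrib_left sum.distrib mult.assoc)
  qed
  have dA1: "((\<lambda>v. formu (u, v) (l u v)) has_field_derivative X u v) (at v)" if uv: "u \<in> ?U" "v \<in> ?V" for u v
  proof -
    have "((\<lambda>v. (-1) ^ i * (l u v i * (logu (Suc i mod N) (u, v) - logu N (u, v)))) has_field_derivative
       (-1) ^ i * (logv i (u, v) * (logu (Suc i mod N) (u, v) - logu N (u, v))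
      + (loguv (Suc i mod N) (u, v) - loguv N (u, v)) * l u v i)) (at v)" if "i < N" for i
      by (intro DERIV_cmult DERIV_mult lv[OF idx(1)[OF that] uv] DERIV_diff logu_deriv nz[OF _ uv] idx(2)[OF that] order_refl)
    then have "((\<lambda>v. \<Sum>i<N. (-1) ^ i * (l u v i * (logu (Suc i mod N) (u, v) - logu N (u, v)))) has_field_derivative X u v) (at v)"
      unfolding X_def by (intro DERIV_sum) auto
    then show ?thesis by (simp add: formu_def heis_form_def mult.assoc)
  qed
  have dA2: "((\<lambda>u. formv (u, v) (l u v)) has_field_derivative X u v) (at u)" if uv: "u \<in> ?U" "v \<in> ?V" for u v
  proof -
    have "((\<lambda>u. (-1) ^ i * (l u v i * (logv (Suc i mod N) (u, v) - logv N (u, v)))) has_field_derivative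
       (-1) ^ i * (logu i (u, v) * (logv (Suc i mod N) (u, v) - logv N (u, v))
      + (loguv (Suc i mod N) (u, v) - loguv N (u, v)) * l u v i)) (at u)" if "i < N" for i
      by (intro DERIV_cmult DERIV_mult lu[OF idx(1)[OF that] uv] DERIV_diff logv_deriv nz[OF _ uv] idx(2)[OF that] order_refl)
    then have "((\<lambda>u. \<Sum>i<N. (-1) ^ i * (l u v i * (logv (Suc i mod N) (u, v) - logv N (u, v)))) has_field_derivative X u v) (at u)"
      unfolding X'[OF uv] by (intro DERIV_sum) auto
    then show ?thesis by (simp add: formv_def heis_form_def mult.assoc)
  qed
  have hol_eqn: "(\<lambda>u. eqn j (u, v)) holomorphic_on S" "(\<lambda>v. eqn j (u, v)) holomorphic_on S" for j u v S
    by (cases "j < N"; auto simp: eqn_def intro!: holomorphic_intros)+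
  have hol_log: "(\<lambda>u. logu j (u, v)) holomorphic_on ?U" "(\<lambda>v. logv j (u, v)) holomorphic_on ?V"
    if j: "j \<le> N" and uv: "u \<in> ?U" "v \<in> ?V" for j u v
    unfolding logu_def logv_def using nz[OF j _ uv(2)] nz[OF j uv(1)]
    by (cases "j < N"; auto intro!: holomorphic_intros hol_eqn)+
  have hol_l: "(\<lambda>u. l u v j) holomorphic_on ?U" "(\<lambda>v. l u v j) holomorphic_on ?V"
    if "j \<le> N" "u \<in> ?U" "v \<in> ?V" for j u v
    unfolding holomorphic_on_def field_differentiable_def
    using has_field_derivative_at_within[OF lu[OF that(1) _ that(3)]]
      has_field_derivative_at_within[OF lv[OF that(1,2)]] by blast+
  have ctr: "u0 \<in> ?U" "v0 \<in> ?V" using R0 by auto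
  have hA1: "(\<lambda>u. formu (u, v) (l u v)) holomorphic_on ?U" if "v \<in> ?V" for v
    unfolding formu_def heis_form_def
    by (intro holomorphic_intros hol_log(1)[OF _ ctr(1) that] hol_l(1)[OF _ ctr(1) that])
       (auto simp: idx)
  have hA2: "(\<lambda>v. formv (u, v) (l u v)) holomorphic_on ?V" if "u \<in> ?U" for u
    unfolding formv_def heis_form_def
    by (intro holomorphic_intros hol_log(2)[OF _ that ctr(2)] hol_l(2)[OF _ that ctr(2)])
       (auto simp: idx)
  have c1: "continuous_on (?U \<times> ?V) (\<lambda>q. logu j q)" "continuous_on (?U \<times> ?V) (\<lambda>q. logv j q)"
    "continuous_on (?U \<times> ?V) (\<lambda>q. loguv j q)" if j: "j \<le> N" for j
  proof -
    have z: "\<forall>q\<in>?U \<times> ?V. eqn j q \<noteq> 0" using nz[OF j] by auto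
    then have z2: "\<forall>q\<in>?U \<times> ?V. (eqn j q)\<^sup>2 \<noteq> 0" by simp
    show "continuous_on (?U \<times> ?V) (\<lambda>q. logu j q)" "continuous_on (?U \<times> ?V) (\<lambda>q. logv j q)"
      "continuous_on (?U \<times> ?V) (\<lambda>q. loguv j q)"
      unfolding logu_def logv_def loguv_def
      by (cases "j < N"; simp only: if_True if_False; intro continuous_intros z z2)+
  qed
  have lc': "continuous_on (?U \<times> ?V) (\<lambda>q. l (fst q) (snd q) j)" for j
    using lc[of j] by (simp add: case_prod_unfold)
  have cX: "continuous_on (?U \<times> ?V) (\<lambda>(u, v). X u v)"
    unfolding X_def case_prod_unfold prod.collapse
    by (intro continuous_intros c1 lc') (auto simp: idx)
  obtain J where J: "\<forall>u\<in>?U. \<forall>v\<in>?V. ((\<lambda>u. J u v) has_field_derivative formu (u, v) (l u v)) (at u) \<and>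
      (J u has_field_derivative formv (u, v) (l u v)) (at v)"
    using two_variable_primitive[where ?A1.0 = "\<lambda>u v. formu (u, v) (l u v)" and ?A2.0 = "\<lambda>u v. formv (u, v) (l u v)",
        OF open_ball convex_ball open_ball convex_ball ctr hA1 hA2 dA1 dA2 cX] by auto
  have "developing ?U ?V l J"
    unfolding developing_def
  proof (intro conjI ballI allI impI open_ball convex_ball sub lc)
    fix u v assume uv: "u \<in> ?U" "v \<in> ?V"
    show "((\<lambda>u. J u v) has_field_derivative formu (u, v) (l u v)) (at u)"
      "(J u has_field_derivative formv (u, v) (l u v)) (at v)"
      using J uv by blast+
    fix j
    show "l u v j = 0" if "N < j" using that by (simp add: l_def)
    assume "j \<le> N"
    then show "exp (l u v j) = eqn j (u, v)" "((\<lambda>u. l u v j) has_field_derivative logu j (u, v)) (at u)"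
      "((\<lambda>v. l u v j) has_field_derivative logv j (u, v)) (at v)"
      using uv by (rule lexp lu lv)+
  qed
  then show ?thesis using that R0 by blast
qed

text \<open>On the convex overlap the logarithms differ by constants \<open>a\<close>, and then
  \<open>J' - J - heis_form N a l\<close> has vanishing partial derivatives. The two developing maps
  thus differ by one left translation, which cancels in the increments.\<close>

lemma developing_unique:
  assumes D: "developing U V l J" and D': "developing U' V' l' J'"
    and p: "u \<in> U \<inter> U'" "v \<in> V \<inter> V'" and q: "x \<in> U \<inter> U'" "y \<in> V \<inter> V'"
  shows "inv\<^bsub>heis N\<^esub> (l u v, J u v) \<otimes>\<^bsub>heis N\<^esub> (l x y, J x y) =
    inv\<^bsub>heis N\<^esub> (l' u v, J' u v) \<otimes>\<^bsub>heis N\<^esub> (l' x y, J' x y)"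
proof -
  interpret H: group "heis N" by (rule group_heis)
  let ?U = "U \<inter> U'" and ?V = "V \<inter> V'"
  have op: "open ?U" "convex ?U" "open ?V" "convex ?V"
    using D D' by (auto simp: developing_def convex_Int)
  have lD: "((\<lambda>u. l u v j) has_field_derivative logu j (u, v)) (at u)"
      "((\<lambda>v. l u v j) has_field_derivative logv j (u, v)) (at v)" if "j \<le> N" "u \<in> ?U" "v \<in> ?V" for j u v
    using D that unfolding developing_def by auto
  have lD': "((\<lambda>u. l' u v j) has_field_derivative logu j (u, v)) (at u)"
      "((\<lambda>v. l' u v j) has_field_derivative logv j (u, v)) (at v)" if "j \<le> N" "u \<in> ?U" "v \<in> ?V" for j u v
    using D' that unfolding developing_def by auto
  have zero: "l u v j = 0" "l' u v j = 0" if "j > N" "u \<in> ?U" "v \<in> ?V" for j u v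
    using D D' that unfolding developing_def by auto
  have JD: "((\<lambda>u. J u v) has_field_derivative formu (u, v) (l u v)) (at u)"
      "((\<lambda>v. J u v) has_field_derivative formv (u, v) (l u v)) (at v)" if "u \<in> ?U" "v \<in> ?V" for u v
    using D that unfolding developing_def by auto
  have JD': "((\<lambda>u. J' u v) has_field_derivative formu (u, v) (l' u v)) (at u)"
      "((\<lambda>v. J' u v) has_field_derivative formv (u, v) (l' u v)) (at v)" if "u \<in> ?U" "v \<in> ?V" for u v
    using D' that unfolding developing_def by auto
  define a where "a j = l' x y j - l x y j" for j
  have la: "l' w z = (\<lambda>j. a j + l w z j)" if wz: "w \<in> ?U" "z \<in> ?V" for w z
  proof
    fix j
    show "l' w z j = a j + l w z j"
    proof (cases "j \<le> N")
      case True
      have "l' w z j - l w z j = l' x y j - l x y j"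
      proof (rule constant_of_zero_partials[OF op _ _ wz q, of "\<lambda>w z. l' w z j - l w z j"])
        fix u v assume uv: "u \<in> ?U" "v \<in> ?V"
        show "((\<lambda>u. l' u v j - l u v j) has_field_derivative 0) (at u)"
          using DERIV_diff[OF lD'(1)[OF True uv] lD(1)[OF True uv]] by simp
        show "((\<lambda>v. l' u v j - l u v j) has_field_derivative 0) (at v)"
          using DERIV_diff[OF lD'(2)[OF True uv] lD(2)[OF True uv]] by simp
      qed
      then show ?thesis unfolding a_def by (simp only: diff_eq_eq)
    next
      case False
      then show ?thesis using zero wz q by (simp add: a_def)
    qed
  qed
  define f where "f w z = J' w z - J w z - heis_form N a (l w z)" for w z
  have idx: "Suc i mod N \<le> N" for i using N_ge by (auto intro: less_imp_le)
  have fconst: "f w z = f x y" if wz: "w \<in> ?U" "z \<in> ?V" for w z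
  proof (rule constant_of_zero_partials[OF op _ _ wz q])
    fix u v assume uv: "u \<in> ?U" "v \<in> ?V"
    have "((\<lambda>u. heis_form N a (l u v)) has_field_derivative formu (u, v) a) (at u)"
      unfolding formu_def heis_form_def
      by (intro DERIV_sum DERIV_cmult DERIV_diff lD(1)[OF _ uv] idx order_refl)
    from DERIV_diff[OF DERIV_diff[OF JD'(1)[OF uv] JD(1)[OF uv]] this]
    show "((\<lambda>u. f u v) has_field_derivative 0) (at u)"
      by (simp add: f_def la[OF uv] formu_def heis_form_linear)
    have "((\<lambda>v. heis_form N a (l u v)) has_field_derivative formv (u, v) a) (at v)"
      unfolding formv_def heis_form_def
      by (intro DERIV_sum DERIV_cmult DERIV_diff lD(2)[OF _ uv] idx order_refl)
    from DERIV_diff[OF DERIV_diff[OF JD'(2)[OF uv] JD(2)[OF uv]] this]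
    show "(f u has_field_derivative 0) (at v)"
      by (simp add: f_def[abs_def] la[OF uv] formv_def heis_form_linear)
  qed
  define c where "c = (a, f x y)"
  have "(l' w z, J' w z) = c \<otimes>\<^bsub>heis N\<^esub> (l w z, J w z)" if wz: "w \<in> ?U" "z \<in> ?V" for w z
    using fconst[OF wz] la[OF wz] by (simp add: c_def heis_def f_def algebra_simps)
  from this[OF p] this[OF q] show ?thesis
    by (simp add: H.inv_mult_group H.m_assoc) (simp add: H.m_assoc[symmetric])
qed

text \<open>The increment of a developing map from \<open>p\<close> to \<open>q\<close>. It is
  unambiguous as soon as some developing domain contains both points, and unspecified
  otherwise.\<close>

definition local_transport :: "complex \<times> complex \<Rightarrow> complex \<times> complex \<Rightarrow> (nat \<Rightarrow> complex) \<times> complex" where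
  "local_transport p q = (SOME h. \<exists>U V l J. developing U V l J \<and> p \<in> U \<times> V \<and> q \<in> U \<times> V \<and>
     h = inv\<^bsub>heis N\<^esub> (l (fst p) (snd p), J (fst p) (snd p)) \<otimes>\<^bsub>heis N\<^esub> (l (fst q) (snd q), J (fst q) (snd q)))"

lemma local_transport_eq:
  assumes "developing U V l J" "p \<in> U \<times> V" "q \<in> U \<times> V"
  shows "local_transport p q = inv\<^bsub>heis N\<^esub> (l (fst p) (snd p), J (fst p) (snd p)) \<otimes>\<^bsub>heis N\<^esub> (l (fst q) (snd q), J (fst q) (snd q))"
  unfolding local_transport_def
proof (rule some_equality)
  fix h assume "\<exists>U V l J. developing U V l J \<and> p \<in> U \<times> V \<and> q \<in> U \<times> V \<and>
     h = inv\<^bsub>heis N\<^esub> (l (fst p) (snd p), J (fst p) (snd p)) \<otimes>\<^bsub>heis N\<^esub> (l (fst q) (snd q), J (fst q) (snd q))"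
  then obtain U' V' l' J' where D': "developing U' V' l' J'" "p \<in> U' \<times> V'" "q \<in> U' \<times> V'"
    and h: "h = inv\<^bsub>heis N\<^esub> (l' (fst p) (snd p), J' (fst p) (snd p)) \<otimes>\<^bsub>heis N\<^esub> (l' (fst q) (snd q), J' (fst q) (snd q))"
    by blast
  show "h = inv\<^bsub>heis N\<^esub> (l (fst p) (snd p), J (fst p) (snd p)) \<otimes>\<^bsub>heis N\<^esub> (l (fst q) (snd q), J (fst q) (snd q))"
    unfolding h by (rule developing_unique[OF D'(1) assms(1)]) (use D' assms in auto)
qed (use assms in blast)

lemma developing_neighborhood:
  assumes "x \<in> compl"
  obtains e U V l J where "e > 0" "ball x e \<subseteq> U \<times> V" "developing U V l J"
proof -
  obtain u0 v0 where x: "x = (u0, v0)" by (cases x)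
  obtain r l J where r: "r > 0" "developing (ball u0 r) (ball v0 r) l J"
    using developing_exists assms x by metis
  have "ball x r \<subseteq> ball u0 r \<times> ball v0 r"
  proof
    fix q assume "q \<in> ball x r"
    then have "dist x q < r" by simp
    moreover have "dist u0 (fst q) \<le> dist x q" "dist v0 (snd q) \<le> dist x q"
      using dist_fst_le[of x q] dist_snd_le[of x q] x by auto
    ultimately show "q \<in> ball u0 r \<times> ball v0 r" by (auto simp: mem_Times_iff)
  qed
  then show ?thesis using that r by blast
qed

sublocale transport "heis N" compl local_transport
proof (intro transport.intro transport_axioms.intro group_heis)
  interpret H: group "heis N" by (rule group_heis)
  fix x assume "x \<in> compl"
  then obtain e U V l J where e: "e > 0" "ball x e \<subseteq> U \<times> V" "developing U V l J"
    by (rule developing_neighborhood)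
  have "local_transport p q \<otimes>\<^bsub>heis N\<^esub> local_transport q s = local_transport p s"
    if "p \<in> U \<times> V" "q \<in> U \<times> V" "s \<in> U \<times> V" for p q s
    unfolding local_transport_eq[OF e(3) that(1,2)] local_transport_eq[OF e(3) that(2,3)] local_transport_eq[OF e(3) that(1,3)]
    by (simp add: H.m_assoc) (simp add: H.m_assoc[symmetric])
  then show "\<exists>e>0. \<forall>p\<in>ball x e \<inter> compl. \<forall>q\<in>ball x e \<inter> compl. \<forall>s\<in>ball x e \<inter> compl.
           local_transport p q \<otimes>\<^bsub>heis N\<^esub> local_transport q s = local_transport p s"
    using e(1,2) by (metis IntD1 subsetD)
qed simp

text \<open>The first components of the holonomy are the periods of the logarithmic forms. A lift
  and the given continuous logarithm \<open>L\<close> have the same increments on short intervals,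
  and bisection extends this to the whole path.\<close>

lemma holonomy_log:
  assumes \<gamma>: "path \<gamma>" "path_image \<gamma> \<subseteq> compl" and j: "j \<le> N"
    and L: "continuous_on {0..1} L" "\<And>t. t \<in> {0..1} \<Longrightarrow> exp (L t) = eqn j (\<gamma> t)"
  shows "fst (holonomy \<gamma>) j = L 1 - L 0"
proof -
  interpret H: group "heis N" by (rule group_heis)
  obtain h where h: "lift_on \<gamma> 0 1 h" using path_lift_exists[OF \<gamma>] .
  have "0 \<le> (0::real) \<longrightarrow> (1::real) \<le> 1 \<longrightarrow> fst (h 1) j - L 1 = fst (h 0) j - L 0"
  proof (rule Bolzano[where P = "\<lambda>a b. 0 \<le> a \<longrightarrow> b \<le> 1 \<longrightarrow> fst (h b) j - L b = fst (h a) j - L a"])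
    fix x :: real assume "0 \<le> x" "x \<le> 1"
    then have x: "x \<in> {0..1}" by simp
    then have "\<gamma> x \<in> compl" using \<gamma>(2) by (auto simp: path_image_def)
    then obtain r U V l J where r: "r > 0" "ball (\<gamma> x) r \<subseteq> U \<times> V" "developing U V l J"
      by (rule developing_neighborhood)
    define K where "K q = l (fst q) (snd q) j" for q
    have K: "continuous_on (U \<times> V) K" "\<And>q. q \<in> U \<times> V \<Longrightarrow> exp (K q) = eqn j q"
      using r(3) j unfolding developing_def K_def by (auto simp: case_prod_unfold)
    have mem: "\<gamma> x \<in> U \<times> V" using r by auto
    obtain d1 where d1: "d1 > 0" "\<And>q. q \<in> U \<times> V \<Longrightarrow> dist q (\<gamma> x) < d1 \<Longrightarrow> dist (K q) (K (\<gamma> x)) < 1"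
      using K(1) mem unfolding continuous_on_iff by (metis zero_less_one)
    obtain d2 where d2: "d2 > 0" "\<And>s. s \<in> {0..1} \<Longrightarrow> dist s x < d2 \<Longrightarrow> dist (\<gamma> s) (\<gamma> x) < min r d1"
      using \<gamma>(1) x r(1) d1(1) unfolding path_def continuous_on_iff by (metis min_less_iff_conj)
    obtain d3 where d3: "d3 > 0" "\<And>s. s \<in> {0..1} \<Longrightarrow> dist s x < d3 \<Longrightarrow> dist (L s) (L x) < 1"
      using L(1) x unfolding continuous_on_iff by (metis zero_less_one)
    obtain d4 where d4: "d4 > 0" "\<forall>s\<in>{0..1}. \<forall>s'\<in>{0..1}. \<bar>s - x\<bar> < d4 \<longrightarrow> \<bar>s' - x\<bar> < d4 \<longrightarrow>
        h s' = h s \<otimes>\<^bsub>heis N\<^esub> local_transport (\<gamma> s) (\<gamma> s')"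
      using lift_onD[OF h x] .
    define d where "d = min (min d2 d3) d4"
    have "fst (h b) j - L b = fst (h a) j - L a"
      if ab: "a \<le> x" "x \<le> b" "b - a < d" "0 \<le> a" "b \<le> 1" for a b
    proof -
      have ab01: "a \<in> {0..1}" "b \<in> {0..1}" using ab x by auto
      have near: "dist a x < d2" "dist a x < d3" "\<bar>a - x\<bar> < d4" "dist b x < d2" "dist b x < d3" "\<bar>b - x\<bar> < d4"
        using ab by (auto simp: d_def dist_real_def)
      have "\<gamma> a \<in> ball (\<gamma> x) r" "\<gamma> b \<in> ball (\<gamma> x) r"
        using d2(2)[OF ab01(1) near(1)] d2(2)[OF ab01(2) near(4)] by (simp_all add: dist_commute)
      then have g: "\<gamma> a \<in> U \<times> V" "\<gamma> b \<in> U \<times> V" using r(2) by blast+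
      have "h b = h a \<otimes>\<^bsub>heis N\<^esub> local_transport (\<gamma> a) (\<gamma> b)"
        using d4(2) ab01 near by blast
      then have "fst (h b) j - fst (h a) j = K (\<gamma> b) - K (\<gamma> a)"
        by (simp add: local_transport_eq[OF r(3) g] fst_heis_mult fst_heis_inv K_def)
      \<comment> \<open>The two increments have the same exponential. Each has norm below 2, so
        their imaginary parts differ by less than 4 < 2 pi, which leaves no room for a nonzero
        multiple of the period.\<close>
      moreover have "K (\<gamma> b) - K (\<gamma> a) = L b - L a"
      proof (rule exp_complex_eqI)
        show "exp (K (\<gamma> b) - K (\<gamma> a)) = exp (L b - L a)"
          by (simp add: exp_diff K(2)[OF g(1)] K(2)[OF g(2)] L(2)[OF ab01(1)] L(2)[OF ab01(2)])
        have "dist (K (\<gamma> a)) (K (\<gamma> x)) < 1" "dist (K (\<gamma> b)) (K (\<gamma> x)) < 1"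
          using d1(2)[OF g(1)] d1(2)[OF g(2)] d2(2)[OF ab01(1) near(1)] d2(2)[OF ab01(2) near(4)] by auto
        then have 1: "dist (K (\<gamma> b)) (K (\<gamma> a)) < 2"
          using dist_triangle2[of "K (\<gamma> b)" "K (\<gamma> a)" "K (\<gamma> x)"] by linarith
        have "dist (L a) (L x) < 1" "dist (L b) (L x) < 1"
          using d3(2)[OF ab01(1) near(2)] d3(2)[OF ab01(2) near(5)] by auto
        then have 2: "dist (L b) (L a) < 2"
          using dist_triangle2[of "L b" "L a" "L x"] by linarith
        have "\<bar>Im (K (\<gamma> b) - K (\<gamma> a)) - Im (L b - L a)\<bar> \<le> norm (K (\<gamma> b) - K (\<gamma> a)) + norm (L b - L a)"
          using abs_Im_le_cmod[of "K (\<gamma> b) - K (\<gamma> a)"] abs_Im_le_cmod[of "L b - L a"] by linarith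
        also have "\<dots> < 4" using 1 2 by (simp add: dist_norm)
        also have "4 < 2 * pi" using pi_gt3 by simp
        finally show "\<bar>Im (K (\<gamma> b) - K (\<gamma> a)) - Im (L b - L a)\<bar> < 2 * pi" .
      qed
      ultimately show ?thesis by (simp add: algebra_simps)
    qed
    moreover have "d > 0" using d2(1) d3(1) d4(1) by (simp add: d_def)
    ultimately show "\<exists>d>0. \<forall>a b. a \<le> x \<and> x \<le> b \<and> b - a < d \<longrightarrow> 0 \<le> a \<longrightarrow> b \<le> 1 \<longrightarrow>
        fst (h b) j - L b = fst (h a) j - L a"
      by blast
  qed auto
  then show ?thesis
    by (simp add: holonomy_eq[OF h] fst_heis_mult fst_heis_inv algebra_simps)
qed

text \<open>The central component of the commutator of the two holonomies; it vanishes when the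
  classes commute.\<close>

definition loop_form :: "(real \<Rightarrow> complex \<times> complex) set \<Rightarrow> (real \<Rightarrow> complex \<times> complex) set \<Rightarrow> complex" where
  "loop_form X Y = heis_form N (fst (class_holonomy X)) (fst (class_holonomy Y)) -
     heis_form N (fst (class_holonomy Y)) (fst (class_holonomy X))"

lemma isotropic_loop_form: "isotropic_form (fundamental_group compl p) loop_form"
  unfolding isotropic_form_def
proof (intro conjI ballI impI)
  let ?G = "fundamental_group compl p"
  fix X Y assume X: "X \<in> carrier ?G" and Y: "Y \<in> carrier ?G"
  have mult: "class_holonomy (X \<otimes>\<^bsub>?G\<^esub> Y) = class_holonomy X \<otimes>\<^bsub>heis N\<^esub> class_holonomy Y"
    if "X \<in> carrier ?G" "Y \<in> carrier ?G" for X Y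
    using class_holonomy_hom that by (auto simp: hom_def)
  have fst_mult: "fst (class_holonomy (X \<otimes>\<^bsub>?G\<^esub> Y)) = (\<lambda>i. fst (class_holonomy X) i + fst (class_holonomy Y) i)"
    unfolding mult[OF X Y] by (rule ext) (rule fst_heis_mult)
  fix Z
  show "loop_form (X \<otimes>\<^bsub>?G\<^esub> Y) Z = loop_form X Z + loop_form Y Z"
    "loop_form Z (X \<otimes>\<^bsub>?G\<^esub> Y) = loop_form Z X + loop_form Z Y"
    by (simp_all add: loop_form_def fst_mult heis_form_linear)
  assume "X \<otimes>\<^bsub>?G\<^esub> Y = Y \<otimes>\<^bsub>?G\<^esub> X"
  then have "snd (class_holonomy X \<otimes>\<^bsub>heis N\<^esub> class_holonomy Y) = snd (class_holonomy Y \<otimes>\<^bsub>heis N\<^esub> class_holonomy X)"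
    by (metis mult X Y)
  then show "loop_form X Y = 0" by (simp add: snd_heis_mult loop_form_def)
qed

end

section \<open>Additive functionals of free loops\<close>

definition loop_in :: "'a::topological_space set \<Rightarrow> (real \<Rightarrow> 'a) \<Rightarrow> bool" where
  "loop_in M \<gamma> \<longleftrightarrow> path \<gamma> \<and> path_image \<gamma> \<subseteq> M \<and> pathfinish \<gamma> = pathstart \<gamma>"

text \<open>The counterpart of \<open>isotropic_pair\<close> without base points. Values on free
  loops make sense because homomorphisms to \<int> ignore conjugation, and maps of the torus replace
  commuting pairs.\<close>

definition isotropic_loop_pair :: "'a::real_normed_vector set \<Rightarrow> ((real \<Rightarrow> 'a) \<Rightarrow> int) \<Rightarrow> ((real \<Rightarrow> 'a) \<Rightarrow> int) \<Rightarrow> bool" where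
  "isotropic_loop_pair M c c' \<longleftrightarrow>
     (\<forall>f g. homotopic_loops M f g \<longrightarrow> c f = c g \<and> c' f = c' g) \<and>
     (\<forall>f g. loop_in M f \<and> loop_in M g \<and> pathstart f = pathstart g \<longrightarrow>
        c (f +++ g) = c f + c g \<and> c' (f +++ g) = c' f + c' g) \<and>
     (\<forall>\<tau>. continuous_on ({0..1} \<times> {0..1}) \<tau> \<and> \<tau> ` ({0..1} \<times> {0..1}) \<subseteq> M \<and>
        (\<forall>s\<in>{0..1}. \<tau> (s, 0) = \<tau> (s, 1)) \<and> (\<forall>s\<in>{0..1}. \<tau> (0, s) = \<tau> (1, s)) \<longrightarrow>
        c (\<lambda>s. \<tau> (s, 0)) * c' (\<lambda>s. \<tau> (0, s)) = c' (\<lambda>s. \<tau> (s, 0)) * c (\<lambda>s. \<tau> (0, s)))"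

section \<open>Path homotopies and the passage from free to based loops\<close>

lemma homotopic_paths_convex:
  fixes S :: "'a::real_normed_vector set"
  assumes "convex S" "path f" "path g" "path_image f \<subseteq> S" "path_image g \<subseteq> S"
    "pathstart f = pathstart g" "pathfinish f = pathfinish g"
  shows "homotopic_paths S f g"
proof (rule homotopic_paths_linear)
  show "closed_segment (f t) (g t) \<subseteq> S" if "t \<in> {0..1}" for t
    using assms that by (intro closed_segment_subset) (auto simp: path_image_def)
qed (use assms in auto)

lemma homotopic_paths_join_left:
  "\<lbrakk>homotopic_paths S f f'; path g; path_image g \<subseteq> S; pathfinish f = pathstart g\<rbrakk>
    \<Longrightarrow> homotopic_paths S (f +++ g) (f' +++ g)"
  by (simp add: homotopic_paths_join)

lemma homotopic_paths_join_right:
  "\<lbrakk>homotopic_paths S g g'; path f; path_image f \<subseteq> S; pathfinish f = pathstart g\<rbrakk>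
    \<Longrightarrow> homotopic_paths S (f +++ g) (f +++ g')"
  by (simp add: homotopic_paths_join)

lemma homotopic_paths_cancel:
  fixes S :: "'a::real_normed_vector set"
  assumes "path a" "path u" "path b" "path_image a \<subseteq> S" "path_image u \<subseteq> S" "path_image b \<subseteq> S"
    "pathfinish a = pathfinish u" "pathstart b = pathfinish u"
  shows "homotopic_paths S ((a +++ reversepath u) +++ (u +++ b)) (a +++ b)"
proof -
  have "homotopic_paths S ((a +++ reversepath u) +++ (u +++ b)) (a +++ (reversepath u +++ (u +++ b)))"
    by (rule homotopic_paths_sym[OF homotopic_paths_assoc]) (use assms in \<open>auto simp: path_image_join\<close>)
  moreover have "homotopic_paths S (reversepath u +++ (u +++ b)) ((reversepath u +++ u) +++ b)"
    by (rule homotopic_paths_assoc) (use assms in auto)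
  moreover have "homotopic_paths S ((reversepath u +++ u) +++ b) (linepath (pathfinish u) (pathfinish u) +++ b)"
    by (intro homotopic_paths_join homotopic_paths_linv) (use assms in auto)
  moreover have "homotopic_paths S (linepath (pathfinish u) (pathfinish u) +++ b) b"
    by (rule homotopic_paths_lid') (use assms in auto)
  ultimately have "homotopic_paths S (reversepath u +++ (u +++ b)) b"
    using homotopic_paths_trans by blast
  then have "homotopic_paths S (a +++ (reversepath u +++ (u +++ b))) (a +++ b)"
    by (intro homotopic_paths_join) (use assms in auto)
  then show ?thesis
    using \<open>homotopic_paths S ((a +++ reversepath u) +++ (u +++ b)) (a +++ (reversepath u +++ (u +++ b)))\<close>
    by (rule homotopic_paths_trans[rotated])
qed

text \<open>Both sides of a commutation relation between path classes are compared with the same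
  path from \<open>p\<close> along \<open>u\<close>, the loop, and back along \<open>v\<close>.\<close>

lemma homotopic_paths_transfer:
  fixes S :: "'a::real_normed_vector set"
  assumes u: "path u" "path_image u \<subseteq> S" and v: "path v" "path_image v \<subseteq> S"
    and f: "loop_in S f" and ends: "pathfinish u = pathstart f" "pathfinish v = pathstart f"
  shows "homotopic_paths S ((u +++ f +++ reversepath u) +++ (u +++ reversepath v))
     ((u +++ reversepath v) +++ (v +++ f +++ reversepath v))"
proof -
  have f': "path f" "path_image f \<subseteq> S" "pathfinish f = pathstart f" using f by (auto simp: loop_in_def)
  have "homotopic_paths S ((u +++ f +++ reversepath u) +++ (u +++ reversepath v))
      (((u +++ f) +++ reversepath u) +++ (u +++ reversepath v))"
    by (rule homotopic_paths_join_left[OF homotopic_paths_assoc]) (use u v f' ends in \<open>auto simp: path_image_join\<close>)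
  also have "homotopic_paths S (((u +++ f) +++ reversepath u) +++ (u +++ reversepath v)) ((u +++ f) +++ reversepath v)"
    by (rule homotopic_paths_cancel) (use u v f' ends in \<open>auto simp: path_image_join\<close>)
  also have "homotopic_paths S ((u +++ f) +++ reversepath v) (u +++ (f +++ reversepath v))"
    by (rule homotopic_paths_sym[OF homotopic_paths_assoc]) (use u v f' ends in \<open>auto simp: path_image_join\<close>)
  also have "homotopic_paths S (u +++ (f +++ reversepath v)) ((u +++ reversepath v) +++ (v +++ f +++ reversepath v))"
    by (rule homotopic_paths_sym[OF homotopic_paths_cancel]) (use u v f' ends in \<open>auto simp: path_image_join\<close>)
  finally show ?thesis .
qed

lemma homotopic_paths_conjugate_join:
  fixes S :: "'a::real_normed_vector set"
  assumes u: "path u" "path_image u \<subseteq> S" and f: "loop_in S f" and g: "loop_in S g"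
    and ends: "pathfinish u = pathstart f" "pathstart g = pathstart f"
  shows "homotopic_paths S ((u +++ f +++ reversepath u) +++ (u +++ g +++ reversepath u))
     (u +++ (f +++ g) +++ reversepath u)"
proof -
  have f': "path f" "path_image f \<subseteq> S" "pathfinish f = pathstart f" using f by (auto simp: loop_in_def)
  have g': "path g" "path_image g \<subseteq> S" "pathfinish g = pathstart g" using g by (auto simp: loop_in_def)
  have "homotopic_paths S ((u +++ f +++ reversepath u) +++ (u +++ g +++ reversepath u))
      (((u +++ f) +++ reversepath u) +++ (u +++ g +++ reversepath u))"
    by (rule homotopic_paths_join_left[OF homotopic_paths_assoc]) (use u f' g' ends in \<open>auto simp: path_image_join\<close>)
  also have "homotopic_paths S (((u +++ f) +++ reversepath u) +++ (u +++ g +++ reversepath u)) ((u +++ f) +++ (g +++ reversepath u))"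
    by (rule homotopic_paths_cancel) (use u f' g' ends in \<open>auto simp: path_image_join\<close>)
  also have "homotopic_paths S ((u +++ f) +++ (g +++ reversepath u)) (u +++ (f +++ (g +++ reversepath u)))"
    by (rule homotopic_paths_sym[OF homotopic_paths_assoc]) (use u f' g' ends in \<open>auto simp: path_image_join\<close>)
  also have "homotopic_paths S (u +++ (f +++ (g +++ reversepath u))) (u +++ ((f +++ g) +++ reversepath u))"
    by (rule homotopic_paths_join_right[OF homotopic_paths_assoc]) (use u f' g' ends in \<open>auto simp: path_image_join\<close>)
  finally show ?thesis .
qed

lemma homotopic_paths_square:
  fixes h :: "real \<times> real \<Rightarrow> 'a::real_normed_vector"
  assumes h: "continuous_on ({0..1} \<times> {0..1}) h" "h ` ({0..1} \<times> {0..1}) \<subseteq> S"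
    and fg: "path f" "path g" "path_image f \<subseteq> {0..1} \<times> {0..1}" "path_image g \<subseteq> {0..1} \<times> {0..1}"
      "pathstart f = pathstart g" "pathfinish f = pathfinish g"
  shows "homotopic_paths S (h \<circ> f) (h \<circ> g)"
proof (rule homotopic_paths_continuous_image[OF homotopic_paths_convex])
  show "convex ({0..1::real} \<times> {0..1::real})" by (intro convex_Times convex_real_interval)
qed (use assms in auto)

lemma compose_joinpaths: "h \<circ> (f +++ g) = (h \<circ> f) +++ (h \<circ> g)"
  by (auto simp: joinpaths_def fun_eq_iff)

text \<open>\<open>w\<close> is the track of the starting point during the free homotopy. One side
  of the homotopy square is deformed into the other three, and the two sides swept by the end points
  have the same image because every stage is a loop.\<close>

lemma homotopic_loops_track:
  fixes S :: "'a::real_normed_vector set"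
  assumes "homotopic_loops S f g"
  obtains w where "path w" "path_image w \<subseteq> S" "pathstart w = pathstart f" "pathfinish w = pathstart g"
    "homotopic_paths S f (w +++ g +++ reversepath w)"
proof -
  obtain h :: "real \<times> real \<Rightarrow> 'a" where h: "continuous_on ({0..1} \<times> {0..1}) h" "h \<in> ({0..1} \<times> {0..1}) \<rightarrow> S"
    and h0: "\<forall>x\<in>{0..1}. h (0, x) = f x" and h1: "\<forall>x\<in>{0..1}. h (1, x) = g x"
    and loop: "\<forall>t\<in>{0..1}. h (t, 1) = h (t, 0)"
    using assms unfolding homotopic_loops by (auto simp: pathstart_def pathfinish_def)
  have hS: "h ` ({0..1} \<times> {0..1}) \<subseteq> S" using h(2) by auto
  define w where "w = h \<circ> linepath (0, 0) (1, 0)"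
  have seg: "path_image (linepath a b) \<subseteq> {0..1} \<times> {0..1}" if "a \<in> {0..1} \<times> {0..1}" "b \<in> {0..1} \<times> {0..1}"
    for a b :: "real \<times> real"
    using closed_segment_subset[OF that] by (simp add: convex_Times)
  have w: "path w" "path_image w \<subseteq> S"
  proof -
    show "path w" unfolding w_def
      by (rule path_continuous_image[OF path_linepath]) (rule continuous_on_subset[OF h(1)], use seg in auto)
    show "path_image w \<subseteq> S" unfolding w_def path_image_compose
      using hS seg[of "(0, 0)" "(1, 0)"] by auto
  qed
  have "homotopic_paths S (h \<circ> linepath (0, 0) (0, 1))
      (h \<circ> (linepath (0, 0) (1, 0) +++ linepath (1, 0) (1, 1) +++ linepath (1, 1) (0, 1)))"
    by (rule homotopic_paths_square[OF h(1) hS]; (intro subset_path_image_join seg)?) auto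
  moreover have fp: "path f" "path_image f \<subseteq> S" "path g" "path_image g \<subseteq> S" "pathfinish g = pathstart g"
    using assms homotopic_loops_imp_path homotopic_loops_imp_subset homotopic_loops_imp_loop by blast+
  have "homotopic_paths S f (h \<circ> linepath (0, 0) (0, 1))"
    using fp h0 by (intro homotopic_paths_eq) (auto simp: linepath_def)
  moreover have "homotopic_paths S (w +++ (h \<circ> linepath (1, 0) (1, 1)) +++ (h \<circ> linepath (1, 1) (0, 1)))
      (w +++ g +++ reversepath w)"
  proof (intro homotopic_paths_join)
    show "homotopic_paths S w w" using w by simp
    show "homotopic_paths S (h \<circ> linepath (1, 0) (1, 1)) g"
      using fp h1 by (intro homotopic_paths_sym[OF homotopic_paths_eq]) (auto simp: linepath_def)
    show "homotopic_paths S (h \<circ> linepath (1, 1) (0, 1)) (reversepath w)"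
    proof (rule homotopic_paths_sym[OF homotopic_paths_eq])
      show "path (reversepath w)" "path_image (reversepath w) \<subseteq> S" using w by simp_all
      show "reversepath w t = (h \<circ> linepath (1, 1) (0, 1)) t" if "t \<in> {0..1}" for t
        using loop that by (simp add: linepath_def reversepath_def w_def)
    qed
  qed (auto simp: pathstart_def pathfinish_def w_def linepath_def joinpaths_def)
  ultimately have "homotopic_paths S f (w +++ g +++ reversepath w)"
    unfolding compose_joinpaths w_def[symmetric] using homotopic_paths_trans by blast
  then show ?thesis using that[of w] w h0 h1 by (auto simp: pathstart_def pathfinish_def w_def linepath_def)
qed

definition tail :: "'a::topological_space set \<Rightarrow> 'a \<Rightarrow> 'a \<Rightarrow> real \<Rightarrow> 'a" where
  "tail M p q = (SOME u. path u \<and> path_image u \<subseteq> M \<and> pathstart u = p \<and> pathfinish u = q)"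

definition conj_class :: "'a::real_normed_vector set \<Rightarrow> (real \<Rightarrow> 'a) \<Rightarrow> (real \<Rightarrow> 'a) \<Rightarrow> (real \<Rightarrow> 'a) set" where
  "conj_class M u f = Collect (homotopic_paths M (u +++ f +++ reversepath u))"

text \<open>The tail is an arbitrary choice; \<open>additive_conj_class\<close> shows that additive
  functions into \<int> do not see it.\<close>

definition based_class :: "'a::real_normed_vector set \<Rightarrow> 'a \<Rightarrow> (real \<Rightarrow> 'a) \<Rightarrow> (real \<Rightarrow> 'a) set" where
  "based_class M p f = conj_class M (tail M p (pathstart f)) f"

lemma Collect_homotopic_paths_eq:
  "homotopic_paths M f g \<Longrightarrow> Collect (homotopic_paths M f) = Collect (homotopic_paths M g)"
  by (auto intro: homotopic_paths_trans homotopic_paths_sym)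

locale based_space =
  fixes M :: "'a::real_normed_vector set" and p :: 'a
  assumes connected: "path_connected M" and base: "p \<in> M"
begin

abbreviation "G \<equiv> fundamental_group M p"

lemma tail:
  assumes "q \<in> M"
  shows "path (tail M p q)" "path_image (tail M p q) \<subseteq> M" "pathstart (tail M p q) = p" "pathfinish (tail M p q) = q"
proof -
  have "\<exists>u. path u \<and> path_image u \<subseteq> M \<and> pathstart u = p \<and> pathfinish u = q"
    using connected base assms unfolding path_connected_def by blast
  from someI_ex[OF this] show "path (tail M p q)" "path_image (tail M p q) \<subseteq> M" "pathstart (tail M p q) = p" "pathfinish (tail M p q) = q"
    unfolding tail_def by blast+
qed

lemma loop_in_start: "loop_in M f \<Longrightarrow> pathstart f \<in> M"
  unfolding loop_in_def using pathstart_in_path_image by blast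

lemma conj_loop:
  assumes "path u" "path_image u \<subseteq> M" "pathstart u = p" "loop_in M f" "pathfinish u = pathstart f"
  shows "u +++ f +++ reversepath u \<in> loops_at M p"
  using assms by (auto simp: loops_at_def loop_in_def path_image_join)

lemma conj_class_closed:
  assumes "path u" "path_image u \<subseteq> M" "pathstart u = p" "loop_in M f" "pathfinish u = pathstart f"
  shows "conj_class M u f \<in> carrier G"
  using conj_loop[OF assms] by (auto simp: conj_class_def carrier_fundamental_group)

lemma based_class_closed:
  assumes "loop_in M f" shows "based_class M p f \<in> carrier G"
  unfolding based_class_def using tail[OF loop_in_start[OF assms]] assms by (intro conj_class_closed) auto

lemma based_class_join:
  assumes f: "loop_in M f" and g: "loop_in M g" and fg: "pathstart f = pathstart g"
  shows "based_class M p (f +++ g) = based_class M p f \<otimes>\<^bsub>G\<^esub> based_class M p g"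
proof -
  note u = tail[OF loop_in_start[OF f]]
  let ?u = "tail M p (pathstart f)"
  have "based_class M p f \<otimes>\<^bsub>G\<^esub> based_class M p g =
      Collect (homotopic_paths M ((?u +++ f +++ reversepath ?u) +++ (?u +++ g +++ reversepath ?u)))"
    unfolding based_class_def conj_class_def fg[symmetric]
    by (intro homotopy_class_mult conj_loop u f g) (simp_all only: fg[symmetric] u(4))
  also have "\<dots> = based_class M p (f +++ g)"
    unfolding based_class_def conj_class_def pathstart_join
    by (intro Collect_homotopic_paths_eq homotopic_paths_conjugate_join u f g) (simp_all add: fg)
  finally show ?thesis ..
qed

text \<open>Two tails differ by the loop \<open>u +++ reversepath v\<close>, which conjugates one
  class into the other; commutativity of \<int> cancels the conjugating class.\<close>

lemma additive_conj_class:
  fixes \<xi> :: "(real \<Rightarrow> 'a) set \<Rightarrow> int"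
  assumes add: "\<And>g h. g \<in> carrier G \<Longrightarrow> h \<in> carrier G \<Longrightarrow> \<xi> (g \<otimes>\<^bsub>G\<^esub> h) = \<xi> g + \<xi> h"
    and u: "path u" "path_image u \<subseteq> M" "pathstart u = p" "pathfinish u = pathstart f"
    and v: "path v" "path_image v \<subseteq> M" "pathstart v = p" "pathfinish v = pathstart f"
    and f: "loop_in M f"
  shows "\<xi> (conj_class M u f) = \<xi> (conj_class M v f)"
proof -
  have k: "u +++ reversepath v \<in> loops_at M p" using u v by (auto simp: loops_at_def path_image_join)
  let ?K = "Collect (homotopic_paths M (u +++ reversepath v))"
  have K: "?K \<in> carrier G" using k by (auto simp: carrier_fundamental_group)
  note cu = conj_loop[OF u(1-3) f u(4)] and cv = conj_loop[OF v(1-3) f v(4)]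
  have "conj_class M u f \<otimes>\<^bsub>G\<^esub> ?K = ?K \<otimes>\<^bsub>G\<^esub> conj_class M v f"
    unfolding conj_class_def homotopy_class_mult[OF cu k] homotopy_class_mult[OF k cv]
    by (intro Collect_homotopic_paths_eq homotopic_paths_transfer u v f)
  then have "\<xi> (conj_class M u f) + \<xi> ?K = \<xi> ?K + \<xi> (conj_class M v f)"
    using add conj_class_closed[OF u(1-3) f u(4)] conj_class_closed[OF v(1-3) f v(4)] K by metis
  then show ?thesis by simp
qed

text \<open>Up to homotopy with fixed ends, a free homotopy only extends the tail by the track
  \<open>w\<close>, and the value does not depend on the tail.\<close>

lemma additive_based_class_homotopic:
  fixes \<xi> :: "(real \<Rightarrow> 'a) set \<Rightarrow> int"
  assumes add: "\<And>g h. g \<in> carrier G \<Longrightarrow> h \<in> carrier G \<Longrightarrow> \<xi> (g \<otimes>\<^bsub>G\<^esub> h) = \<xi> g + \<xi> h"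
    and fg: "homotopic_loops M f g"
  shows "\<xi> (based_class M p f) = \<xi> (based_class M p g)"
proof -
  have f: "loop_in M f" and g: "loop_in M g"
    using fg homotopic_loops_imp_path homotopic_loops_imp_subset homotopic_loops_imp_loop
    unfolding loop_in_def by blast+
  obtain w where w: "path w" "path_image w \<subseteq> M" "pathstart w = pathstart f" "pathfinish w = pathstart g"
    and hom: "homotopic_paths M f (w +++ g +++ reversepath w)"
    using homotopic_loops_track[OF fg] .
  note u = tail[OF loop_in_start[OF f]]
  note v = tail[OF loop_in_start[OF g]]
  let ?u = "tail M p (pathstart f)"
  have g': "path g" "path_image g \<subseteq> M" "pathfinish g = pathstart g" using g by (auto simp: loop_in_def)
  have f': "path f" "path_image f \<subseteq> M" "pathfinish f = pathstart f" using f by (auto simp: loop_in_def)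
  have "homotopic_paths M (?u +++ f +++ reversepath ?u) (?u +++ (w +++ g +++ reversepath w) +++ reversepath ?u)"
    by (intro homotopic_paths_join_right homotopic_paths_join_left hom) (use u f' in \<open>auto simp: path_image_join\<close>)
  also have "homotopic_paths M \<dots> (?u +++ w +++ (g +++ reversepath w) +++ reversepath ?u)"
    by (rule homotopic_paths_join_right[OF homotopic_paths_sym[OF homotopic_paths_assoc]]) (use u w g' in \<open>auto simp: path_image_join\<close>)
  also have "homotopic_paths M \<dots> (?u +++ w +++ g +++ (reversepath w +++ reversepath ?u))"
    by (rule homotopic_paths_join_right[OF homotopic_paths_join_right[OF homotopic_paths_sym[OF homotopic_paths_assoc]]]) (use u w g' in \<open>auto simp: path_image_join\<close>)
  also have "homotopic_paths M \<dots> ((?u +++ w) +++ g +++ (reversepath w +++ reversepath ?u))"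
    by (rule homotopic_paths_assoc) (use u w g' in \<open>auto simp: path_image_join\<close>)
  also have "reversepath w +++ reversepath ?u = reversepath (?u +++ w)"
    using u w by (simp add: reversepath_joinpaths)
  finally have "conj_class M ?u f = conj_class M (?u +++ w) g"
    unfolding conj_class_def by (rule Collect_homotopic_paths_eq)
  then have "\<xi> (based_class M p f) = \<xi> (conj_class M (?u +++ w) g)" by (simp add: based_class_def)
  also have "\<dots> = \<xi> (based_class M p g)"
    unfolding based_class_def
    by (rule additive_conj_class[OF add _ _ _ _ v g]) (use u w in \<open>auto simp: path_image_join\<close>)
  finally show ?thesis .
qed

text \<open>The two halves of the boundary of the parameter square have the same ends and are
  homotopic in it. Periodicity identifies opposite sides, so their images are the two products of
  the generating loops.\<close>

lemma based_class_torus: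
  fixes \<tau> :: "real \<times> real \<Rightarrow> 'a"
  assumes \<tau>: "continuous_on ({0..1} \<times> {0..1}) \<tau>" "\<tau> ` ({0..1} \<times> {0..1}) \<subseteq> M"
    and per: "\<forall>s\<in>{0..1}. \<tau> (s, 0) = \<tau> (s, 1)" "\<forall>s\<in>{0..1}. \<tau> (0, s) = \<tau> (1, s)"
  shows "loop_in M (\<lambda>s. \<tau> (s, 0))" "loop_in M (\<lambda>s. \<tau> (0, s))"
    "based_class M p (\<lambda>s. \<tau> (s, 0)) \<otimes>\<^bsub>G\<^esub> based_class M p (\<lambda>s. \<tau> (0, s)) =
     based_class M p (\<lambda>s. \<tau> (0, s)) \<otimes>\<^bsub>G\<^esub> based_class M p (\<lambda>s. \<tau> (s, 0))"
proof -
  let ?g = "\<lambda>s. \<tau> (s, 0)" and ?h = "\<lambda>s. \<tau> (0, s)"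
  show g: "loop_in M ?g" and h: "loop_in M ?h"
    using \<tau>(2) per
    by (auto simp: loop_in_def path_def path_image_def pathstart_def pathfinish_def
        intro!: continuous_on_compose2[OF \<tau>(1)] continuous_intros)
  have seg: "path_image (linepath a b) \<subseteq> {0..1} \<times> {0..1}" if "a \<in> {0..1} \<times> {0..1}" "b \<in> {0..1} \<times> {0..1}"
    for a b :: "real \<times> real"
    using closed_segment_subset[OF that] by (simp add: convex_Times)
  have gp: "path ?g" "path_image ?g \<subseteq> M" "path ?h" "path_image ?h \<subseteq> M"
    using g h by (auto simp: loop_in_def)
  have e: "homotopic_paths M ?g (\<tau> \<circ> linepath (0, 0) (1, 0))" "homotopic_paths M ?h (\<tau> \<circ> linepath (1, 0) (1, 1))"
    "homotopic_paths M ?h (\<tau> \<circ> linepath (0, 0) (0, 1))" "homotopic_paths M ?g (\<tau> \<circ> linepath (0, 1) (1, 1))"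
    using gp per by (auto intro!: homotopic_paths_eq simp: linepath_def)
  have "homotopic_paths M (?g +++ ?h) (\<tau> \<circ> (linepath (0, 0) (1, 0) +++ linepath (1, 0) (1, 1)))"
    unfolding compose_joinpaths by (intro homotopic_paths_join e) (use per in \<open>auto simp: pathstart_def pathfinish_def\<close>)
  also have "homotopic_paths M \<dots> (\<tau> \<circ> (linepath (0, 0) (0, 1) +++ linepath (0, 1) (1, 1)))"
    by (rule homotopic_paths_square[OF \<tau>]; (intro subset_path_image_join seg)?) auto
  also have "homotopic_paths M \<dots> (?h +++ ?g)"
    unfolding compose_joinpaths
    by (intro homotopic_paths_join homotopic_paths_sym[OF e(3)] homotopic_paths_sym[OF e(4)])
       (auto simp: pathstart_def pathfinish_def linepath_def)
  finally have hom: "homotopic_paths M (?g +++ ?h) (?h +++ ?g)" .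
  have st: "pathstart ?g = pathstart ?h" by (simp add: pathstart_def)
  note u = tail[OF loop_in_start[OF g]]
  have "based_class M p (?g +++ ?h) = based_class M p (?h +++ ?g)"
    unfolding based_class_def conj_class_def pathstart_join st
    by (intro Collect_homotopic_paths_eq homotopic_paths_join_right homotopic_paths_join_left hom)
       (use u st g h in \<open>auto simp: loop_in_def path_image_join\<close>)
  then show "based_class M p ?g \<otimes>\<^bsub>G\<^esub> based_class M p ?h = based_class M p ?h \<otimes>\<^bsub>G\<^esub> based_class M p ?g"
    by (simp only: based_class_join[OF g h st] based_class_join[OF h g st[symmetric]])
qed

lemma isotropic_pair_loops:
  assumes pair: "isotropic_pair G \<xi> \<xi>'"
  shows "isotropic_loop_pair M (\<lambda>f. \<xi> (based_class M p f)) (\<lambda>f. \<xi>' (based_class M p f))"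
  unfolding isotropic_loop_pair_def
proof (intro conjI allI impI)
  fix f g assume "homotopic_loops M f g"
  then show "\<xi> (based_class M p f) = \<xi> (based_class M p g)" "\<xi>' (based_class M p f) = \<xi>' (based_class M p g)"
    using additive_based_class_homotopic isotropic_pairD(1,2)[OF pair] by blast+
next
  fix f g assume "loop_in M f \<and> loop_in M g \<and> pathstart f = pathstart g"
  then have fg: "loop_in M f" "loop_in M g" "pathstart f = pathstart g" by auto
  show "\<xi> (based_class M p (f +++ g)) = \<xi> (based_class M p f) + \<xi> (based_class M p g)"
    "\<xi>' (based_class M p (f +++ g)) = \<xi>' (based_class M p f) + \<xi>' (based_class M p g)"
    unfolding based_class_join[OF fg]
    by (rule isotropic_pairD[OF pair based_class_closed[OF fg(1)] based_class_closed[OF fg(2)]])+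
next
  fix \<tau> :: "real \<times> real \<Rightarrow> 'a"
  assume "continuous_on ({0..1} \<times> {0..1}) \<tau> \<and> \<tau> ` ({0..1} \<times> {0..1}) \<subseteq> M \<and>
        (\<forall>s\<in>{0..1}. \<tau> (s, 0) = \<tau> (s, 1)) \<and> (\<forall>s\<in>{0..1}. \<tau> (0, s) = \<tau> (1, s))"
  then have \<tau>: "continuous_on ({0..1} \<times> {0..1}) \<tau>" "\<tau> ` ({0..1} \<times> {0..1}) \<subseteq> M"
        "\<forall>s\<in>{0..1}. \<tau> (s, 0) = \<tau> (s, 1)" "\<forall>s\<in>{0..1}. \<tau> (0, s) = \<tau> (1, s)" by auto
  note t = based_class_torus[OF \<tau>]
  show "\<xi> (based_class M p (\<lambda>s. \<tau> (s, 0))) * \<xi>' (based_class M p (\<lambda>s. \<tau> (0, s))) =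
        \<xi>' (based_class M p (\<lambda>s. \<tau> (s, 0))) * \<xi> (based_class M p (\<lambda>s. \<tau> (0, s)))"
    by (rule isotropic_pairD(3)[OF pair based_class_closed[OF t(1)] based_class_closed[OF t(2)] t(3)])
qed

end

text \<open>The winding number gives a homotopy in the plane punctured at \<open>a\<close>, which
  may leave \<open>W\<close>. Composing it with the radial retraction \<open>\<psi>\<close> onto the
  punctured disc of radius \<open>r\<close> brings it back, and \<open>\<gamma>\<close> is joined to
  \<open>\<psi> \<circ> \<gamma>\<close> by straight segments.\<close>

lemma winding_one_homotopic_circlepath:
  fixes W :: "complex set"
  assumes W: "convex W" "cball a r \<subseteq> W" "r > 0"
    and \<gamma>: "path \<gamma>" "path_image \<gamma> \<subseteq> W - {a}" "pathfinish \<gamma> = pathstart \<gamma>" and wn: "winding_number \<gamma> a = 1"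
  shows "homotopic_loops (W - {a}) \<gamma> (circlepath a r)"
proof -
  define \<psi> where "\<psi> z = a + of_real (min 1 (r / norm (z - a))) * (z - a)" for z
  have \<psi>_cont: "continuous_on (- {a}) \<psi>"
    unfolding \<psi>_def by (intro continuous_intros) auto
  have \<psi>_in: "\<psi> z \<in> cball a r - {a}" if "z \<noteq> a" for z
  proof -
    have n: "norm (z - a) > 0" using that by simp
    have "norm (\<psi> z - a) = min 1 (r / norm (z - a)) * norm (z - a)"
      using W(3) n by (simp add: \<psi>_def norm_mult min_def)
    also have "\<dots> \<le> r" using n W(3) by (auto simp: min_def field_simps)
    finally have "norm (\<psi> z - a) \<le> r" .
    moreover have "min 1 (r / norm (z - a)) > 0" using n W(3) by simp
    then have "\<psi> z \<noteq> a" using that by (simp add: \<psi>_def)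
    ultimately show ?thesis by (simp add: dist_norm norm_minus_commute)
  qed
  have ag: "a \<notin> path_image \<gamma>" using \<gamma>(2) by auto
  have "homotopic_loops (- {a}) \<gamma> (circlepath a r)"
    using winding_number_homotopic_loops_eq[of \<gamma> a "circlepath a r"] \<gamma> ag wn W(3)
    by (simp add: winding_number_circlepath_centre)
  then have "homotopic_loops (W - {a}) (\<psi> \<circ> \<gamma>) (\<psi> \<circ> circlepath a r)"
    by (rule homotopic_loops_continuous_image[OF _ \<psi>_cont]) (use \<psi>_in W(2) in auto)
  moreover have "homotopic_loops (W - {a}) \<gamma> (\<psi> \<circ> \<gamma>)"
  proof (rule homotopic_loops_linear[OF \<gamma>(1) _ \<gamma>(3)])
    show "path (\<psi> \<circ> \<gamma>)"
      using \<gamma>(1) ag by (intro path_continuous_image continuous_on_subset[OF \<psi>_cont]) auto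
    show "pathfinish (\<psi> \<circ> \<gamma>) = pathstart (\<psi> \<circ> \<gamma>)"
      using \<gamma>(3) by (simp add: pathfinish_compose pathstart_compose)
    show "closed_segment (\<gamma> t) ((\<psi> \<circ> \<gamma>) t) \<subseteq> W - {a}" if t: "t \<in> {0..1}" for t
    proof -
      have "\<gamma> t \<in> path_image \<gamma>" using t by (simp add: path_image_def)
      then have gt: "\<gamma> t \<in> W" "\<gamma> t \<noteq> a" using \<gamma>(2) by auto
      have pt: "\<psi> (\<gamma> t) \<in> W" using \<psi>_in[OF gt(2)] W(2) by auto
      \<comment> \<open>\<open>\<psi>\<close> moves a point along its own ray from \<open>a\<close>
        by a positive factor, so the segment stays on that open ray.\<close>
      have "a \<notin> closed_segment (\<gamma> t) (\<psi> (\<gamma> t))"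
      proof
        define k where "k = min 1 (r / norm (\<gamma> t - a))"
        have k: "k > 0" using gt(2) W(3) by (simp add: k_def)
        assume "a \<in> closed_segment (\<gamma> t) (\<psi> (\<gamma> t))"
        then obtain u where u: "0 \<le> u" "u \<le> 1" "a = (1 - u) *\<^sub>R \<gamma> t + u *\<^sub>R \<psi> (\<gamma> t)"
          by (auto simp: closed_segment_def)
        have "(1 - u) *\<^sub>R \<gamma> t + u *\<^sub>R \<psi> (\<gamma> t) - a = of_real (1 - u + u * k) * (\<gamma> t - a)"
          by (simp add: \<psi>_def k_def[symmetric] scaleR_conv_of_real algebra_simps)
        then have "1 - u + u * k = 0" using u(3) gt(2) by (metis diff_self mult_eq_0_iff of_real_eq_0_iff right_minus_eq)
        moreover have "u * k \<ge> 0" using u k by simp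
        ultimately have "u = 1" "u * k = 0" using u(1,2) by linarith+
        then show False using k by simp
      qed
      moreover have "closed_segment (\<gamma> t) (\<psi> (\<gamma> t)) \<subseteq> W" using gt pt W(1) by (simp add: closed_segment_subset)
      ultimately show ?thesis by auto
    qed
  qed
  moreover have "\<psi> \<circ> circlepath a r = circlepath a r"
    using W(3) by (simp add: fun_eq_iff \<psi>_def circlepath norm_mult)
  ultimately show ?thesis by (metis homotopic_loops_trans)
qed

definition loop_functional :: "'a::real_normed_vector set \<Rightarrow> ((real \<Rightarrow> 'a) \<Rightarrow> int) \<Rightarrow> bool" where
  "loop_functional M c \<longleftrightarrow>
     (\<forall>f g. homotopic_loops M f g \<longrightarrow> c f = c g) \<and>
     (\<forall>f g. loop_in M f \<and> loop_in M g \<and> pathstart f = pathstart g \<longrightarrow> c (f +++ g) = c f + c g)"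

lemma loop_functional_homotopic: "loop_functional M c \<Longrightarrow> homotopic_loops M f g \<Longrightarrow> c f = c g"
  by (simp add: loop_functional_def)

lemma loop_functional_circlepath_shrink:
  assumes c: "loop_functional M c" and \<Phi>: "continuous_on (ball a R' - {a}) \<Phi>" "\<Phi> ` (ball a R' - {a}) \<subseteq> M"
    and r: "0 < r" "r < R'" "0 < R" "R < R'"
  shows "c (\<Phi> \<circ> circlepath a R) = c (\<Phi> \<circ> circlepath a r)"
proof -
  have "homotopic_loops (ball a R' - {a}) (circlepath a R) (circlepath a r)"
    by (rule winding_one_homotopic_circlepath) (use r in \<open>auto simp: winding_number_circlepath_centre\<close>)
  then have "homotopic_loops M (\<Phi> \<circ> circlepath a R) (\<Phi> \<circ> circlepath a r)"
    by (rule homotopic_loops_continuous_image[OF _ \<Phi>(1)]) (use \<Phi>(2) in auto)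
  then show ?thesis by (rule loop_functional_homotopic[OF c])
qed

lemma loop_in_continuous_image:
  assumes "loop_in S f" "continuous_on S \<Phi>" "\<Phi> ` S \<subseteq> M"
  shows "loop_in M (\<Phi> \<circ> f)"
  using assms
  by (auto simp: loop_in_def path_image_compose pathfinish_compose pathstart_compose
      intro!: path_continuous_image intro: continuous_on_subset)

text \<open>The real diameter cuts the large circle into an upper and a lower loop, each going once
  around one puncture. Each loop lies in a convex region that excludes the other puncture and can be
  shrunk there to a small circle.\<close>

lemma loop_functional_circlepath_split:
  fixes \<Phi> :: "complex \<Rightarrow> 'a::real_normed_vector"
  assumes c: "loop_functional M c"
    and \<Phi>: "continuous_on (ball 0 R' - {\<i>, - \<i>}) \<Phi>" "\<Phi> ` (ball 0 R' - {\<i>, - \<i>}) \<subseteq> M"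
    and R: "2 \<le> R" "R < R'" and r: "0 < r" "r < 1"
  shows "c (\<Phi> \<circ> circlepath 0 R) = c (\<Phi> \<circ> circlepath \<i> r) + c (\<Phi> \<circ> circlepath (- \<i>) r)"
proof -
  let ?S = "ball 0 R' - {\<i>, - \<i>}"
  define A where "A = part_circlepath 0 R 0 pi"
  define B where "B = part_circlepath 0 R pi (2 * pi)"
  define u where "u = linepath (of_real R) (- of_real R :: complex)"
  have AB: "circlepath 0 R = A +++ B"
    by (auto simp: fun_eq_iff A_def B_def joinpaths_def circlepath_def part_circlepath_def linepath_def algebra_simps)
  have ends: "pathstart A = of_real R" "pathfinish A = - of_real R" "pathstart B = - of_real R"
    "pathfinish B = of_real R" "pathstart u = of_real R" "pathfinish u = - of_real R"
  proof -
    have "exp (\<i> * (2 * complex_of_real pi)) = 1" by (metis exp_two_pi_i mult.commute)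
    then show "pathfinish B = of_real R" by (simp add: B_def)
  qed (simp_all add: A_def B_def u_def)
  have paths: "path A" "path B" "path u" by (auto simp: A_def B_def u_def)
  have AI: "norm z = R \<and> Im z \<ge> 0" if z: "z \<in> path_image A" for z
  proof -
    obtain x where x: "0 \<le> x" "x \<le> 1" "z = of_real R * exp (\<i> * of_real (pi * x))"
      using z by (auto simp: path_image_def A_def part_circlepath_def linepath_def mult.commute)
    have "sin (pi * x) \<ge> 0" using x by (intro sin_ge_zero) (auto simp: mult_left_le)
    then show ?thesis using x R by (simp add: norm_mult Im_exp)
  qed
  have BI: "norm z = R \<and> Im z \<le> 0" if z: "z \<in> path_image B" for z
  proof -
    obtain x where x: "0 \<le> x" "x \<le> 1" "z = of_real R * exp (\<i> * of_real (pi + pi * x))"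
      using z by (auto simp: path_image_def B_def part_circlepath_def linepath_def algebra_simps)
    have "sin (pi * x) \<ge> 0" using x by (intro sin_ge_zero) (auto simp: mult_left_le)
    then have "sin (pi + pi * x) \<le> 0" by (simp add: sin_add)
    then show ?thesis using x R by (simp add: norm_mult Im_exp mult_nonneg_nonpos)
  qed
  have uI: "norm z \<le> R \<and> Im z = 0" if z: "z \<in> path_image u" for z
  proof -
    obtain x where x: "0 \<le> x" "x \<le> 1" "z = of_real ((1 - 2 * x) * R)"
      using z by (auto simp: path_image_def u_def linepath_def scaleR_conv_of_real algebra_simps)
    have "\<bar>(1 - 2 * x) * R\<bar> \<le> 1 * R" using x R by (simp only: abs_mult) (intro mult_mono, auto)
    then show ?thesis using x(3) by (simp only: norm_of_real Im_complex_of_real) simp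
  qed
  define \<gamma>1 where "\<gamma>1 = A +++ reversepath u"
  define \<gamma>2 where "\<gamma>2 = u +++ B"
  have im1: "z \<in> path_image \<gamma>1 \<Longrightarrow> norm z \<le> R \<and> Im z \<ge> 0 \<and> (norm z = R \<or> Im z = 0)" for z
    using AI[of z] uI[of z] ends by (auto simp: \<gamma>1_def path_image_join)
  have im2: "z \<in> path_image \<gamma>2 \<Longrightarrow> norm z \<le> R \<and> Im z \<le> 0 \<and> (norm z = R \<or> Im z = 0)" for z
    using BI[of z] uI[of z] ends by (auto simp: \<gamma>2_def path_image_join)
  have loops: "path \<gamma>1" "path \<gamma>2" "pathstart \<gamma>1 = of_real R" "pathfinish \<gamma>1 = of_real R"
    "pathstart \<gamma>2 = of_real R" "pathfinish \<gamma>2 = of_real R"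
    using paths ends by (auto simp: \<gamma>1_def \<gamma>2_def)
  have inS: "path_image A \<subseteq> ?S" "path_image B \<subseteq> ?S" "path_image u \<subseteq> ?S"
    using AI BI uI R by fastforce+
  have in12: "path_image \<gamma>1 \<subseteq> ?S" "path_image \<gamma>2 \<subseteq> ?S"
    using inS ends by (auto simp: \<gamma>1_def \<gamma>2_def path_image_join)
  have hom: "homotopic_paths ?S (\<gamma>1 +++ \<gamma>2) (circlepath 0 R)"
    unfolding \<gamma>1_def \<gamma>2_def AB by (rule homotopic_paths_cancel) (use paths ends inS in auto)
  have notin: "\<i> \<notin> path_image A" "\<i> \<notin> path_image B" "\<i> \<notin> path_image u"
    "- \<i> \<notin> path_image A" "- \<i> \<notin> path_image B" "- \<i> \<notin> path_image u"
    using inS by auto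
  have wn_circ: "winding_number (circlepath 0 R) \<i> = 1" "winding_number (circlepath 0 R) (- \<i>) = 1"
    using R by (auto intro!: winding_number_circlepath)
  have wn_sum: "winding_number A z + winding_number B z = 1"
    "winding_number \<gamma>1 z = winding_number A z - winding_number u z"
    "winding_number \<gamma>2 z = winding_number u z + winding_number B z" if "z = \<i> \<or> z = - \<i>" for z
  proof -
    have n: "z \<notin> path_image A" "z \<notin> path_image B" "z \<notin> path_image u" using notin that by auto
    show "winding_number A z + winding_number B z = 1"
      using wn_circ that paths n ends by (auto simp: AB winding_number_join)
    show "winding_number \<gamma>1 z = winding_number A z - winding_number u z"
      using paths n ends by (simp add: \<gamma>1_def winding_number_join winding_number_reversepath)
    show "winding_number \<gamma>2 z = winding_number u z + winding_number B z"
      using paths n ends by (simp add: \<gamma>2_def winding_number_join)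
  qed
  \<comment> \<open>The lower loop lies in a closed half-plane that misses \<open>\<i>\<close>. The
    total winding number of the large circle is 1, so the upper loop has winding number 1 about
    \<open>\<i>\<close>; the other puncture is treated symmetrically.\<close>
  have "winding_number \<gamma>2 \<i> = 0"
    by (rule winding_number_zero_outside[of _ "{z. Im z \<le> 0}"])
       (use loops im2 convex_halfspace_Im_le[of 0] in auto)
  then have wn1: "winding_number \<gamma>1 \<i> = 1" using wn_sum[of \<i>] by (simp add: algebra_simps add_eq_0_iff)
  have "winding_number \<gamma>1 (- \<i>) = 0"
    by (rule winding_number_zero_outside[of _ "{z. Im z \<ge> 0}"])
       (use loops im1 convex_halfspace_Im_ge[of 0] in auto)
  then have wn2: "winding_number \<gamma>2 (- \<i>) = 1" using wn_sum[of "- \<i>"] by (simp add: algebra_simps)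
  have small: "z \<in> cball \<i> r \<Longrightarrow> norm z < R' \<and> Im z > 0" "z \<in> cball (- \<i>) r \<Longrightarrow> norm z < R' \<and> Im z < 0" for z
  proof -
    assume "z \<in> cball \<i> r"
    then have "norm (z - \<i>) < 1" using r by (simp add: dist_norm norm_minus_commute)
    then show "norm z < R' \<and> Im z > 0"
      using abs_Im_le_cmod[of "z - \<i>"] norm_triangle_sub[of z \<i>] R by auto
  next
    assume "z \<in> cball (- \<i>) r"
    then have "norm (z + \<i>) < 1" using r by (simp add: dist_norm norm_minus_commute add.commute)
    then show "norm z < R' \<and> Im z < 0"
      using abs_Im_le_cmod[of "z + \<i>"] norm_triangle_sub[of z "- \<i>"] R by auto
  qed
  have h1: "homotopic_loops ((ball 0 R' \<inter> {z. Im z > -1}) - {\<i>}) \<gamma>1 (circlepath \<i> r)"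
  proof (rule winding_one_homotopic_circlepath[OF _ _ r(1) loops(1) _ _ wn1])
    show "convex (ball 0 R' \<inter> {z. Im z > -1})" by (intro convex_Int convex_ball convex_halfspace_Im_gt)
    show "cball \<i> r \<subseteq> ball 0 R' \<inter> {z. Im z > -1}" using small(1) by fastforce
    show "path_image \<gamma>1 \<subseteq> ball 0 R' \<inter> {z. Im z > -1} - {\<i>}" using im1 in12(1) by fastforce
  qed (simp add: loops)
  have h2: "homotopic_loops ((ball 0 R' \<inter> {z. Im z < 1}) - {- \<i>}) \<gamma>2 (circlepath (- \<i>) r)"
  proof (rule winding_one_homotopic_circlepath[OF _ _ r(1) loops(2) _ _ wn2])
    show "convex (ball 0 R' \<inter> {z. Im z < 1})" by (intro convex_Int convex_ball convex_halfspace_Im_lt)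
    show "cball (- \<i>) r \<subseteq> ball 0 R' \<inter> {z. Im z < 1}" using small(2) by fastforce
    show "path_image \<gamma>2 \<subseteq> ball 0 R' \<inter> {z. Im z < 1} - {- \<i>}" using im2 in12(2) by fastforce
  qed (simp add: loops)
  have image: "homotopic_loops M (\<Phi> \<circ> f) (\<Phi> \<circ> g)" if "homotopic_loops ?S f g" for f g
    by (rule homotopic_loops_continuous_image[OF that \<Phi>(1)]) (use \<Phi>(2) in auto)
  have "homotopic_loops ?S \<gamma>1 (circlepath \<i> r)" "homotopic_loops ?S \<gamma>2 (circlepath (- \<i>) r)"
    by (rule homotopic_loops_subset[OF h1], force) (rule homotopic_loops_subset[OF h2], force)
  then have e12: "c (\<Phi> \<circ> \<gamma>1) = c (\<Phi> \<circ> circlepath \<i> r)" "c (\<Phi> \<circ> \<gamma>2) = c (\<Phi> \<circ> circlepath (- \<i>) r)"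
    using image loop_functional_homotopic[OF c] by blast+
  have "homotopic_loops ?S (\<gamma>1 +++ \<gamma>2) (circlepath 0 R)"
    by (rule homotopic_paths_imp_homotopic_loops[OF hom]) (use loops in auto)
  then have "c (\<Phi> \<circ> (\<gamma>1 +++ \<gamma>2)) = c (\<Phi> \<circ> circlepath 0 R)"
    using image loop_functional_homotopic[OF c] by blast
  moreover have "c ((\<Phi> \<circ> \<gamma>1) +++ (\<Phi> \<circ> \<gamma>2)) = c (\<Phi> \<circ> \<gamma>1) + c (\<Phi> \<circ> \<gamma>2)"
  proof -
    have "loop_in M (\<Phi> \<circ> \<gamma>1)" "loop_in M (\<Phi> \<circ> \<gamma>2)"
      by (rule loop_in_continuous_image[OF _ \<Phi>]; use loops in12 in \<open>simp add: loop_in_def\<close>)+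
    moreover have "pathstart (\<Phi> \<circ> \<gamma>1) = pathstart (\<Phi> \<circ> \<gamma>2)" using loops by (simp add: pathstart_compose)
    ultimately show ?thesis using c unfolding loop_functional_def by blast
  qed
  ultimately show ?thesis by (simp add: compose_joinpaths e12)
qed

lemma loop_functional_isotropic:
  assumes "isotropic_loop_pair M c c'"
  shows "loop_functional M c" "loop_functional M c'"
  using assms unfolding isotropic_loop_pair_def loop_functional_def by simp_all

lemma isotropic_torus:
  assumes "isotropic_loop_pair M c c'"
    and "continuous_on ({0..1} \<times> {0..1}) \<tau>" "\<tau> ` ({0..1} \<times> {0..1}) \<subseteq> M"
    and "\<And>s. s \<in> {0..1} \<Longrightarrow> \<tau> (s, 0) = \<tau> (s, 1)" "\<And>s. s \<in> {0..1} \<Longrightarrow> \<tau> (0, s) = \<tau> (1, s)"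
  shows "c (\<lambda>s. \<tau> (s, 0)) * c' (\<lambda>s. \<tau> (0, s)) = c' (\<lambda>s. \<tau> (s, 0)) * c (\<lambda>s. \<tau> (0, s))"
  using assms unfolding isotropic_loop_pair_def by simp

section \<open>Meridians\<close>

context inscribed
begin

text \<open>Coordinates adapted to curve \<open>j\<close>: \<open>w\<close> is the value of its
  equation and \<open>z\<close> the position along it, measured by v on a line and by u on the
  conic.\<close>

definition chart :: "nat \<Rightarrow> complex \<Rightarrow> complex \<Rightarrow> complex \<times> complex" where
  "chart j z w = (if j < N then (t j + t (Suc j) - t j * t (Suc j) * z + w, z) else (z, (1 + w) / z))"

definition chart_dom :: "nat \<Rightarrow> complex \<Rightarrow> bool" where
  "chart_dom j z \<longleftrightarrow> j < N \<or> z \<noteq> 0"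

definition others :: "nat \<Rightarrow> complex \<times> complex \<Rightarrow> bool" where
  "others j q \<longleftrightarrow> (\<forall>i\<le>N. i \<noteq> j \<longrightarrow> eqn i q \<noteq> 0)"

definition generic :: "nat \<Rightarrow> complex \<Rightarrow> bool" where
  "generic j z \<longleftrightarrow> chart_dom j z \<and> others j (chart j z 0)"

text \<open>The closed transversal disc of radius \<open>norm k\<close> over \<open>z\<close> avoids
  all other curves. The parameter \<open>k\<close> is complex because it is also the starting value
  of the equation along the meridian.\<close>

definition admissible :: "nat \<Rightarrow> complex \<Rightarrow> complex \<Rightarrow> bool" where
  "admissible j z k \<longleftrightarrow> chart_dom j z \<and> k \<noteq> 0 \<and> (\<forall>w. norm w \<le> norm k \<longrightarrow> others j (chart j z w))"

definition meridian :: "nat \<Rightarrow> complex \<Rightarrow> complex \<Rightarrow> real \<Rightarrow> complex \<times> complex" where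
  "meridian j z k s = chart j z (k * exp (2 * of_real pi * \<i> * of_real s))"

lemma eqn_chart: "j \<le> N \<Longrightarrow> chart_dom j z \<Longrightarrow> eqn j (chart j z w) = w"
  by (auto simp: eqn_def chart_def chart_dom_def)

lemma compl_iff: "j \<le> N \<Longrightarrow> q \<in> compl \<longleftrightarrow> eqn j q \<noteq> 0 \<and> others j q"
  by (auto simp: compl_def others_def)

lemma open_others: "open {q. others j q}"
proof -
  have "{q. others j q} = (\<Inter>i\<in>{..N} - {j}. {q. eqn i q \<noteq> 0})"
    by (auto simp: others_def)
  moreover have "open {q. eqn i q \<noteq> 0}" for i
    by (intro open_Collect_neq continuous_intros)
  ultimately show ?thesis by (simp add: open_INT)
qed

lemma continuous_on_chart:
  assumes "continuous_on S f" "continuous_on S g" "\<And>x. x \<in> S \<Longrightarrow> chart_dom j (f x)"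
  shows "continuous_on S (\<lambda>x. chart j (f x) (g x))"
proof (cases "j < N")
  case True
  then show ?thesis using assms by (auto simp: chart_def intro!: continuous_intros)
next
  case False
  then have "\<forall>x\<in>S. f x \<noteq> 0" using assms(3) by (auto simp: chart_dom_def)
  then show ?thesis using False assms by (auto simp: chart_def intro!: continuous_intros)
qed

lemma generic_admissible:
  assumes "generic j z"
  obtains e where "e > 0" "\<forall>z' k. dist z z' < e \<longrightarrow> k \<noteq> 0 \<longrightarrow> norm k < e \<longrightarrow> admissible j z' k"
proof -
  let ?D = "{z. chart_dom j z} \<times> (UNIV :: complex set)"
  have "open {z. chart_dom j z}"
  proof (cases "j < N")
    case False
    then have "{z. chart_dom j z} = - {0}" by (auto simp: chart_dom_def)
    then show ?thesis using open_Compl[OF closed_singleton[of "0::complex"]] by (simp only:)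
  qed (simp add: chart_dom_def)
  then have D: "open ?D" by (simp add: open_Times)
  have "continuous_on ?D (\<lambda>q. chart j (fst q) (snd q))"
    by (intro continuous_on_chart continuous_intros) auto
  then have op: "open (?D \<inter> (\<lambda>q. chart j (fst q) (snd q)) -` {q. others j q})"
    by (rule continuous_open_preimage[OF _ D open_others])
  have mem: "(z, 0) \<in> ?D \<inter> (\<lambda>q. chart j (fst q) (snd q)) -` {q. others j q}"
    using assms by (auto simp: generic_def)
  obtain A B where AB: "open A" "open B" "(z, 0) \<in> A \<times> B"
    "A \<times> B \<subseteq> ?D \<inter> (\<lambda>q. chart j (fst q) (snd q)) -` {q. others j q}"
    using open_prod_elim[OF op mem] .
  obtain a where a: "a > 0" "ball z a \<subseteq> A" using AB(1,3) by (auto simp: open_contains_ball)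
  obtain b where b: "b > 0" "ball 0 b \<subseteq> B" using AB(2,3) by (auto simp: open_contains_ball)
  have "admissible j z' k" if "dist z z' < min a b" "k \<noteq> 0" "norm k < min a b" for z' k
  proof -
    have *: "chart_dom j z' \<and> others j (chart j z' w)" if "norm w \<le> norm k" for w
    proof -
      have "z' \<in> A" using a(2) \<open>dist z z' < min a b\<close> by auto
      moreover have "w \<in> B" using b(2) \<open>norm k < min a b\<close> that by auto
      ultimately have "(z', w) \<in> ?D \<inter> (\<lambda>q. chart j (fst q) (snd q)) -` {q. others j q}"
        using AB(4) by blast
      then show ?thesis by simp
    qed
    then show ?thesis using that(2) by (auto simp: admissible_def)
  qed
  then show ?thesis using that[of "min a b"] a(1) b(1) by simp
qed

lemma homotopic_loops_family:
  fixes K :: "real \<times> real \<Rightarrow> 'a::real_normed_vector"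
  assumes "continuous_on ({0..1} \<times> {0..1}) K" "\<And>x s. x \<in> {0..1} \<Longrightarrow> s \<in> {0..1} \<Longrightarrow> K (x, s) \<in> S"
    "\<And>x. x \<in> {0..1} \<Longrightarrow> K (x, 0) = K (x, 1)"
  shows "homotopic_loops S (\<lambda>s. K (0, s)) (\<lambda>s. K (1, s))"
  unfolding homotopic_loops
  using assms by (intro exI[of _ K]) (auto simp: pathfinish_def pathstart_def)

lemma exp_turn [simp]: "exp (2 * of_real pi * \<i> * of_real 1) = 1" "exp (2 * complex_of_real pi * \<i>) = 1"
  by (simp_all add: exp_two_pi_i)

lemma norm_exp_turn [simp]: "norm (exp (2 * complex_of_real pi * \<i> * of_real s)) = 1"
proof -
  have "2 * complex_of_real pi * \<i> * of_real s = \<i> * of_real (2 * pi * s)" by simp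
  then show ?thesis by (simp only: norm_exp_i_times)
qed

lemma generic_center: "admissible j z k \<Longrightarrow> generic j z"
  by (simp add: admissible_def generic_def)

lemma chart_in_compl:
  "j \<le> N \<Longrightarrow> admissible j z k \<Longrightarrow> w \<noteq> 0 \<Longrightarrow> norm w \<le> norm k \<Longrightarrow> chart j z w \<in> compl"
  by (simp add: compl_iff[of j] eqn_chart admissible_def)

lemma meridian_loop:
  assumes "j \<le> N" "admissible j z k"
  shows "loop_in compl (meridian j z k)"
proof -
  have "continuous_on {0..1} (\<lambda>s. chart j z (k * exp (2 * of_real pi * \<i> * of_real s)))"
    by (intro continuous_on_chart continuous_intros) (use assms in \<open>auto simp: admissible_def\<close>)
  moreover have "meridian j z k s \<in> compl" for s
    using chart_in_compl[OF assms] assms(2) by (simp add: meridian_def admissible_def norm_mult)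
  ultimately show ?thesis
    by (auto simp: loop_in_def path_def meridian_def[abs_def] path_image_def pathfinish_def pathstart_def)
qed

lemma meridian_radius:
  assumes c: "loop_functional compl c" and j: "j \<le> N" and k: "admissible j z k" "admissible j z k'"
  shows "c (meridian j z k) = c (meridian j z k')"
proof -
  \<comment> \<open>Interpolation of logarithms keeps the values away from 0. Their modulus is a
    weighted geometric mean of \<open>norm k\<close> and \<open>norm k'\<close>, so the larger of
    the two admissible discs contains the whole family.\<close>
  define l where "l x = exp ((1 - of_real x) * Ln k + of_real x * Ln k')" for x
  have nz: "k \<noteq> 0" "k' \<noteq> 0" using k by (auto simp: admissible_def)
  have l01: "l 0 = k" "l 1 = k'" using nz by (auto simp: l_def)
  have ln: "norm (l x) \<le> max (norm k) (norm k')" if "x \<in> {0..1}" for x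
  proof -
    have "norm (l x) = exp ((1 - x) * ln (norm k) + x * ln (norm k'))"
      using nz by (simp add: l_def norm_exp_eq_Re)
    also have "\<dots> \<le> exp ((1 - x) * ln (max (norm k) (norm k')) + x * ln (max (norm k) (norm k')))"
    proof -
      have "ln (norm k) \<le> ln (max (norm k) (norm k'))" "ln (norm k') \<le> ln (max (norm k) (norm k'))"
        using nz by (auto intro!: ln_le_cancel_iff[THEN iffD2] simp: less_max_iff_disj)
      then show ?thesis using that by (simp only: exp_le_cancel_iff) (intro add_mono mult_left_mono, auto)
    qed
    also have "\<dots> = max (norm k) (norm k')"
    proof -
      have "max (norm k) (norm k') > 0" using nz by (simp add: less_max_iff_disj)
      then show ?thesis by (simp add: left_diff_distrib exp_ln)
    qed
    finally show ?thesis .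
  qed
  define K where "K q = chart j z (l (fst q) * exp (2 * of_real pi * \<i> * of_real (snd q)))" for q
  have "homotopic_loops compl (\<lambda>s. K (0, s)) (\<lambda>s. K (1, s))"
  proof (rule homotopic_loops_family)
    show "continuous_on ({0..1} \<times> {0..1}) K"
      unfolding K_def[abs_def] l_def
      by (intro continuous_on_chart continuous_intros) (use k in \<open>auto simp: admissible_def\<close>)
    fix x s :: real assume x: "x \<in> {0..1}"
    define w where "w = l x * exp (2 * of_real pi * \<i> * of_real s)"
    have w: "w \<noteq> 0" "norm w \<le> max (norm k) (norm k')"
      using ln[OF x] by (auto simp: w_def norm_mult) (auto simp: l_def)
    have K: "K (x, s) = chart j z w" by (simp add: K_def w_def)
    show "K (x, s) \<in> compl"
    proof (cases "norm k \<le> norm k'")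
      case True
      then show ?thesis unfolding K using chart_in_compl[OF j k(2) w(1)] w(2) by simp
    next
      case False
      then show ?thesis unfolding K using chart_in_compl[OF j k(1) w(1)] w(2) by simp
    qed
  next
    show "K (x, 0) = K (x, 1)" for x by (simp add: K_def)
  qed
  then show ?thesis
    using loop_functional_homotopic[OF c] by (simp add: K_def l01 meridian_def[abs_def])
qed

lemma meridian_move:
  assumes c: "loop_functional compl c" and j: "j \<le> N"
    and adm: "\<And>x. x \<in> closed_segment z z' \<Longrightarrow> admissible j x k"
  shows "c (meridian j z k) = c (meridian j z' k)"
proof -
  define l where "l x = (1 - x) *\<^sub>R z + x *\<^sub>R z'" for x
  have l: "admissible j (l x) k" if "x \<in> {0..1}" for x
    using adm that by (auto simp: l_def closed_segment_def)
  have l01: "l 0 = z" "l 1 = z'" by (auto simp: l_def)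
  define K where "K q = chart j (l (fst q)) (k * exp (2 * of_real pi * \<i> * of_real (snd q)))" for q
  have "homotopic_loops compl (\<lambda>s. K (0, s)) (\<lambda>s. K (1, s))"
  proof (rule homotopic_loops_family)
    have cl: "continuous_on S (\<lambda>q. l (fst q))" for S :: "(real \<times> real) set"
      unfolding l_def by (intro continuous_intros)
    show "continuous_on ({0..1} \<times> {0..1}) K"
      unfolding K_def[abs_def]
      by (intro continuous_on_chart cl continuous_intros) (use l in \<open>auto simp: admissible_def\<close>)
    fix x s :: real assume x: "x \<in> {0..1}"
    show "K (x, s) \<in> compl"
      using chart_in_compl[OF j l[OF x]] l[OF x] by (simp add: K_def norm_mult admissible_def)
  next
    show "K (x, 0) = K (x, 1)" for x by (simp add: K_def)
  qed
  then show ?thesis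
    using loop_functional_homotopic[OF c] by (simp add: K_def l01 meridian_def[abs_def])
qed

section \<open>Intersections of the curves and uniqueness of meridians\<close>

lemma conic_on_line:
  "i < N \<Longrightarrow> eqn N (chart i z w) = - (t i * t (Suc i)) * (z - 1 / t i) * (z - 1 / t (Suc i)) + w * z"
  using t_nonzero[of i] t_nonzero[of "Suc i"]
  by (simp add: eqn_def chart_def field_simps)

lemma line_on_line:
  "i < N \<Longrightarrow> j < N \<Longrightarrow> eqn j (chart i z w) =
    (t j * t (Suc j) - t i * t (Suc i)) * z + (t i + t (Suc i) - t j - t (Suc j)) + w"
  by (simp add: eqn_def chart_def algebra_simps)

lemma line_on_conic:
  assumes "i < N" "z \<noteq> 0"
  shows "eqn i (chart N z 0) = (z - t i) * (z - t (Suc i)) / z"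
  using assms by (simp add: eqn_def chart_def field_simps)

lemma finite_nongeneric:
  assumes j: "j \<le> N"
  shows "finite {z. \<not> generic j z}"
proof -
  have lines: "finite {z. chart_dom j z \<and> eqn i (chart j z 0) = 0}" if i: "i \<le> N" "i \<noteq> j" for i
  proof -
    consider "i < N" "j < N" | "i = N" "j < N" | "i < N" "j = N" using i j by linarith
    then show ?thesis
    proof cases
      case 1
      let ?d = "t i * t (Suc i) - t j * t (Suc j)"
      have d: "?d \<noteq> 0" using not_parallel[OF 1] i by auto
      have "{z. chart_dom j z \<and> eqn i (chart j z 0) = 0} \<subseteq> {- (t j + t (Suc j) - t i - t (Suc i)) / ?d}"
      proof safe
        fix z assume "eqn i (chart j z 0) = 0"
        then have "?d * z + (t j + t (Suc j) - t i - t (Suc i)) = 0"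
          using line_on_line[OF 1(2,1), of z 0] by simp
        then have "?d * z = - (t j + t (Suc j) - t i - t (Suc i))"
          by (rule eq_neg_iff_add_eq_0[THEN iffD2])
        then show "z = - (t j + t (Suc j) - t i - t (Suc i)) / ?d" using d by (metis nonzero_mult_div_cancel_left)
      qed
      then show ?thesis using finite_subset by blast
    next
      case 2
      have "{z. chart_dom j z \<and> eqn i (chart j z 0) = 0} \<subseteq> {1 / t j, 1 / t (Suc j)}"
        using conic_on_line[OF 2(2)] t_nonzero by (auto simp: 2(1))
      then show ?thesis using finite_subset by blast
    next
      case 3
      have "{z. chart_dom j z \<and> eqn i (chart j z 0) = 0} \<subseteq> {t i, t (Suc i)}"
        using line_on_conic[OF 3(1)] by (auto simp: 3(2) chart_dom_def)
      then show ?thesis using finite_subset by blast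
    qed
  qed
  \<comment> \<open>The point 0 accounts for the parameter that the chart of the conic
    omits.\<close>
  have "{z. \<not> generic j z} \<subseteq> {0} \<union> (\<Union>i\<in>{..N} - {j}. {z. chart_dom j z \<and> eqn i (chart j z 0) = 0})"
    by (auto simp: generic_def chart_dom_def others_def)
  moreover have "finite ({0} \<union> (\<Union>i\<in>{..N} - {j}. {z. chart_dom j z \<and> eqn i (chart j z 0) = 0}))"
    using lines by (intro finite_UnI finite_UN_I) auto
  ultimately show ?thesis by (rule finite_subset)
qed

text \<open>The generic parameters of a curve form the plane minus a finite set, which is connected,
  and nearby meridians are freely homotopic after being shrunk to a common size. The relation
  \<open>R\<close> compares all radii at once so that it is an equivalence on generic
  parameters.\<close>

lemma meridian_unique:
  assumes c: "loop_functional compl c" and j: "j \<le> N" and k: "admissible j z k" "admissible j z' k'"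
  shows "c (meridian j z k) = c (meridian j z' k')"
proof -
  define R where "R x y \<longleftrightarrow> (\<forall>k k'. admissible j x k \<longrightarrow> admissible j y k' \<longrightarrow> c (meridian j x k) = c (meridian j y k'))" for x y
  have ex: "\<exists>k. admissible j x k" if gx: "generic j x" for x
  proof -
    obtain e where e: "e > 0" "\<forall>z' k. dist x z' < e \<longrightarrow> k \<noteq> 0 \<longrightarrow> norm k < e \<longrightarrow> admissible j z' k"
      using generic_admissible[OF gx] .
    then show ?thesis by (intro exI[of _ "of_real (e / 2)"]) simp
  qed
  have "{z. generic j z} = UNIV - {z. \<not> generic j z}" by auto
  then have con: "connected {z. generic j z}"
    using connected_open_delete_finite[OF open_UNIV connected_UNIV _ finite_nongeneric[OF j]] by simp
  have "R z z'"
  proof (rule connected_equivalence_relation[OF con, of z z' R])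
    show "z \<in> {z. generic j z}" "z' \<in> {z. generic j z}" using generic_center k by auto
    show "R y x" if "R x y" for x y using that by (auto simp: R_def)
    show "R x w" if xyw: "R x y" "R y w" "y \<in> {z. generic j z}" for x y w
    proof -
      obtain k where "admissible j y k" using ex xyw(3) by auto
      then show ?thesis using xyw(1,2) by (metis R_def)
    qed
    fix a assume "a \<in> {z. generic j z}"
    then have ga: "generic j a" by simp
    obtain e where e: "e > 0" "\<forall>z' k. dist a z' < e \<longrightarrow> k \<noteq> 0 \<longrightarrow> norm k < e \<longrightarrow> admissible j z' k"
      using generic_admissible[OF ga] .
    have "R a x" if x: "x \<in> ball a e" for x
      unfolding R_def
    proof (intro allI impI)
      fix k k' assume kk: "admissible j a k" "admissible j x k'"
      define d where "d = complex_of_real (e / 2)"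
      have d: "d \<noteq> 0" "norm d < e" using e(1) by (auto simp: d_def)
      have adm: "admissible j y d" if "y \<in> ball a e" for y using e(2) d that by auto
      have "c (meridian j a k) = c (meridian j a d)"
        by (rule meridian_radius[OF c j kk(1) adm]) (use e(1) in simp)
      also have "\<dots> = c (meridian j x d)"
      proof (rule meridian_move[OF c j adm])
        fix y assume "y \<in> closed_segment a x"
        then show "y \<in> ball a e" using closed_segment_subset[of a "ball a e" x] x e(1) by auto
      qed
      also have "\<dots> = c (meridian j x k')"
        by (rule meridian_radius[OF c j adm[OF x] kk(2)])
      finally show "c (meridian j a k) = c (meridian j x k')" .
    qed
    then show "\<exists>T. openin (top_of_set {z. generic j z}) T \<and> a \<in> T \<and> (\<forall>x\<in>T. R a x)"
      using ga e(1) by (intro exI[of _ "{z. generic j z} \<inter> ball a e"]) (auto intro: openin_open_Int)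
  qed
  then show ?thesis using k by (simp add: R_def)
qed

definition mer :: "((real \<Rightarrow> complex \<times> complex) \<Rightarrow> int) \<Rightarrow> nat \<Rightarrow> int" where
  "mer c j = (SOME x. \<exists>z k. admissible j z k \<and> x = c (meridian j z k))"

lemma mer_eq:
  assumes "loop_functional compl c" "j \<le> N" "admissible j z k"
  shows "c (meridian j z k) = mer c j"
  unfolding mer_def
  by (rule someI2[of _ "c (meridian j z k)"]) (use assms meridian_unique in blast)+

lemma admissible_exists:
  assumes "j \<le> N" obtains z k where "admissible j z k"
proof -
  have "\<exists>z. generic j z"
    using finite_nongeneric[OF assms] infinite_UNIV_char_0[where 'a = complex] by (metis (mono_tags, lifting) UNIV_eq_I mem_Collect_eq)
  then obtain z where z: "generic j z" ..
  obtain e where e: "e > 0" "\<forall>z' k. dist z z' < e \<longrightarrow> k \<noteq> 0 \<longrightarrow> norm k < e \<longrightarrow> admissible j z' k"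
    using generic_admissible[OF z] .
  then have "admissible j z (of_real (e / 2))" by simp
  then show ?thesis using that by blast
qed

text \<open>A disc crossing curve \<open>j\<close> transversally at a generic point has a meridian
  as its small boundary circle. The factor \<open>v - r\<close> carries the single turn, while
  \<open>f\<close> and the nonvanishing \<open>g\<close> can be deformed to their values at
  \<open>r\<close>.\<close>

lemma transversal_circle:
  assumes c: "loop_functional compl c" and j: "j \<le> N" and e0: "e0 > 0"
    and f: "continuous_on (ball r e0) f" and g: "continuous_on (ball r e0) g" and gr: "g r \<noteq> 0"
    and \<Lambda>: "\<And>v. v \<in> ball r e0 \<Longrightarrow> \<Lambda> v = chart j (f v) ((v - r) * g v)"
    and gen: "generic j (f r)"
  shows "\<exists>e>0. \<forall>\<rho>. 0 < \<rho> \<longrightarrow> \<rho> < e \<longrightarrow> c (\<Lambda> \<circ> circlepath r \<rho>) = mer c j"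
proof -
  obtain e1 where e1: "e1 > 0" "\<forall>z' k. dist (f r) z' < e1 \<longrightarrow> k \<noteq> 0 \<longrightarrow> norm k < e1 \<longrightarrow> admissible j z' k"
    using generic_admissible[OF gen] .
  have r0: "r \<in> ball r e0" using e0 by simp
  obtain d1 where d1: "d1 > 0" "\<And>v. v \<in> ball r e0 \<Longrightarrow> dist v r < d1 \<Longrightarrow> dist (f v) (f r) < e1"
    using f r0 e1(1) unfolding continuous_on_iff by metis
  have ng: "norm (g r) > 0" using gr by simp
  obtain d2 where d2: "d2 > 0" "\<And>v. v \<in> ball r e0 \<Longrightarrow> dist v r < d2 \<Longrightarrow> dist (g v) (g r) < norm (g r)"
    using g r0 ng unfolding continuous_on_iff by metis
  \<comment> \<open>\<open>d2\<close> keeps \<open>g\<close> nonzero and below twice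
    \<open>norm (g r)\<close>; the last bound then keeps the value of the equation below the
    admissible radius \<open>e1\<close>.\<close>
  define e where "e = min (min e0 (min d1 d2)) (e1 / (2 * norm (g r)))"
  have e: "e > 0" "e \<le> e0" "e \<le> d1" "e \<le> d2" "e \<le> e1 / (2 * norm (g r))"
    using e0 d1(1) d2(1) e1(1) ng by (auto simp: e_def)
  have "c (\<Lambda> \<circ> circlepath r \<rho>) = mer c j" if \<rho>: "0 < \<rho>" "\<rho> < e" for \<rho>
  proof -
    define E where "E s = exp (2 * complex_of_real pi * \<i> * of_real s)" for s :: real
    define v where "v q = r + of_real (fst q * \<rho>) * E (snd q)" for q :: "real \<times> real"
    have nE: "norm (E s) = 1" for s by (simp add: E_def)
    have vr: "dist (v q) r \<le> \<rho>" if "fst q \<in> {0..1}" for q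
      using that \<rho>(1) by (simp add: v_def dist_norm norm_mult nE mult_left_le_one_le)
    have vin: "v q \<in> ball r e0" "dist (v q) r < d1" "dist (v q) r < d2" if "fst q \<in> {0..1}" for q
      using vr[OF that] \<rho> e by (auto simp: dist_commute)
    \<comment> \<open>Only the arguments of \<open>f\<close> and \<open>g\<close> shrink towards
      \<open>r\<close>; the factor of modulus \<rho> that turns once is kept. Parameter 0 gives a
      meridian and parameter 1 the given circle.\<close>
    define K where "K q = chart j (f (v q)) (of_real \<rho> * E (snd q) * g (v q))" for q
    have adm: "admissible j (f (v q)) (of_real \<rho> * E s * g (v q))" if q: "fst q \<in> {0..1}" for q s
    proof -
      have dg: "dist (g (v q)) (g r) < norm (g r)" using d2(2) vin[OF q] by blast
      then have g0: "g (v q) \<noteq> 0" by (auto simp: dist_norm)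
      have "norm (g (v q)) \<le> norm (g r) + dist (g (v q)) (g r)"
        using norm_triangle_sub[of "g (v q)" "g r"] by (simp add: dist_norm)
      then have "norm (g (v q)) < 2 * norm (g r)" using dg by simp
      then have "\<rho> * norm (g (v q)) < e1 / (2 * norm (g r)) * (2 * norm (g r))"
        using \<rho> e ng by (intro mult_strict_mono) auto
      then have "norm (of_real \<rho> * E s * g (v q)) < e1" using ng \<rho> by (simp add: norm_mult nE)
      moreover have "dist (f r) (f (v q)) < e1"
        using d1(2)[OF vin(1)[OF q] vin(2)[OF q]] by (simp only: dist_commute)
      moreover have "of_real \<rho> * E s * g (v q) \<noteq> 0" using g0 \<rho> by (simp add: E_def)
      ultimately show ?thesis using e1(2) by blast
    qed
    have "homotopic_loops compl (\<lambda>s. K (0, s)) (\<lambda>s. K (1, s))"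
    proof (rule homotopic_loops_family)
      have cv: "continuous_on ({0..1} \<times> {0..1}) v" unfolding v_def E_def by (intro continuous_intros)
      have im: "v ` ({0..1} \<times> {0..1}) \<subseteq> ball r e0" using vin(1) by fastforce
      show "continuous_on ({0..1} \<times> {0..1}) K"
        unfolding K_def[abs_def]
      proof (rule continuous_on_chart)
        show "continuous_on ({0..1} \<times> {0..1}) (\<lambda>q. f (v q))"
          by (rule continuous_on_compose2[OF f cv im])
        have "continuous_on ({0..1} \<times> {0..1}) (\<lambda>q. g (v q))"
          by (rule continuous_on_compose2[OF g cv im])
        then show "continuous_on ({0..1} \<times> {0..1}) (\<lambda>q. of_real \<rho> * E (snd q) * g (v q))"
          unfolding E_def by (intro continuous_intros)
        show "chart_dom j (f (v q))" if "q \<in> {0..1} \<times> {0..1}" for q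
          using adm[of q] that by (auto simp: admissible_def)
      qed
      fix x s :: real assume x: "x \<in> {0..1}"
      have "fst (x, s) \<in> {0..1}" using x by simp
      note a = adm[OF this, of s]
      show "K (x, s) \<in> compl"
        using chart_in_compl[OF j a _ order_refl] a by (simp add: K_def admissible_def)
    next
      show "K (x, 0) = K (x, 1)" for x by (simp add: K_def v_def E_def)
    qed
    then have "c (\<lambda>s. K (0, s)) = c (\<lambda>s. K (1, s))" by (rule loop_functional_homotopic[OF c])
    moreover have "(\<lambda>s. K (0, s)) = meridian j (f r) (of_real \<rho> * g r)"
      by (simp add: fun_eq_iff K_def v_def meridian_def E_def mult_ac)
    moreover have "(\<lambda>s. K (1, s)) = \<Lambda> \<circ> circlepath r \<rho>"
    proof
      fix s
      have cp: "circlepath r \<rho> s = v (1, s)" by (simp add: circlepath v_def E_def mult_ac)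
      have "v (1, s) \<in> ball r e0" using vin(1)[of "(1, s)"] by simp
      from \<Lambda>[OF this] show "K (1, s) = (\<Lambda> \<circ> circlepath r \<rho>) s"
        by (simp add: cp K_def) (simp add: v_def)
    qed
    moreover have "admissible j (f r) (of_real \<rho> * g r)"
      using adm[of "(0, 0)" 0] by (simp add: v_def E_def)
    ultimately show ?thesis using mer_eq[OF c j] by simp
  qed
  then show ?thesis using e(1) by blast
qed

section \<open>Tori at double points and vertices\<close>

lemma tube:
  assumes i: "i < N" and K: "compact K" and nz: "\<And>v l. v \<in> K \<Longrightarrow> l \<in> L \<Longrightarrow> eqn l (chart i v 0) \<noteq> 0" and L: "finite L"
  shows "\<exists>e>0. \<forall>v\<in>K. \<forall>w. norm w < e \<longrightarrow> (\<forall>l\<in>L. eqn l (chart i v w) \<noteq> 0)"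
proof -
  let ?W = "{q. \<forall>l\<in>L. eqn l (chart i (snd q) (fst q)) \<noteq> 0}"
  have cc: "continuous_on UNIV (\<lambda>q. chart i (snd q) (fst q))"
    by (intro continuous_on_chart continuous_intros) (use i in \<open>auto simp: chart_dom_def\<close>)
  have "?W = (\<Inter>l\<in>L. {q. eqn l (chart i (snd q) (fst q)) \<noteq> 0})" by auto
  moreover have "open {q. eqn l (chart i (snd q) (fst q)) \<noteq> 0}" for l
    by (intro open_Collect_neq continuous_intros cc)
  ultimately have W: "open ?W" using L by (simp add: open_INT)
  have "{0} \<times> K \<subseteq> ?W" using nz by auto
  then obtain X where X: "0 \<in> X" "open X" "X \<times> K \<subseteq> ?W"
    using Elementary_Topology.tube_lemma[OF K W, of 0] by auto
  obtain e where e: "e > 0" "ball 0 e \<subseteq> X" using X(1,2) by (auto simp: open_contains_ball)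
  have "\<forall>v\<in>K. \<forall>w. norm w < e \<longrightarrow> (\<forall>l\<in>L. eqn l (chart i v w) \<noteq> 0)"
  proof (intro ballI allI impI)
    fix v w :: complex and l assume "v \<in> K" "norm w < e" "l \<in> L"
    then have "(w, v) \<in> X \<times> K" using e(2) by auto
    then show "eqn l (chart i v w) \<noteq> 0" using X(3) \<open>l \<in> L\<close> by auto
  qed
  then show ?thesis using e(1) by blast
qed

text \<open>\<open>B\<close> lists the curves allowed to pass through the point \<open>v0\<close> of
  line \<open>i\<close>. In the thickened disc of radius \<open>2 * d\<close> only these can be met
  besides line \<open>i\<close> itself, and over the annulus no curve other than \<open>i\<close> is
  met. Tori live over the annulus, and their pushed-off loops are contracted over the disc.\<close>

lemma line_neighborhood:
  assumes i: "i < N" and B: "\<And>l. l \<le> N \<Longrightarrow> l \<noteq> i \<Longrightarrow> l \<notin> B \<Longrightarrow> eqn l (chart i v0 0) \<noteq> 0"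
  obtains d e where "d > 0" "e > 0"
    "\<forall>v. v \<noteq> v0 \<longrightarrow> dist v0 v \<le> 2 * d \<longrightarrow> generic i v"
    "\<forall>v w l. dist v0 v \<le> 2 * d \<longrightarrow> norm w < e \<longrightarrow> l \<le> N \<longrightarrow> l \<noteq> i \<longrightarrow> l \<notin> B \<longrightarrow> eqn l (chart i v w) \<noteq> 0"
    "\<forall>v w. d / 2 \<le> dist v0 v \<longrightarrow> dist v0 v \<le> 2 * d \<longrightarrow> norm w < e \<longrightarrow> others i (chart i v w)"
proof -
  have "finite {z. \<not> generic i z}" using finite_nongeneric i by simp
  then obtain d0 where d0: "d0 > 0" "\<forall>x\<in>{z. \<not> generic i z}. x \<noteq> v0 \<longrightarrow> d0 \<le> dist v0 x"
    using finite_set_avoid by blast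
  define d where "d = d0 / 3"
  have d: "d > 0" "2 * d < d0" using d0(1) by (auto simp: d_def)
  have gen: "generic i v" if "v \<noteq> v0" "dist v0 v \<le> 2 * d" for v
    using d0(2) d that by force
  have "\<exists>e>0. \<forall>v\<in>cball v0 (2 * d). \<forall>w. norm w < e \<longrightarrow> (\<forall>l\<in>{..N} - {i} - B. eqn l (chart i v w) \<noteq> 0)"
  proof (rule tube[OF i compact_cball])
    show "eqn l (chart i v 0) \<noteq> 0" if "v \<in> cball v0 (2 * d)" "l \<in> {..N} - {i} - B" for v l
      using gen[of v] B[of l] that by (cases "v = v0") (auto simp: generic_def others_def)
  qed simp
  then obtain e1 where e1: "e1 > 0" "\<forall>v\<in>cball v0 (2 * d). \<forall>w. norm w < e1 \<longrightarrow> (\<forall>l\<in>{..N} - {i} - B. eqn l (chart i v w) \<noteq> 0)"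
    by blast
  have "\<exists>e>0. \<forall>v\<in>cball v0 (2 * d) - ball v0 (d / 2). \<forall>w. norm w < e \<longrightarrow> (\<forall>l\<in>{..N} - {i}. eqn l (chart i v w) \<noteq> 0)"
  proof (rule tube[OF i compact_diff[OF compact_cball open_ball]])
    show "eqn l (chart i v 0) \<noteq> 0" if "v \<in> cball v0 (2 * d) - ball v0 (d / 2)" "l \<in> {..N} - {i}" for v l
      using gen[of v] d(1) that by (cases "v = v0") (auto simp: generic_def others_def)
  qed simp
  then obtain e2 where e2: "e2 > 0" "\<forall>v\<in>cball v0 (2 * d) - ball v0 (d / 2). \<forall>w. norm w < e2 \<longrightarrow> (\<forall>l\<in>{..N} - {i}. eqn l (chart i v w) \<noteq> 0)"
    by blast
  show ?thesis
  proof (rule that[of d "min e1 e2"])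
    show "\<forall>v w l. dist v0 v \<le> 2 * d \<longrightarrow> norm w < min e1 e2 \<longrightarrow> l \<le> N \<longrightarrow> l \<noteq> i \<longrightarrow> l \<notin> B \<longrightarrow> eqn l (chart i v w) \<noteq> 0"
      using e1(2) by auto
    show "\<forall>v w. d / 2 \<le> dist v0 v \<longrightarrow> dist v0 v \<le> 2 * d \<longrightarrow> norm w < min e1 e2 \<longrightarrow> others i (chart i v w)"
      using e2(2) by (auto simp: others_def)
  qed (use d e1 e2 gen in auto)
qed

text \<open>A loop \<open>\<zeta>\<close> in the curve times the meridian circle is a torus in the
  complement. Its two generating loops are a meridian and the copy of \<open>\<zeta>\<close> pushed
  off the curve to the level \<open>k\<close>.\<close>

lemma line_torus:
  assumes pair: "isotropic_loop_pair compl c c'" and i: "i \<le> N"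
    and \<zeta>: "continuous_on {0..1} \<zeta>" "\<zeta> 0 = \<zeta> 1" and adm: "\<And>s. s \<in> {0..1} \<Longrightarrow> admissible i (\<zeta> s) k"
  shows "mer c i * c' (\<lambda>s. chart i (\<zeta> s) k) = mer c' i * c (\<lambda>s. chart i (\<zeta> s) k)"
proof -
  note cf = loop_functional_isotropic[OF pair]
  define \<tau> where "\<tau> q = chart i (\<zeta> (snd q)) (k * exp (2 * of_real pi * \<i> * of_real (fst q)))" for q :: "real \<times> real"
  have "c (\<lambda>s. \<tau> (s, 0)) * c' (\<lambda>s. \<tau> (0, s)) = c' (\<lambda>s. \<tau> (s, 0)) * c (\<lambda>s. \<tau> (0, s))"
  proof (rule isotropic_torus[OF pair])
    show "continuous_on ({0..1} \<times> {0..1}) \<tau>"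
      unfolding \<tau>_def[abs_def]
    proof (intro continuous_on_chart)
      show "continuous_on ({0..1} \<times> {0..1}) (\<lambda>q. \<zeta> (snd q))"
        by (rule continuous_on_compose2[OF \<zeta>(1) continuous_on_snd[OF continuous_on_id]]) auto
      show "continuous_on ({0..1} \<times> {0..1}) (\<lambda>q. k * exp (2 * of_real pi * \<i> * of_real (fst q)))"
        by (intro continuous_intros)
      show "chart_dom i (\<zeta> (snd q))" if "q \<in> {0..1} \<times> {0..1}" for q
        using adm[of "snd q"] that by (auto simp: admissible_def)
    qed
    show "\<tau> ` ({0..1} \<times> {0..1}) \<subseteq> compl"
    proof (rule image_subsetI)
      fix q :: "real \<times> real" assume "q \<in> {0..1} \<times> {0..1}"
      then have q: "snd q \<in> {0..1}" by auto
      show "\<tau> q \<in> compl"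
        using chart_in_compl[OF i adm[OF q]] adm[OF q] by (simp add: \<tau>_def norm_mult admissible_def)
    qed
    show "\<tau> (s, 0) = \<tau> (s, 1)" "\<tau> (0, s) = \<tau> (1, s)" for s using \<zeta>(2) by (simp_all add: \<tau>_def)
  qed
  moreover have "(\<lambda>s. \<tau> (s, 0)) = meridian i (\<zeta> 0) k" by (simp add: fun_eq_iff \<tau>_def meridian_def)
  moreover have "(\<lambda>s. \<tau> (0, s)) = (\<lambda>s. chart i (\<zeta> s) k)" by (simp add: \<tau>_def)
  ultimately show ?thesis using mer_eq[OF cf(1) i adm[of 0]] mer_eq[OF cf(2) i adm[of 0]] by simp
qed

text \<open>The loop of the torus pushed off line \<open>i\<close> bounds a disc parallel to line
  \<open>i\<close>. This disc meets the arrangement once, where line \<open>j\<close> crosses it, so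
  the loop has the value of a meridian of \<open>j\<close>.\<close>

lemma mer_double_point:
  assumes pair: "isotropic_loop_pair compl c c'" and i: "i < N" and j: "j < N" and ij: "i \<noteq> j"
    and v0: "eqn j (chart i v0 0) = 0"
    and others0: "\<And>l. l \<le> N \<Longrightarrow> l \<noteq> i \<Longrightarrow> l \<noteq> j \<Longrightarrow> eqn l (chart i v0 0) \<noteq> 0"
  shows "mer c i * mer c' j = mer c' i * mer c j"
proof -
  note cf = loop_functional_isotropic[OF pair]
  obtain d e where de: "d > 0" "e > 0"
    "\<forall>v w l. dist v0 v \<le> 2 * d \<longrightarrow> norm w < e \<longrightarrow> l \<le> N \<longrightarrow> l \<noteq> i \<longrightarrow> l \<notin> {j} \<longrightarrow> eqn l (chart i v w) \<noteq> 0"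
    "\<forall>v w. d / 2 \<le> dist v0 v \<longrightarrow> dist v0 v \<le> 2 * d \<longrightarrow> norm w < e \<longrightarrow> others i (chart i v w)"
    by (rule line_neighborhood[OF i, of "{j}" v0]) (use others0 in auto)
  define D where "D = t j * t (Suc j) - t i * t (Suc i)"
  have D: "D \<noteq> 0" using not_parallel[OF j i] ij by (auto simp: D_def)
  \<comment> \<open>The first bound keeps the level inside the tube of thickness \<open>e\<close>,
    the second moves the crossing with line \<open>j\<close> by at most
    \<open>d / 4\<close>.\<close>
  define x where "x = min (e / 2) (norm D * d / 4)"
  have x: "x > 0" "x < e" "x \<le> norm D * d / 4" using de(1,2) D by (auto simp: x_def)
  define k where "k = complex_of_real x"
  have k: "k \<noteq> 0" "norm k < e" "norm k \<le> norm D * d / 4"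
    using x by (simp_all add: k_def)
  \<comment> \<open>The parameter at which line \<open>j\<close> crosses the line pushed off to
    level \<open>k\<close>.\<close>
  define r where "r = v0 - k / D"
  have vr: "dist v0 r \<le> d / 4"
    using k(3) D by (simp add: r_def dist_norm norm_divide field_simps)
  have eqnj: "eqn j (chart i v k) = (v - r) * D" for v
  proof -
    have "D * v0 + (t i + t (Suc i) - t j - t (Suc j)) = 0"
      using v0 line_on_line[OF i j, of v0 0] by (simp add: D_def)
    then have "D * v + (t i + t (Suc i) - t j - t (Suc j)) + k = D * v - D * v0 + k" by (simp add: algebra_simps add_eq_0_iff)
    also have "\<dots> = (v - r) * D" using D by (simp add: r_def field_simps)
    finally show ?thesis using line_on_line[OF i j, of v k] by (simp add: D_def)
  qed
  have dom: "chart_dom l v" if "l < N" for l v using that by (simp add: chart_dom_def)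
  have snd_chart: "chart i v k = chart j v ((v - r) * D)" for v
  proof -
    have "fst (chart i v k) + t j * t (Suc j) * v - (t j + t (Suc j)) = (v - r) * D"
      using eqnj[of v] j i by (simp add: eqn_def chart_def)
    then have "fst (chart i v k) = t j + t (Suc j) - t j * t (Suc j) * v + (v - r) * D"
      by (simp add: algebra_simps)
    then show ?thesis using i j by (simp add: chart_def)
  qed
  let ?\<Phi> = "\<lambda>v. chart i v k"
  have near: "dist v0 v \<le> 2 * d" if "v \<in> ball r (3 * d / 2)" for v
  proof -
    have "dist v0 v \<le> dist v0 r + dist r v" by (rule dist_triangle)
    then show ?thesis using that vr de(1) by simp
  qed
  have \<Phi>c: "continuous_on (ball r (3 * d / 2) - {r}) ?\<Phi>"
    by (intro continuous_on_chart continuous_intros) (use dom i in auto)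
  have \<Phi>M: "?\<Phi> ` (ball r (3 * d / 2) - {r}) \<subseteq> compl"
  proof (rule image_subsetI)
    fix v assume "v \<in> ball r (3 * d / 2) - {r}"
    then have v: "v \<in> ball r (3 * d / 2)" "v \<noteq> r" by auto
    have "eqn l (chart i v k) \<noteq> 0" if "l \<le> N" for l
    proof (cases "l = i \<or> l = j")
      case True
      then show ?thesis using eqn_chart[of i v k] i dom k(1) eqnj[of v] v(2) D by auto
    next
      case False
      then show ?thesis using de(3) near[OF v(1)] k(2) that by auto
    qed
    then show "chart i v k \<in> compl" by (simp add: compl_def)
  qed
  have gen: "generic j r"
    unfolding generic_def others_def
  proof (intro conjI allI impI)
    fix l assume l: "l \<le> N" "l \<noteq> j"
    have "chart j r 0 = chart i r k" using snd_chart[of r] by simp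
    moreover have "eqn l (chart i r k) \<noteq> 0"
    proof (cases "l = i")
      case True
      then show ?thesis using eqn_chart[of i r k] i dom k(1) by auto
    next
      case False
      then show ?thesis using de(3) near[of r] de(1) k(2) l by auto
    qed
    ultimately show "eqn l (chart j r 0) \<noteq> 0" by simp
  qed (use dom j in auto)
  have loop: "f (?\<Phi> \<circ> circlepath r d) = mer f j" if f: "loop_functional compl f" for f
  proof -
    have "\<exists>e>0. \<forall>\<rho>. 0 < \<rho> \<longrightarrow> \<rho> < e \<longrightarrow> f (?\<Phi> \<circ> circlepath r \<rho>) = mer f j"
      by (rule transversal_circle[OF f, of j 1 r "\<lambda>v. v" "\<lambda>v. D"])
         (use j D snd_chart gen in \<open>auto intro!: continuous_intros\<close>)
    then obtain e1 where e1: "e1 > 0" "\<And>\<rho>. 0 < \<rho> \<Longrightarrow> \<rho> < e1 \<Longrightarrow> f (?\<Phi> \<circ> circlepath r \<rho>) = mer f j" by blast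
    define \<rho> where "\<rho> = min (e1 / 2) d"
    have "f (?\<Phi> \<circ> circlepath r d) = f (?\<Phi> \<circ> circlepath r \<rho>)"
      by (rule loop_functional_circlepath_shrink[OF f \<Phi>c \<Phi>M]) (use de(1) e1(1) in \<open>auto simp: \<rho>_def\<close>)
    also have "\<dots> = mer f j" by (rule e1(2)) (use de(1) e1(1) in \<open>auto simp: \<rho>_def\<close>)
    finally show ?thesis .
  qed
  have "mer c i * c' (\<lambda>s. chart i (circlepath r d s) k) = mer c' i * c (\<lambda>s. chart i (circlepath r d s) k)"
  proof (rule line_torus[OF pair, where \<zeta> = "circlepath r d"])
    show "continuous_on {0..1} (circlepath r d)" using path_circlepath[of r d] by (simp add: path_def)
    show "circlepath r d 0 = circlepath r d 1" by (simp add: circlepath)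
    fix s :: real
    have "dist r (circlepath r d s) = d" using de(1) by (simp add: circlepath dist_norm norm_mult)
    then have "d / 2 \<le> dist v0 (circlepath r d s)" "dist v0 (circlepath r d s) \<le> 2 * d"
      using vr de(1) dist_triangle[of v0 "circlepath r d s" r] dist_triangle2[of r "circlepath r d s" v0]
      by (auto simp: dist_commute)
    then show "admissible i (circlepath r d s) k"
      using de(4) k dom[OF i] by (auto simp: admissible_def)
  qed (use i in simp)
  then show ?thesis using loop[OF cf(1)] loop[OF cf(2)] by (simp add: o_def)
qed

text \<open>The edge through the vertices a and b, pushed off to level \<open>k\<close>, meets the
  edge through b and c at \<open>r1\<close> and the conic at \<open>r2\<close> near 1/b and at
  \<open>r2'\<close> near 1/a. Suitable values are found by letting one parameter tend to 0.\<close>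

lemma vertex_parameters:
  fixes a b c :: complex
  assumes "a \<noteq> 0" "b \<noteq> 0" "a \<noteq> b" "b \<noteq> c" "a \<noteq> c" and d: "d > 0" "e > 0" and far: "2 * d < dist (1 / b) (1 / a)"
  shows "\<exists>k r1 r2 r2'. k \<noteq> 0 \<and> norm k < e \<and> r1 \<noteq> r2 \<and> dist (1 / b) ((r1 + r2) / 2) \<le> d / 2 \<and>
     norm (r1 - r2) \<le> d / 2 \<and> 2 * d < dist (1 / b) r2' \<and> b * (c - a) * r1 = (c - a) - k \<and>
     a * b * (r2 + r2') = a + b + k \<and> a * b * (r2 * r2') = 1"
proof -
  \<comment> \<open>A root of the conic equation is prescribed and the level is solved for, which
    avoids square roots: \<open>r2 = (1 + x) / b\<close> forces \<open>r2' = 1 / (a (1 + x))\<close>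
    by the product of the roots, and their sum then determines \<open>k\<close>.\<close>
  define k where "k x = x * (a - b / (1 + x))" for x
  define r1 where "r1 x = (1 - k x / (c - a)) / b" for x
  define r2 where "r2 x = (1 + x) / b" for x
  define r2' where "r2' x = 1 / (a * (1 + x))" for x
  have nz: "1 + (0::complex) \<noteq> 0" "c - a \<noteq> 0" using assms by auto
  have lk: "(k \<longlongrightarrow> 0) (at 0)"
    unfolding k_def using nz by (auto intro!: tendsto_eq_intros)
  have lr1: "(r1 \<longlongrightarrow> 1 / b) (at 0)"
    unfolding r1_def using nz assms lk by (auto intro!: tendsto_eq_intros)
  have lr2: "(r2 \<longlongrightarrow> 1 / b) (at 0)"
    unfolding r2_def using nz assms by (auto intro!: tendsto_eq_intros)
  have lr2': "(r2' \<longlongrightarrow> 1 / a) (at 0)"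
    unfolding r2'_def using nz assms by (auto intro!: tendsto_eq_intros)
  have la: "((\<lambda>x. a - b / (1 + x)) \<longlongrightarrow> a - b) (at 0)" and lc: "((\<lambda>x. c - b / (1 + x)) \<longlongrightarrow> c - b) (at 0)"
    by (auto intro!: tendsto_eq_intros)
  have lm: "((\<lambda>x. dist (1 / b) ((r1 x + r2 x) / 2)) \<longlongrightarrow> 0) (at 0)"
    using tendsto_dist[OF tendsto_const[of "1 / b"] tendsto_divide[OF tendsto_add[OF lr1 lr2] tendsto_const[of 2]]] by simp
  have lh: "((\<lambda>x. norm (r1 x - r2 x)) \<longlongrightarrow> 0) (at 0)"
    using tendsto_norm[OF tendsto_diff[OF lr1 lr2]] by simp
  have lf: "((\<lambda>x. dist (1 / b) (r2' x)) \<longlongrightarrow> dist (1 / b) (1 / a)) (at 0)"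
    by (intro tendsto_intros lr2')
  have ev1: "\<forall>\<^sub>F x in at 0. norm (k x) < e" using order_tendstoD(2)[OF tendsto_norm[OF lk], of e] d by simp
  have ev2: "\<forall>\<^sub>F x in at 0. a - b / (1 + x) \<noteq> 0" using tendsto_imp_eventually_ne[OF la, of 0] assms by simp
  have ev3: "\<forall>\<^sub>F x in at 0. c - b / (1 + x) \<noteq> 0" using tendsto_imp_eventually_ne[OF lc, of 0] assms by simp
  have ev4: "\<forall>\<^sub>F x in at 0. dist (1 / b) ((r1 x + r2 x) / 2) < d / 2" using order_tendstoD(2)[OF lm, of "d / 2"] d by simp
  have ev5: "\<forall>\<^sub>F x in at 0. norm (r1 x - r2 x) < d / 2" using order_tendstoD(2)[OF lh, of "d / 2"] d by simp
  have ev6: "\<forall>\<^sub>F x in at 0. 2 * d < dist (1 / b) (r2' x)" using order_tendstoD(1)[OF lf far] .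
  have ev7: "\<forall>\<^sub>F x in at 0. 1 + x \<noteq> (0::complex)"
    by (rule tendsto_imp_eventually_ne[of _ "1 + 0"]) (auto intro!: tendsto_eq_intros)
  have ev8: "\<forall>\<^sub>F x in at 0. x \<noteq> (0::complex)" by (simp add: eventually_at_filter)
  have "\<forall>\<^sub>F x in at 0. norm (k x) < e \<and> a - b / (1 + x) \<noteq> 0 \<and> c - b / (1 + x) \<noteq> 0 \<and>
      dist (1 / b) ((r1 x + r2 x) / 2) < d / 2 \<and> norm (r1 x - r2 x) < d / 2 \<and> 2 * d < dist (1 / b) (r2' x) \<and>
      1 + x \<noteq> 0 \<and> x \<noteq> 0"
    by (intro eventually_conj ev1 ev2 ev3 ev4 ev5 ev6 ev7 ev8)
  then obtain x where x: "norm (k x) < e" "a - b / (1 + x) \<noteq> 0" "c - b / (1 + x) \<noteq> 0"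
      "dist (1 / b) ((r1 x + r2 x) / 2) < d / 2" "norm (r1 x - r2 x) < d / 2" "2 * d < dist (1 / b) (r2' x)"
      "1 + x \<noteq> 0" "x \<noteq> 0"
    using eventually_happens'[OF at_neq_bot] by blast
  have e1: "b * (c - a) * r1 x = (c - a) - k x" using assms nz(2) by (simp add: r1_def field_simps)
  have br2: "b * (c - a) * r2 x = (c - a) * (1 + x)" using assms by (simp add: r2_def)
  \<comment> \<open>The two crossings are distinct because their scaled difference is -x (c - b / (1
    + x)), where the bracket tends to c - b.\<close>
  have "b * (c - a) * (r1 x - r2 x) = (c - a) - k x - (c - a) * (1 + x)"
    by (simp only: right_diff_distrib[of "b * (c - a)"] e1 br2)
  also have "\<dots> = - x * (c - b / (1 + x))" by (simp add: k_def algebra_simps)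
  finally have ne: "r1 x \<noteq> r2 x" using x(3,8) by auto
  define q where "q = b / (1 + x)"
  have "q * (1 + x) = b" using x(7) by (simp add: q_def)
  then have q: "q + q * x = b" by (simp add: distrib_left)
  have "a * b * r2 x = a * (1 + x)" using assms by (simp add: r2_def)
  moreover have "a * b * r2' x = q" using assms by (simp add: r2'_def q_def)
  ultimately have e2: "a * b * (r2 x + r2' x) = a + b + k x"
    by (simp add: distrib_left k_def flip: q_def) (simp add: algebra_simps flip: q)
  have e3: "a * b * (r2 x * r2' x) = 1"
    using assms x(7) by (simp add: r2_def r2'_def)
  have "k x \<noteq> 0" using x by (simp add: k_def)
  then have "k x \<noteq> 0 \<and> norm (k x) < e \<and> r1 x \<noteq> r2 x \<and> dist (1 / b) ((r1 x + r2 x) / 2) \<le> d / 2 \<and>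
     norm (r1 x - r2 x) \<le> d / 2 \<and> 2 * d < dist (1 / b) (r2' x) \<and> b * (c - a) * r1 x = (c - a) - k x \<and>
     a * b * (r2 x + r2' x) = a + b + k x \<and> a * b * (r2 x * r2' x) = 1"
    using x(1,4,5,6) ne e1 e2 e3 by (intro conjI less_imp_le)
  then show ?thesis by blast
qed

text \<open>b is the common vertex of edge \<open>i\<close> through a and edge \<open>j\<close>
  through c. A disc parallel to edge \<open>i\<close> now meets line \<open>j\<close> and the conic
  once each, so its boundary has the sum of both meridian values. The hypotheses use only symmetric
  functions of the end points, so the two edges can be exchanged.\<close>

lemma mer_vertex:
  assumes pair: "isotropic_loop_pair compl f f'" and i: "i < N" and j: "j < N" and ij: "i \<noteq> j"
    and abc: "a \<noteq> 0" "b \<noteq> 0" "a \<noteq> b" "b \<noteq> c" "a \<noteq> c"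
    and wi: "t i * t (Suc i) = a * b" "t i + t (Suc i) = a + b"
    and wj: "t j * t (Suc j) = b * c" "t j + t (Suc j) = b + c"
    and others0: "\<And>l. l < N \<Longrightarrow> l \<noteq> i \<Longrightarrow> l \<noteq> j \<Longrightarrow> eqn l (b, 1 / b) \<noteq> 0"
  shows "mer f i * (mer f' j + mer f' N) = mer f' i * (mer f j + mer f N)"
proof -
  note cf = loop_functional_isotropic[OF pair]
  have P: "chart i (1 / b) 0 = (b, 1 / b)" using i abc(2) by (simp add: chart_def wi)
  obtain d e where de: "d > 0" "e > 0"
    "\<forall>v. v \<noteq> 1 / b \<longrightarrow> dist (1 / b) v \<le> 2 * d \<longrightarrow> generic i v"
    "\<forall>v w l. dist (1 / b) v \<le> 2 * d \<longrightarrow> norm w < e \<longrightarrow> l \<le> N \<longrightarrow> l \<noteq> i \<longrightarrow> l \<notin> {j, N} \<longrightarrow> eqn l (chart i v w) \<noteq> 0"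
    "\<forall>v w. d / 2 \<le> dist (1 / b) v \<longrightarrow> dist (1 / b) v \<le> 2 * d \<longrightarrow> norm w < e \<longrightarrow> others i (chart i v w)"
    by (rule line_neighborhood[OF i, of "{j, N}" "1 / b"]) (use others0 P in auto)
  have chart_i: "chart i v w = (a + b - a * b * v + w, v)" for v w using i by (simp add: chart_def wi)
  have chart_j: "chart j v w = (b + c - b * c * v + w, v)" for v w using j by (simp add: chart_def wj)
  \<comment> \<open>Edge \<open>i\<close> meets the conic again at the vertex a, so this parameter
    lies outside the disc on which 1/b is the only nongeneric one.\<close>
  have "\<not> generic i (1 / a)"
    using i abc by (auto simp: generic_def others_def chart_i eqn_def intro!: exI[of _ N])
  then have far: "2 * d < dist (1 / b) (1 / a)" using de(3) abc by (metis divide_cancel_left not_le one_neq_zero)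
  obtain k r1 r2 r2' where par: "k \<noteq> 0" "norm k < e" "r1 \<noteq> r2" "dist (1 / b) ((r1 + r2) / 2) \<le> d / 2"
     "norm (r1 - r2) \<le> d / 2" "2 * d < dist (1 / b) r2'" "b * (c - a) * r1 = (c - a) - k"
     "a * b * (r2 + r2') = a + b + k" "a * b * (r2 * r2') = 1"
    using vertex_parameters[OF abc de(1,2) far] by blast
  \<comment> \<open>The affine map y \<mapsto> m + h y places the crossings \<open>r1\<close> and
    \<open>r2\<close> at the normalised punctures \<open>\<i>\<close> and \<open>- \<i>\<close> of
    \<open>loop_functional_circlepath_split\<close>.\<close>
  define m h where "m = (r1 + r2) / 2" and "h = (r1 - r2) / (2 * \<i>)"
  have mh: "m + h * \<i> = r1" "m + h * (- \<i>) = r2" by (simp_all add: m_def h_def field_simps)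
  have h: "h \<noteq> 0" "norm h \<le> d / 4" using par(3,5) by (auto simp: h_def norm_divide norm_mult)
  define R where "R = d / norm h"
  have R: "norm h * R = d" "R \<ge> 4" using h de(1) by (auto simp: R_def field_simps)
  have eqn_j: "eqn j (chart i v k) = b * (c - a) * (v - r1)" for v
    using par(7) j by (simp add: eqn_def chart_i wj algebra_simps)
  have eqn_N: "eqn N (chart i v k) = - (a * b) * ((v - r2) * (v - r2'))" for v
  proof -
    have "- (a * b) * ((v - r2) * (v - r2')) = - (a * b) * v * v + (a * b * (r2 + r2')) * v - a * b * (r2 * r2')"
      by (simp add: algebra_simps)
    then show ?thesis unfolding par(8,9) by (simp add: eqn_def chart_i algebra_simps)
  qed
  let ?\<Phi> = "\<lambda>y. chart i (m + h * y) k"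
  \<comment> \<open>The centre \<open>m\<close> is at most \<open>d / 2\<close> away from 1/b, so
    radius \<open>3 / 2 * d\<close> in the edge parameter is the largest that is sure to stay within
    \<open>2 * d\<close>.\<close>
  let ?R' = "3 / 2 * R"
  have dom: "chart_dom l v" if "l < N" for l v using that by (simp add: chart_dom_def)
  have near: "dist (1 / b) (m + h * y) \<le> 2 * d" if "y \<in> ball 0 ?R'" for y
  proof -
    have "dist (1 / b) (m + h * y) \<le> dist (1 / b) m + norm (h * y)"
      using dist_triangle[of "1 / b" "m + h * y" m] by (simp add: dist_norm)
    moreover have "norm (h * y) \<le> norm h * ?R'"
      unfolding norm_mult by (rule mult_left_mono) (use that in auto)
    moreover have "norm h * ?R' = 3 / 2 * d" using R(1) by simp
    moreover have "dist (1 / b) m \<le> d / 2" using par(4) by (simp only: m_def)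
    ultimately show ?thesis by linarith
  qed
  have \<i>R: "\<i> \<in> ball 0 ?R'" "- \<i> \<in> ball 0 ?R'" using R(2) by auto
  have notr2': "m + h * y \<noteq> r2'" if "y \<in> ball 0 ?R'" for y using near[OF that] par(6) by auto
  have vr: "m + h * y - r1 = h * (y - \<i>)" "m + h * y - r2 = h * (y + \<i>)" for y
    using mh by (auto simp: algebra_simps)
  have ba: "b * (c - a) \<noteq> 0" "a * b \<noteq> 0" using abc by auto
  have rest: "eqn l (?\<Phi> y) \<noteq> 0" if "y \<in> ball 0 ?R'" "l < N" "l \<noteq> j" for l y
  proof (cases "l = i")
    case True
    then show ?thesis using eqn_chart[of i "m + h * y" k] i dom par(1) by auto
  next
    case False
    then show ?thesis using de(4) near[OF that(1)] par(2) that(2,3) by auto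
  qed
  have \<Phi>c: "continuous_on S ?\<Phi>" for S
    by (intro continuous_on_chart continuous_intros) (use dom i in auto)
  have \<Phi>M: "?\<Phi> ` (ball 0 ?R' - {\<i>, - \<i>}) \<subseteq> compl"
  proof (rule image_subsetI)
    fix y assume "y \<in> ball 0 ?R' - {\<i>, - \<i>}"
    then have y: "y \<in> ball 0 ?R'" "y \<noteq> \<i>" "y \<noteq> - \<i>" by auto
    have "eqn l (?\<Phi> y) \<noteq> 0" if "l \<le> N" for l
    proof -
      consider "l = j" | "l = N" | "l < N" "l \<noteq> j" using \<open>l \<le> N\<close> by linarith
      then show ?thesis
      proof cases
        case 1
        have "h * (y - \<i>) \<noteq> 0" using h(1) y(2) by simp
        then show ?thesis unfolding 1 eqn_j vr using ba by (metis mult_eq_0_iff)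
      next
        case 2
        have "h * (y + \<i>) \<noteq> 0" using h(1) y(3) by (simp add: add_eq_0_iff2)
        then show ?thesis unfolding 2 eqn_N vr using ba notr2'[OF y(1)] by simp
      qed (use rest y in auto)
    qed
    then show "?\<Phi> y \<in> compl" by (simp add: compl_def)
  qed
  have gen_j: "generic j r1"
    unfolding generic_def others_def
  proof (intro conjI allI impI)
    fix l assume l: "l \<le> N" "l \<noteq> j"
    have "chart j r1 0 = ?\<Phi> \<i>" unfolding chart_j chart_i mh using par(7) by (simp add: algebra_simps)
    moreover have "eqn l (?\<Phi> \<i>) \<noteq> 0"
    proof (cases "l = N")
      case True
      show ?thesis unfolding True eqn_N mh using ba notr2'[OF \<i>R(1)] par(3) mh by simp
    qed (use rest \<i>R l in auto)
    ultimately show "eqn l (chart j r1 0) \<noteq> 0" by simp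
  qed (use dom j in auto)
  \<comment> \<open>\<open>z\<close> is the u-coordinate along the pushed-off edge. Where it is
    nonzero it serves as the conic parameter, so the crossing \<open>r2\<close> can be read in the
    chart of the conic.\<close>
  define z where "z y = a + b - a * b * (m + h * y) + k" for y
  have z\<Phi>: "?\<Phi> y = (z y, m + h * y)" for y by (simp add: chart_i z_def)
  have z0: "z (- \<i>) \<noteq> 0"
  proof -
    have "eqn N (?\<Phi> (- \<i>)) = 0" unfolding eqn_N mh by simp
    then show ?thesis unfolding z\<Phi> by (auto simp: eqn_def)
  qed
  have chart_N: "?\<Phi> y = chart N (z y) (eqn N (?\<Phi> y))" if "z y \<noteq> 0" for y
    using that unfolding z\<Phi> by (simp add: chart_def eqn_def)
  have gen_N: "generic N (z (- \<i>))"
    unfolding generic_def others_def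
  proof (intro conjI allI impI)
    show "chart_dom N (z (- \<i>))" using z0 by (simp add: chart_dom_def)
    fix l assume l: "l \<le> N" "l \<noteq> N"
    have "eqn N (?\<Phi> (- \<i>)) = 0" unfolding eqn_N mh by simp
    then have "chart N (z (- \<i>)) 0 = ?\<Phi> (- \<i>)" using chart_N[OF z0] by simp
    moreover have "eqn l (?\<Phi> (- \<i>)) \<noteq> 0"
    proof (cases "l = j")
      case True
      show ?thesis unfolding True eqn_j mh using ba par(3) by (metis mult_eq_0_iff right_minus_eq)
    next
      case False
      then show ?thesis using rest[OF \<i>R(2)] l by (metis le_neq_implies_less)
    qed
    ultimately show "eqn l (chart N (z (- \<i>)) 0) \<noteq> 0" by simp
  qed
  have loop: "g (?\<Phi> \<circ> circlepath 0 R) = mer g j + mer g N" if g: "loop_functional compl g" for g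
  proof -
    have "\<exists>e>0. \<forall>\<rho>. 0 < \<rho> \<longrightarrow> \<rho> < e \<longrightarrow> g (?\<Phi> \<circ> circlepath \<i> \<rho>) = mer g j"
    proof (rule transversal_circle[OF g, of j 1 \<i> "\<lambda>y. m + h * y" "\<lambda>y. b * (c - a) * h"])
      show "?\<Phi> y = chart j (m + h * y) ((y - \<i>) * (b * (c - a) * h))" for y
      proof -
        have "(y - \<i>) * (b * (c - a) * h) = b * (c - a) * (m + h * y) - b * (c - a) * r1"
          using vr(1)[of y] by (simp add: algebra_simps flip: mh(1))
        then show ?thesis unfolding par(7) chart_i chart_j by (simp add: algebra_simps)
      qed
      show "generic j (m + h * \<i>)" using gen_j by (simp add: mh)
    qed (use j ba h in \<open>auto intro!: continuous_intros\<close>)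
    then obtain e1 where e1: "e1 > 0" "\<And>\<rho>. 0 < \<rho> \<Longrightarrow> \<rho> < e1 \<Longrightarrow> g (?\<Phi> \<circ> circlepath \<i> \<rho>) = mer g j" by blast
    have zc: "continuous_on UNIV z" unfolding z_def by (intro continuous_intros)
    then have "open {y. z y \<noteq> 0}" by (intro open_Collect_neq) auto
    then obtain e0 where e0: "e0 > 0" "ball (- \<i>) e0 \<subseteq> {y. z y \<noteq> 0}"
      using z0 by (metis (mono_tags, lifting) mem_Collect_eq open_contains_ball)
    have "\<exists>e>0. \<forall>\<rho>. 0 < \<rho> \<longrightarrow> \<rho> < e \<longrightarrow> g (?\<Phi> \<circ> circlepath (- \<i>) \<rho>) = mer g N"
    proof (rule transversal_circle[OF g, of N e0 "- \<i>" z "\<lambda>y. - (a * b) * h * (m + h * y - r2')"])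
      show "?\<Phi> y = chart N (z y) ((y - (- \<i>)) * (- (a * b) * h * (m + h * y - r2')))" if "y \<in> ball (- \<i>) e0" for y
      proof -
        have "(y - (- \<i>)) * (- (a * b) * h * (m + h * y - r2')) = eqn N (?\<Phi> y)"
          unfolding eqn_N vr by (simp add: algebra_simps)
        then show ?thesis using chart_N[of y] that e0(2) by auto
      qed
      show "- (a * b) * h * (m + h * (- \<i>) - r2') \<noteq> 0"
        using ba h(1) notr2'[OF \<i>R(2)] by simp
      show "continuous_on (ball (- \<i>) e0) z" using zc continuous_on_subset by blast
    qed (use e0 gen_N in \<open>auto intro!: continuous_intros\<close>)
    then obtain e2 where e2: "e2 > 0" "\<And>\<rho>. 0 < \<rho> \<Longrightarrow> \<rho> < e2 \<Longrightarrow> g (?\<Phi> \<circ> circlepath (- \<i>) \<rho>) = mer g N" by blast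
    define \<rho> where "\<rho> = min (min (e1 / 2) (e2 / 2)) (1 / 2)"
    have \<rho>: "0 < \<rho>" "\<rho> < e1" "\<rho> < e2" "\<rho> < 1" using e1(1) e2(1) by (auto simp: \<rho>_def)
    have "g (?\<Phi> \<circ> circlepath 0 R) = g (?\<Phi> \<circ> circlepath \<i> \<rho>) + g (?\<Phi> \<circ> circlepath (- \<i>) \<rho>)"
      by (rule loop_functional_circlepath_split[OF g \<Phi>c \<Phi>M]) (use R(2) \<rho> in auto)
    then show ?thesis using e1(2) e2(2) \<rho> by simp
  qed
  have "mer f i * f' (\<lambda>s. chart i (m + h * circlepath 0 R s) k) = mer f' i * f (\<lambda>s. chart i (m + h * circlepath 0 R s) k)"
  proof (rule line_torus[OF pair, where \<zeta> = "\<lambda>s. m + h * circlepath 0 R s"])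
    show "continuous_on {0..1} (\<lambda>s. m + h * circlepath 0 R s)"
      using path_circlepath[of 0 R] by (auto simp: path_def intro!: continuous_intros)
    show "m + h * circlepath 0 R 0 = m + h * circlepath 0 R 1" by (simp add: circlepath)
    fix s :: real
    define v where "v = m + h * circlepath 0 R s"
    have "dist m v = norm h * R" using R(2) by (simp add: v_def circlepath dist_norm norm_mult)
    then have "dist m v = d" using R(1) by simp
    moreover have "dist (1 / b) m \<le> d / 2" using par(4) by (simp add: m_def)
    ultimately have "d / 2 \<le> dist (1 / b) v" "dist (1 / b) v \<le> 2 * d"
      using de(1) dist_triangle[of "1 / b" v m] dist_triangle3[of m v "1 / b"] by auto
    then show "admissible i (m + h * circlepath 0 R s) k"
      unfolding v_def[symmetric] using de(5) par(1,2) dom[OF i] by (auto simp: admissible_def)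
  qed (use i in simp)
  then show ?thesis using loop[OF cf(1)] loop[OF cf(2)] by (simp add: o_def)
qed

end

section \<open>Meridians of adjacent edges\<close>

text \<open>Cramer's rule: a vector parallel to two independent vectors of \<int>^2 is zero.\<close>

lemma int_proportional_zero:
  fixes a b p q :: int
  assumes "a0 * q = b0 * p" "a1 * q = b1 * p" "a0 * b1 \<noteq> b0 * a1"
  shows "p = 0" "q = 0"
proof -
  have "p * (a0 * b1 - b0 * a1) = a0 * (b1 * p) - a1 * (b0 * p)" by (simp add: algebra_simps)
  also have "\<dots> = 0" unfolding assms(1,2)[symmetric] by (simp add: algebra_simps)
  finally show "p = 0" using assms(3) by simp
  have "q * (a0 * b1 - b0 * a1) = b1 * (a0 * q) - b0 * (a1 * q)" by (simp add: algebra_simps)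
  also have "\<dots> = 0" unfolding assms(1,2) by (simp add: algebra_simps)
  finally show "q = 0" using assms(3) by simp
qed

text \<open>Write x_j = (a_j, b_j) and suppose x_0 and x_1 are independent. Then x_3 is parallel to
  both and vanishes, and so does x_N + x_0 + x_1. The vertex of edges 2 and 3 makes x_2 parallel to
  x_N, which together with x_2 parallel to x_0 gives x_2 = 0. The vertex of edges 1 and 2 then makes
  x_1 parallel to x_0 + x_1, a contradiction.\<close>

lemma cycle_proportional:
  fixes a0 a1 a2 a3 aN b0 b1 b2 b3 bN :: int
  assumes D02: "a0 * b2 = b0 * a2" and D03: "a0 * b3 = b0 * a3" and D13: "a1 * b3 = b1 * a3"
    and V01: "a0 * (b1 + bN) = b0 * (a1 + aN)" and V10: "a1 * (b0 + bN) = b1 * (a0 + aN)"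
    and V12: "a1 * (b2 + bN) = b1 * (a2 + aN)" and V23: "a2 * (b3 + bN) = b2 * (a3 + aN)"
  shows "a0 * b1 = b0 * a1"
proof (rule ccontr)
  assume ne: "a0 * b1 \<noteq> b0 * a1"
  have 3: "a3 = 0" "b3 = 0" using int_proportional_zero[OF D03 D13 ne] by auto
  have "a0 * (bN + b0 + b1) = b0 * (aN + a0 + a1)" "a1 * (bN + b0 + b1) = b1 * (aN + a0 + a1)"
    using V01 V10 by (simp_all add: algebra_simps)
  from int_proportional_zero[OF this ne] have N: "aN = - a0 - a1" "bN = - b0 - b1" by simp_all
  have "a1 * b2 = b1 * a2" using V23 D02 unfolding 3 N by (simp add: algebra_simps)
  from int_proportional_zero[OF D02 this ne] have "a2 = 0" "b2 = 0" by simp_all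
  then show False using V12 ne unfolding N by (simp add: algebra_simps)
qed

text \<open>Concurrency is excluded at all complex points, not only at the real points of the
  polygon's plane.\<close>

locale inscribed_general = inscribed +
  assumes no_triple: "\<lbrakk>i < N; j < N; l < N; i \<noteq> j; j \<noteq> l; i \<noteq> l\<rbrakk> \<Longrightarrow>
    \<not> (\<exists>q. fst q + t i * t (Suc i) * snd q = t i + t (Suc i) \<and> fst q + t j * t (Suc j) * snd q = t j + t (Suc j) \<and>
       fst q + t l * t (Suc l) * snd q = t l + t (Suc l))"
begin

lemma eqn_conic_point:
  assumes "l < N" "x \<noteq> 0"
  shows "eqn l (x, 1 / x) = (x - t l) * (x - t (Suc l)) / x"
  using assms by (simp add: eqn_def field_simps)

lemma t_eq_Suc: "\<lbrakk>i < N; l < N; t (Suc i) = t (Suc l)\<rbrakk> \<Longrightarrow> i = l"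
proof -
  assume il: "i < N" "l < N" "t (Suc i) = t (Suc l)"
  have "t (Suc i mod N) = t (Suc l mod N)" using il(3) by (simp add: periodic)
  then have "Suc i mod N = Suc l mod N" using N_ge by (intro t_inj) auto
  then show "i = l" using il(1,2) by (auto simp: mod_Suc split: if_splits)
qed

text \<open>The intersection point of the two edges is off the conic, since the conic meets an edge
  only in its end points and these are disjoint; \<open>no_triple\<close> excludes a third line. The
  bound on \<open>j\<close> keeps both edges clear of the index wrap-around.\<close>

lemma mer_nonadjacent:
  assumes pair: "isotropic_loop_pair compl c c'" and ij: "Suc i < j" "Suc j < N"
  shows "mer c i * mer c' j = mer c' i * mer c j"
proof -
  have lt: "i < N" "j < N" "Suc i < N" "i \<noteq> j" using ij by auto
  define D where "D = t j * t (Suc j) - t i * t (Suc i)"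
  have D: "D \<noteq> 0" using not_parallel[OF lt(2,1)] lt by (auto simp: D_def)
  define v0 where "v0 = - (t i + t (Suc i) - t j - t (Suc j)) / D"
  have ej: "eqn j (chart i v0 0) = 0"
    using line_on_line[OF lt(1,2), of v0 0] D by (simp add: v0_def flip: D_def)
  have ei: "eqn i (chart i v0 0) = 0" using eqn_chart[of i v0 0] lt by (simp add: chart_dom_def)
  show ?thesis
  proof (rule mer_double_point[OF pair lt(1,2,4) ej])
    fix l assume l: "l \<le> N" "l \<noteq> i" "l \<noteq> j"
    show "eqn l (chart i v0 0) \<noteq> 0"
    proof (cases "l = N")
      case False
      then have "l < N" using l by simp
      from no_triple[OF lt(1,2) this lt(4)] l have "\<not> (eqn i (chart i v0 0) = 0 \<and> eqn j (chart i v0 0) = 0 \<and> eqn l (chart i v0 0) = 0)"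
        using lt \<open>l < N\<close> by (auto simp: eqn_def)
      then show ?thesis using ei ej by simp
    next
      case True
      show ?thesis
      proof
        assume "eqn l (chart i v0 0) = 0"
        then have "v0 = 1 / t i \<or> v0 = 1 / t (Suc i)"
          using conic_on_line[OF lt(1), of v0 0] t_nonzero True by simp
        then have "\<exists>x. (x = t i \<or> x = t (Suc i)) \<and> chart i v0 0 = (x, 1 / x)"
          using t_nonzero[of i] t_nonzero[of "Suc i"] lt(1) by (auto simp: chart_def field_simps)
        then obtain x where x: "x = t i \<or> x = t (Suc i)" "chart i v0 0 = (x, 1 / x)" by blast
        have "x \<noteq> 0" using x(1) t_nonzero by auto
        then have "x = t j \<or> x = t (Suc j)" using ej eqn_conic_point[OF lt(2)] x(2) by simp
        then show False using x(1) t_inj[of i j] t_inj[of "Suc i" j] t_inj[of i "Suc j"] t_inj[of "Suc i" "Suc j"] ij lt by auto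
      qed
    qed
  qed
qed

text \<open>Both relations come from the same vertex: the torus is built around one edge or, after
  exchanging the outer end points, around the other.\<close>

lemma mer_adjacent:
  assumes pair: "isotropic_loop_pair compl c c'" and i: "Suc (Suc i) < N"
  shows "mer c i * (mer c' (Suc i) + mer c' N) = mer c' i * (mer c (Suc i) + mer c N)"
    "mer c (Suc i) * (mer c' i + mer c' N) = mer c' (Suc i) * (mer c i + mer c N)"
proof -
  let ?a = "t i" and ?b = "t (Suc i)" and ?c = "t (Suc (Suc i))"
  have lt: "i < N" "Suc i < N" using i by auto
  have ne: "?a \<noteq> ?b" "?b \<noteq> ?c" "?a \<noteq> ?c"
    using t_inj[of i "Suc i"] t_inj[of "Suc i" "Suc (Suc i)"] t_inj[of i "Suc (Suc i)"] i by auto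
  have other: "eqn l (?b, 1 / ?b) \<noteq> 0" if l: "l < N" "l \<noteq> i" "l \<noteq> Suc i" for l
    using eqn_conic_point[OF l(1) t_nonzero] t_inj[OF l(1) lt(2)] t_eq_Suc[OF l(1) lt(1)] l t_nonzero[of "Suc i"] by auto
  show "mer c i * (mer c' (Suc i) + mer c' N) = mer c' i * (mer c (Suc i) + mer c N)"
    by (rule mer_vertex[OF pair lt, of ?a ?b ?c]) (use ne t_nonzero other in auto)
  show "mer c (Suc i) * (mer c' i + mer c' N) = mer c' (Suc i) * (mer c i + mer c N)"
    by (rule mer_vertex[OF pair lt(2,1), of ?c ?b ?a]) (use ne t_nonzero other in \<open>auto simp: mult.commute add.commute\<close>)
qed

lemma mer_first_two:
  assumes pair: "isotropic_loop_pair compl c c'"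
  shows "mer c 0 * mer c' 1 = mer c' 0 * mer c 1"
proof (rule cycle_proportional)
  show "mer c 0 * mer c' 2 = mer c' 0 * mer c 2" "mer c 0 * mer c' 3 = mer c' 0 * mer c 3"
    "mer c 1 * mer c' 3 = mer c' 1 * mer c 3"
    using N_ge by (auto intro!: mer_nonadjacent[OF pair])
  show "mer c 0 * (mer c' 1 + mer c' N) = mer c' 0 * (mer c 1 + mer c N)"
    "mer c 1 * (mer c' 0 + mer c' N) = mer c' 1 * (mer c 0 + mer c N)"
    using mer_adjacent[OF pair, of 0] N_ge by simp_all
  show "mer c 1 * (mer c' 2 + mer c' N) = mer c' 1 * (mer c 2 + mer c N)"
    using mer_adjacent(1)[OF pair, of 1] N_ge by (simp add: numeral_2_eq_2)
  show "mer c 2 * (mer c' 3 + mer c' N) = mer c' 2 * (mer c 3 + mer c N)"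
    using mer_adjacent(1)[OF pair, of 2] N_ge by (simp add: numeral_3_eq_3 numeral_2_eq_2)
qed

text \<open>The complex line through two points of the complement meets each curve in the zeros of a
  polynomial that is nonzero at the parameter of the first point. Removing finitely many points from
  the plane leaves it path connected.\<close>

lemma path_connected_compl: "path_connected compl"
  unfolding path_connected_def
proof (intro ballI)
  fix p q assume p: "p \<in> compl" and q: "q \<in> compl"
  define L where "L z = (fst p + z * (fst q - fst p), snd p + z * (snd q - snd p))" for z
  have fin: "finite {z. eqn j (L z) = 0}" if j: "j \<le> N" for j
  proof -
    obtain A B C where ABC: "\<And>z. eqn j (L z) = poly [:A, B, C:] z"
    proof (cases "j < N")
      case True
      then show ?thesis
        by (intro that[of "fst p + t j * t (Suc j) * snd p - (t j + t (Suc j))" "(fst q - fst p) + t j * t (Suc j) * (snd q - snd p)" 0])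
           (simp add: eqn_def L_def algebra_simps)
    next
      case False
      then show ?thesis
        by (intro that[of "fst p * snd p - 1" "fst p * (snd q - snd p) + snd p * (fst q - fst p)" "(fst q - fst p) * (snd q - snd p)"])
           (simp add: eqn_def L_def algebra_simps)
    qed
    have "poly [:A, B, C:] 0 \<noteq> 0" using p j unfolding ABC[symmetric] by (simp add: L_def compl_def)
    then have "[:A, B, C:] \<noteq> 0" by auto
    then show ?thesis unfolding ABC by (rule poly_roots_finite)
  qed
  define F where "F = (\<Union>j\<le>N. {z. eqn j (L z) = 0})"
  have "finite F" unfolding F_def using fin by auto
  then have "connected (UNIV - F)" by (intro connected_open_delete_finite) auto
  moreover have "open (UNIV - F)" using \<open>finite F\<close> by (simp add: finite_imp_closed open_Diff)
  ultimately have "path_connected (UNIV - F)" using connected_open_path_connected by blast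
  moreover have "continuous_on (UNIV - F) L" unfolding L_def by (intro continuous_intros)
  ultimately have "path_connected (L ` (UNIV - F))" using path_connected_continuous_image by blast
  moreover have "L ` (UNIV - F) \<subseteq> compl" by (auto simp: F_def compl_def)
  moreover have "p = L 0" "q = L 1" "0 \<in> UNIV - F" "1 \<in> UNIV - F"
    using p q by (auto simp: L_def F_def compl_def)
  ultimately show "\<exists>g. path g \<and> path_image g \<subseteq> compl \<and> pathstart g = p \<and> pathfinish g = q"
    unfolding path_connected_def by (meson imageI subset_trans)
qed

text \<open>The curve's own equation runs once around 0 along the meridian, so its logarithm grows
  by 2 pi \<open>\<i>\<close>. Every other equation has no zero on the disc bounded by the meridian
  and thus has a logarithm there, which returns to its value.\<close>

lemma holonomy_meridian:
  assumes i: "i \<le> N" and adm: "admissible i z k" and j: "j \<le> N"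
  shows "fst (holonomy (meridian i z k)) j = (if j = i then 2 * of_real pi * \<i> else 0)"
proof -
  have m: "path (meridian i z k)" "path_image (meridian i z k) \<subseteq> compl"
    using meridian_loop[OF i adm] by (auto simp: loop_in_def)
  have k: "k \<noteq> 0" "chart_dom i z" using adm by (auto simp: admissible_def)
  show ?thesis
  proof (cases "j = i")
    case True
    have "fst (holonomy (meridian i z k)) j = (Ln k + 2 * of_real pi * \<i> * of_real 1) - (Ln k + 2 * of_real pi * \<i> * of_real 0)"
      by (rule holonomy_log[OF m j]) (use k i True in \<open>auto intro!: continuous_intros simp: meridian_def eqn_chart exp_add\<close>)
    then show ?thesis using True by simp
  next
    case False
    let ?D = "cball 0 (norm k)"
    have "continuous_on ?D (\<lambda>w. eqn j (chart i z w))"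
      by (intro continuous_intros continuous_on_chart) (use k in auto)
    moreover have "eqn j (chart i z w) \<noteq> 0" if "w \<in> ?D" for w
      using adm that j False by (auto simp: admissible_def others_def)
    ultimately obtain g where g: "continuous_on ?D g" "\<And>w. w \<in> ?D \<Longrightarrow> eqn j (chart i z w) = exp (g w)"
      using continuous_logarithm_on_cball[of 0 "norm k" "\<lambda>w. eqn j (chart i z w)"] by blast
    let ?E = "\<lambda>s. k * exp (2 * complex_of_real pi * \<i> * of_real s)"
    have E: "?E s \<in> ?D" for s by (simp add: norm_mult)
    have "fst (holonomy (meridian i z k)) j = g (?E 1) - g (?E 0)"
    proof (rule holonomy_log[OF m j])
      show "continuous_on {0..1} (\<lambda>s. g (?E s))"
        by (rule continuous_on_compose2[OF g(1)]) (use E in \<open>auto intro!: continuous_intros\<close>)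
      show "exp (g (?E s)) = eqn j (meridian i z k s)" for s
        using g(2)[OF E] by (simp add: meridian_def)
    qed
    then show ?thesis using False by simp
  qed
qed

lemma fst_holonomy_join:
  assumes "path f" "path_image f \<subseteq> compl" "path g" "path_image g \<subseteq> compl" "pathfinish f = pathstart g"
  shows "fst (holonomy (f +++ g)) j = fst (holonomy f) j + fst (holonomy g) j"
  unfolding holonomy_join[OF assms] by (rule fst_heis_mult)

text \<open>The first components of the holonomy add under concatenation, so the contributions of
  the tail and its reverse cancel.\<close>

lemma fst_holonomy_conjugate:
  assumes u: "path u" "path_image u \<subseteq> compl" and f: "loop_in compl f" and uf: "pathfinish u = pathstart f"
  shows "fst (holonomy (u +++ f +++ reversepath u)) j = fst (holonomy f) j"
proof -
  have f': "path f" "path_image f \<subseteq> compl" "pathfinish f = pathstart f" using f by (auto simp: loop_in_def)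
  let ?c = "linepath (pathstart u) (pathstart u)"
  have c: "path ?c" "path_image ?c \<subseteq> compl" using u pathstart_in_path_image by auto
  have "holonomy (?c +++ ?c) = holonomy ?c"
    by (rule holonomy_homotopic[OF homotopic_paths_lid']) (use c in auto)
  then have 0: "fst (holonomy ?c) j = 0" using fst_holonomy_join[OF c c, of j] by simp
  have "holonomy (u +++ reversepath u) = holonomy ?c"
    by (rule holonomy_homotopic[OF homotopic_paths_rinv]) (use u in auto)
  then have "fst (holonomy u) j + fst (holonomy (reversepath u)) j = 0"
    using fst_holonomy_join[of u "reversepath u" j] u 0 by simp
  moreover have "fst (holonomy (u +++ f +++ reversepath u)) j = fst (holonomy u) j + (fst (holonomy f) j + fst (holonomy (reversepath u)) j)"
    using u f' uf by (simp add: fst_holonomy_join path_image_join)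
  ultimately show ?thesis by (simp add: algebra_simps add_eq_0_iff)
qed

lemma not_free_abelian_sum_free:
  assumes p: "p \<in> compl"
  shows "\<not> fundamental_group compl p \<cong> free_abelian_sum_free r v m"
proof
  interpret B: based_space compl p by unfold_locales (rule path_connected_compl p)+
  assume iso: "fundamental_group compl p \<cong> free_abelian_sum_free r v m"
  obtain z0 k0 where a0: "admissible 0 z0 k0" using admissible_exists[of 0] by auto
  obtain z1 k1 where a1: "admissible 1 z1 k1" using admissible_exists[of 1] N_ge by auto
  have le: "0 \<le> N" "1 \<le> N" using N_ge by auto
  define X where "X = based_class compl p (meridian 0 z0 k0)"
  define Y where "Y = based_class compl p (meridian 1 z1 k1)"
  note l0 = meridian_loop[OF le(1) a0] and l1 = meridian_loop[OF le(2) a1]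
  have zero: "loop_form X Y = 0"
  proof (rule isotropic_form_iso_free_abelian_sum_free[OF group_fundamental_group[OF p] iso isotropic_loop_form])
    show "X \<in> carrier (fundamental_group compl p)" "Y \<in> carrier (fundamental_group compl p)"
      unfolding X_def Y_def by (rule B.based_class_closed[OF l0] B.based_class_closed[OF l1])+
    fix \<xi> \<xi>' assume "isotropic_pair (fundamental_group compl p) \<xi> \<xi>'"
    note pair = B.isotropic_pair_loops[OF this]
    note cf = loop_functional_isotropic[OF pair]
    show "\<xi> X * \<xi>' Y = \<xi>' X * \<xi> Y"
      using mer_first_two[OF pair] mer_eq[OF cf(1) le(1) a0] mer_eq[OF cf(2) le(1) a0]
        mer_eq[OF cf(1) le(2) a1] mer_eq[OF cf(2) le(2) a1]
      by (simp add: X_def Y_def)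
  qed
  have hol: "fst (class_holonomy (based_class compl p f)) j = fst (holonomy f) j" if f: "loop_in compl f" for f j
  proof -
    note u = B.tail[OF B.loop_in_start[OF f]]
    have "class_holonomy (based_class compl p f) = holonomy (tail compl p (pathstart f) +++ f +++ reversepath (tail compl p (pathstart f)))"
      unfolding based_class_def conj_class_def
      by (rule class_holonomy_eq[OF B.conj_loop[OF u(1-3) f u(4)]])
    then show ?thesis using fst_holonomy_conjugate[OF u(1,2) f u(4)] by simp
  qed
  define \<zeta> where "\<zeta> = 2 * of_real pi * \<i>"
  have X: "fst (class_holonomy X) j = (if j = 0 then \<zeta> else 0)" if "j \<le> N" for j
    unfolding X_def hol[OF l0] holonomy_meridian[OF le(1) a0 that] \<zeta>_def ..
  have Y: "fst (class_holonomy Y) j = (if j = 1 then \<zeta> else 0)" if "j \<le> N" for j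
    unfolding Y_def hol[OF l1] holonomy_meridian[OF le(2) a1 that] \<zeta>_def ..
  have idx: "Suc j mod N \<le> N" for j using N_ge by (auto intro: less_imp_le)
  \<comment> \<open>Up to index \<open>N\<close> the holonomy of \<open>X\<close> lives in
    coordinate 0 and that of \<open>Y\<close> in coordinate 1, so only the summand
    \<open>i = 0\<close> survives. In the exchanged order only \<open>i = 1\<close> could
    contribute, but \<open>X\<close> vanishes at 2 and at \<open>N\<close>.\<close>
  have "heis_form N (fst (class_holonomy X)) (fst (class_holonomy Y)) = (\<Sum>i<N. if i = 0 then \<zeta> * \<zeta> else 0)"
    unfolding heis_form_def using N_ge by (intro sum.cong) (auto simp: X Y idx)
  also have "\<dots> = \<zeta> * \<zeta>" using N_ge by simp
  finally have 1: "heis_form N (fst (class_holonomy X)) (fst (class_holonomy Y)) = \<zeta> * \<zeta>" .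
  have "heis_form N (fst (class_holonomy Y)) (fst (class_holonomy X)) = (\<Sum>i<N. 0)"
    unfolding heis_form_def using N_ge by (intro sum.cong) (auto simp: X Y idx)
  then have "loop_form X Y = \<zeta> * \<zeta>" using 1 by (simp add: loop_form_def)
  then show False using zero by (simp add: \<zeta>_def)
qed

end

section \<open>The real polygon\<close>

lemma fundamental_group_homeomorphic:
  fixes T :: "'a::real_normed_vector \<Rightarrow> 'b::real_normed_vector"
  assumes T: "continuous_on S T" and T': "continuous_on (T ` S) T'" and inv: "\<And>x. x \<in> S \<Longrightarrow> T' (T x) = x"
    and p: "p \<in> S"
  shows "fundamental_group S p \<cong> fundamental_group (T ` S) (T p)"
proof -
  define h where "h X = {g. \<exists>f\<in>X. homotopic_paths (T ` S) (T \<circ> f) g}" for X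
  have loop: "T \<circ> f \<in> loops_at (T ` S) (T p)" if "f \<in> loops_at S p" for f
    using that T
    by (auto simp: loops_at_def path_image_compose pathstart_compose pathfinish_compose
        intro!: path_continuous_image intro: continuous_on_subset)
  have hom: "homotopic_paths (T ` S) (T \<circ> f) (T \<circ> g)" if "homotopic_paths S f g" for f g
    by (rule homotopic_paths_continuous_image[OF that T]) auto
  have h_class: "h (Collect (homotopic_paths S f)) = Collect (homotopic_paths (T ` S) (T \<circ> f))"
    if f: "f \<in> loops_at S p" for f
  proof -
    have "homotopic_paths S f f" using f by (auto simp: loops_at_def)
    then show ?thesis using hom homotopic_paths_trans unfolding h_def by blast
  qed
  have hom': "homotopic_paths S f g" if fg: "f \<in> loops_at S p" "g \<in> loops_at S p"
    and "homotopic_paths (T ` S) (T \<circ> f) (T \<circ> g)" for f g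
  proof -
    have "homotopic_paths S (T' \<circ> (T \<circ> f)) (T' \<circ> (T \<circ> g))"
      by (rule homotopic_paths_continuous_image[OF that(3) T']) (use inv in auto)
    moreover have "homotopic_paths S f (T' \<circ> (T \<circ> f))" if "f \<in> loops_at S p" for f
    proof (rule homotopic_paths_eq)
      show "path f" "path_image f \<subseteq> S" using that by (auto simp: loops_at_def)
      then have "f t \<in> S" if "t \<in> {0..1}" for t using that by (auto simp: path_image_def)
      then show "f t = (T' \<circ> (T \<circ> f)) t" if "t \<in> {0..1}" for t using that inv by simp
    qed
    ultimately show ?thesis using fg homotopic_paths_trans homotopic_paths_sym by metis
  qed
  have "h \<in> iso (fundamental_group S p) (fundamental_group (T ` S) (T p))"
    unfolding iso_def
  proof (intro CollectI conjI homI)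
    show "h X \<in> carrier (fundamental_group (T ` S) (T p))" if "X \<in> carrier (fundamental_group S p)" for X
      using that h_class loop by (auto simp: carrier_fundamental_group)
    show "h (X \<otimes>\<^bsub>fundamental_group S p\<^esub> Y) = h X \<otimes>\<^bsub>fundamental_group (T ` S) (T p)\<^esub> h Y"
      if X: "X \<in> carrier (fundamental_group S p)" and Y: "Y \<in> carrier (fundamental_group S p)" for X Y
    proof -
      obtain f where f: "f \<in> loops_at S p" "X = Collect (homotopic_paths S f)"
        using X by (auto simp: carrier_fundamental_group)
      obtain g where g: "g \<in> loops_at S p" "Y = Collect (homotopic_paths S g)"
        using Y by (auto simp: carrier_fundamental_group)
      have fg: "f +++ g \<in> loops_at S p" using f g by (auto simp: loops_at_def path_image_join)
      show ?thesis
        unfolding f(2) g(2) homotopy_class_mult[OF f(1) g(1)] h_class[OF f(1)] h_class[OF g(1)] h_class[OF fg]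
          homotopy_class_mult[OF loop[OF f(1)] loop[OF g(1)]] compose_joinpaths ..
    qed
    show "bij_betw h (carrier (fundamental_group S p)) (carrier (fundamental_group (T ` S) (T p)))"
      unfolding bij_betw_def
    proof
      show "inj_on h (carrier (fundamental_group S p))"
      proof (rule inj_onI)
        fix X Y assume X: "X \<in> carrier (fundamental_group S p)" and Y: "Y \<in> carrier (fundamental_group S p)"
          and eq: "h X = h Y"
        obtain f where f: "f \<in> loops_at S p" "X = Collect (homotopic_paths S f)"
          using X by (auto simp: carrier_fundamental_group)
        obtain g where g: "g \<in> loops_at S p" "Y = Collect (homotopic_paths S g)"
          using Y by (auto simp: carrier_fundamental_group)
        have "T \<circ> g \<in> Collect (homotopic_paths (T ` S) (T \<circ> g))"
          using loop[OF g(1)] by (auto simp: loops_at_def)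
        moreover have "Collect (homotopic_paths (T ` S) (T \<circ> f)) = Collect (homotopic_paths (T ` S) (T \<circ> g))"
          using eq unfolding f(2) g(2) h_class[OF f(1)] h_class[OF g(1)] .
        ultimately have "homotopic_paths (T ` S) (T \<circ> f) (T \<circ> g)" by blast
        then show "X = Y" unfolding f(2) g(2)
          by (intro Collect_homotopic_paths_eq hom'[OF f(1) g(1)])
      qed
      show "h ` carrier (fundamental_group S p) = carrier (fundamental_group (T ` S) (T p))"
      proof
        show "h ` carrier (fundamental_group S p) \<subseteq> carrier (fundamental_group (T ` S) (T p))"
          using h_class loop by (auto simp: carrier_fundamental_group)
        show "carrier (fundamental_group (T ` S) (T p)) \<subseteq> h ` carrier (fundamental_group S p)"
        proof
          fix Y assume "Y \<in> carrier (fundamental_group (T ` S) (T p))"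
          then obtain g where g: "g \<in> loops_at (T ` S) (T p)" "Y = Collect (homotopic_paths (T ` S) g)"
            by (auto simp: carrier_fundamental_group)
          have gp: "path g" "path_image g \<subseteq> T ` S" "pathstart g = T p" "pathfinish g = T p"
            using g by (auto simp: loops_at_def)
          define f where "f = T' \<circ> g"
          have Tinv: "T (T' y) = y" if "y \<in> T ` S" for y using that inv by auto
          show "Y \<in> h ` carrier (fundamental_group S p)"
          proof -
            have f: "f \<in> loops_at S p"
              using gp inv p T'
              by (auto simp: f_def loops_at_def path_image_compose pathstart_compose pathfinish_compose
                  intro!: path_continuous_image intro: continuous_on_subset)
            have "homotopic_paths (T ` S) g (T \<circ> f)"
            proof (rule homotopic_paths_eq)
              have "g t \<in> T ` S" if "t \<in> {0..1}" for t using that gp(2) by (auto simp: path_image_def)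
              then show "g t = (T \<circ> f) t" if "t \<in> {0..1}" for t using that Tinv by (simp add: f_def)
            qed (use gp in auto)
            then have "Y = h (Collect (homotopic_paths S f))"
              unfolding g(2) h_class[OF f] by (rule Collect_homotopic_paths_eq)
            then show ?thesis using f by (auto simp: carrier_fundamental_group)
          qed
        qed
      qed
    qed
  qed
  then show ?thesis by (auto simp: is_iso_def)
qed

text \<open>In the coordinates u and v the collinearity determinant is multiplied by -2
  \<open>\<i>\<close>. Multiplying it by a b clears the inverses of the unit numbers a and b and
  exposes the nonzero factor a - b. Since X and Y are complex, v is not the conjugate of u, and only
  a and b may be conjugated.\<close>

lemma line_through_unit_circle:
  assumes a: "norm a = 1" and b: "norm b = 1" and ab: "a \<noteq> b"
  shows "(X, Y) \<in> line_through (complex_point (Re a, Im a)) (complex_point (Re b, Im b)) \<longleftrightarrow>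
    (X + \<i> * Y) + a * b * (X - \<i> * Y) = a + b"
proof -
  define A1 A2 B1 B2 where d: "A1 = complex_of_real (Re a)" "A2 = complex_of_real (Im a)"
    "B1 = complex_of_real (Re b)" "B2 = complex_of_real (Im b)"
  have aA: "a = A1 + \<i> * A2" and bB: "b = B1 + \<i> * B2" by (simp_all add: d complex_eq_iff)
  have "a * cnj a = 1" "b * cnj b = 1" using a b by (simp_all add: complex_norm_square[symmetric])
  moreover have "cnj a = A1 - \<i> * A2" "cnj b = B1 - \<i> * B2" by (simp_all add: d complex_eq_iff)
  ultimately have 1: "a * (A1 - \<i> * A2) = 1" "b * (B1 - \<i> * B2) = 1" by simp_all
  define E where "E = (X - A1) * (B2 - A2) - (Y - A2) * (B1 - A1)"
  define u v where "u = X + \<i> * Y" and "v = X - \<i> * Y"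
  define a' b' where "a' = A1 - \<i> * A2" and "b' = B1 - \<i> * B2"
  have aa: "a * a' = 1" "b * b' = 1" using 1 by (simp_all add: a'_def b'_def)
  have "(u - a) * (b' - a') - (v - a') * (b - a) = - (2 * \<i>) * E"
    unfolding u_def v_def a'_def b'_def aA bB E_def by (simp add: algebra_simps)
  then have "a * b * (- (2 * \<i>) * E) = a * b * ((u - a) * (b' - a') - (v - a') * (b - a))" by simp
  also have "\<dots> = (u - a) * (a * (b * b') - b * (a * a')) - (a * b * v - b * (a * a')) * (b - a)"
    by (simp add: algebra_simps)
  also have "\<dots> = (a - b) * (u + a * b * v - (a + b))"
    unfolding aa by (simp add: algebra_simps)
  finally have key: "a * b * (- (2 * \<i>) * E) = (a - b) * (u + a * b * v - (a + b))" .
  have "a \<noteq> 0" "b \<noteq> 0" using a b by auto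
  then have "E = 0 \<longleftrightarrow> u + a * b * v = a + b" using key ab by auto
  then show ?thesis by (simp add: line_through_def complex_point_def E_def u_def v_def flip: d)
qed

lemma line_through_of_real:
  "(x, y) \<in> line_through p q \<longleftrightarrow> complex_point (x, y) \<in> line_through (complex_point p) (complex_point q)"
proof -
  have "(x - fst p) * (snd q - snd p) = (y - snd p) * (fst q - fst p) \<longleftrightarrow>
    complex_of_real ((x - fst p) * (snd q - snd p)) = complex_of_real ((y - snd p) * (fst q - fst p))"
    by (simp only: of_real_eq_iff)
  then show ?thesis by (simp add: line_through_def complex_point_def)
qed

lemma increasing_less:
  fixes g :: "nat \<Rightarrow> real"
  assumes "\<forall>i\<in>{1..<k}. g i < g (i + 1)" "1 \<le> i" "i < j" "j \<le> k"
  shows "g i < g j"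
  using assms(3,4)
proof (induction j)
  case (Suc j)
  have step: "g j < g (Suc j)" if "1 \<le> j" using assms(1) Suc.prems that by auto
  show ?case
  proof (cases "i = j")
    case False
    then have "g i < g j" using Suc by auto
    also have "\<dots> < g (Suc j)" using step False Suc.prems assms(2) by auto
    finally show ?thesis .
  qed (use step assms(2) in auto)
qed simp

section \<open>Passage from the real polygon to the complex coordinates\<close>

locale polygon =
  fixes k :: nat and v v' :: "nat \<Rightarrow> real \<times> real" and s1 s2 :: real
  assumes k: "k \<ge> 3" and inscribed_polygon: "inscribed_polygon k v v' s1 s2"
begin

text \<open>The vertex (x, y) becomes t = x + \<open>\<i>\<close> y. As it lies on the unit circle,
  x - \<open>\<i>\<close> y = 1/t, so in the coordinates u and v it is the point (t, 1/t).\<close>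

definition unit_vertex :: "nat \<Rightarrow> complex" where
  "unit_vertex j = Complex (fst (vertex k v v' j)) (snd (vertex k v v' j))"

text \<open>Not a real slope, but the coefficient of v in the edge equation: a unit complex number
  that encodes the direction of the edge.\<close>

abbreviation "slope j \<equiv> unit_vertex j * unit_vertex (Suc j)"

lemma vertex_unit: "vertex k v v' j = (Re (unit_vertex j), Im (unit_vertex j))"
  by (simp add: unit_vertex_def)

lemma vertex_cases:
  assumes "j < 2 * k"
  obtains i where "i \<in> {1..k}" "j = i - 1" "vertex k v v' j = v i"
  | i where "i \<in> {1..k}" "j = 2 * k - i" "vertex k v v' j = v' i"
proof (cases "j < k")
  case True
  then show ?thesis using that(1)[of "j + 1"] assms by (simp add: vertex_def)
next
  case False
  then have "2 * k - j \<in> {1..k}" "j = 2 * k - (2 * k - j)" "vertex k v v' j = v' (2 * k - j)"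
    using assms by (auto simp: vertex_def)
  then show ?thesis by (rule that(2))
qed

lemma upper_lower:
  assumes "i \<in> {1..k}"
  shows "v i \<in> conic" "snd (v i) > 0" "v' i \<in> conic" "snd (v' i) < 0"
  using inscribed_polygon assms unfolding inscribed_polygon_def by auto

lemma injective:
  assumes "i \<in> {1..k}" "j \<in> {1..k}"
  shows "v i = v j \<Longrightarrow> i = j" "v' i = v' j \<Longrightarrow> i = j"
proof -
  have inc: "\<forall>i\<in>{1..<k}. fst (v i) < fst (v (i + 1))" "\<forall>i\<in>{1..<k}. fst (v' i) < fst (v' (i + 1))"
    using inscribed_polygon unfolding inscribed_polygon_def by auto
  show "v i = v j \<Longrightarrow> i = j"
    using increasing_less[OF inc(1), of i j] increasing_less[OF inc(1), of j i] assms by (cases i j rule: linorder_cases) auto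
  show "v' i = v' j \<Longrightarrow> i = j"
    using increasing_less[OF inc(2), of i j] increasing_less[OF inc(2), of j i] assms by (cases i j rule: linorder_cases) auto
qed

lemma periodic: "unit_vertex (j mod (2 * k)) = unit_vertex j"
  by (simp add: unit_vertex_def vertex_def)

lemma norm_unit_vertex [simp]: "norm (unit_vertex j) = 1"
proof -
  have "j mod (2 * k) < 2 * k" using k by simp
  then have "vertex k v v' (j mod (2 * k)) \<in> conic"
    by (rule vertex_cases) (use upper_lower in auto)
  then have "(fst (vertex k v v' j))\<^sup>2 + (snd (vertex k v v' j))\<^sup>2 = 1"
    by (auto simp: conic_def vertex_def split: prod.splits)
  then show ?thesis by (simp add: unit_vertex_def cmod_def)
qed

lemma unit_vertex_inj:
  assumes ij: "i < 2 * k" "j < 2 * k" and eq: "unit_vertex i = unit_vertex j"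
  shows "i = j"
proof -
  have e: "vertex k v v' i = vertex k v v' j" using eq by (simp add: vertex_unit)
  from ij(1) show ?thesis
  proof (cases rule: vertex_cases)
    case (1 a)
    note A = this
    from ij(2) show ?thesis
    proof (cases rule: vertex_cases)
      case (1 b)
      then show ?thesis using A e injective(1)[of a b] by simp
    next
      case (2 b)
      then show ?thesis using A e upper_lower(2)[of a] upper_lower(4)[of b] by simp
    qed
  next
    case (2 a)
    note A = this
    from ij(2) show ?thesis
    proof (cases rule: vertex_cases)
      case (1 b)
      then show ?thesis using A e upper_lower(4)[of a] upper_lower(2)[of b] by simp
    next
      case (2 b)
      then show ?thesis using A e injective(2)[of a b] by simp
    qed
  qed
qed

lemma unit_vertex_Suc: "unit_vertex j \<noteq> unit_vertex (Suc j)"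
proof
  assume "unit_vertex j = unit_vertex (Suc j)"
  then have "unit_vertex (j mod (2 * k)) = unit_vertex (Suc j mod (2 * k))" by (simp only: periodic)
  then have "j mod (2 * k) = Suc j mod (2 * k)" using k by (intro unit_vertex_inj) auto
  then show False using k by (auto simp: mod_Suc split: if_splits)
qed

lemma complex_edge_line_iff:
  "(X, Y) \<in> complex_edge_line k v v' j \<longleftrightarrow>
    (X + \<i> * Y) + slope j * (X - \<i> * Y) = unit_vertex j + unit_vertex (Suc j)"
  unfolding complex_edge_line_def vertex_unit Suc_eq_plus1[symmetric]
  by (rule line_through_unit_circle) (simp_all add: unit_vertex_Suc)

lemma edge_line_iff:
  "(Re z, Im z) \<in> edge_line k v v' j \<longleftrightarrow> z + slope j * cnj z = unit_vertex j + unit_vertex (Suc j)"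
proof -
  have "(Re z, Im z) \<in> edge_line k v v' j \<longleftrightarrow> (of_real (Re z), of_real (Im z)) \<in> complex_edge_line k v v' j"
    unfolding edge_line_def complex_edge_line_def by (subst line_through_of_real) (simp add: complex_point_def)
  moreover have "of_real (Re z) + \<i> * of_real (Im z) = z" "of_real (Re z) - \<i> * of_real (Im z) = cnj z"
    by (simp_all add: complex_eq_iff)
  ultimately show ?thesis by (simp add: complex_edge_line_iff)
qed

lemma cnj_sum: "slope j * cnj (unit_vertex j + unit_vertex (Suc j)) = unit_vertex j + unit_vertex (Suc j)"
proof -
  have c: "unit_vertex i * cnj (unit_vertex i) = 1" for i
    by (simp add: complex_norm_square[symmetric])
  have "slope j * cnj (unit_vertex j + unit_vertex (Suc j)) =
      (unit_vertex j * cnj (unit_vertex j)) * unit_vertex (Suc j) + unit_vertex j * (unit_vertex (Suc j) * cnj (unit_vertex (Suc j)))"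
    by (simp add: algebra_simps)
  then show ?thesis by (simp add: c)
qed

text \<open>Equal coefficients would make the two real lines translates of one another, which
  general position forbids.\<close>

lemma slope_inj:
  assumes ij: "i < 2 * k" "j < 2 * k" and eq: "slope i = slope j"
  shows "i = j"
proof (rule ccontr)
  assume ne: "i \<noteq> j"
  \<comment> \<open>By \<open>cnj_sum\<close> both constant terms are fixed by z \<mapsto> slope *
    cnj z, so half of their difference is a translation vector that carries one line to the
    other.\<close>
  define si sj a where "si = unit_vertex i + unit_vertex (Suc i)" and "sj = unit_vertex j + unit_vertex (Suc j)"
    and "a = (sj - si) / 2"
  have "slope i * cnj si = si" "slope i * cnj sj = sj"
    using cnj_sum[of i] cnj_sum[of j] eq by (simp_all add: si_def sj_def)
  then have a: "a + slope i * cnj a = sj - si"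
    by (simp add: a_def right_diff_distrib diff_divide_distrib[symmetric])
  have shift: "z + slope i * cnj z = si \<longleftrightarrow> (a + z) + slope i * cnj (a + z) = sj" for z
  proof -
    have "(a + z) + slope i * cnj (a + z) = (a + slope i * cnj a) + (z + slope i * cnj z)"
      by (simp add: algebra_simps)
    then have "(a + z) + slope i * cnj (a + z) = (sj - si) + (z + slope i * cnj z)" unfolding a .
    moreover have "x = si \<longleftrightarrow> (sj - si) + x = sj" for x by (auto simp: algebra_simps)
    ultimately show ?thesis by metis
  qed
  have "edge_line k v v' j = (+) (Re a, Im a) ` edge_line k v v' i"
  proof (intro subset_antisym subsetI)
    fix w assume w: "w \<in> edge_line k v v' j"
    define z where "z = Complex (fst w) (snd w) - a"
    have "(a + z) + slope j * cnj (a + z) = sj"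
      using w edge_line_iff[of "a + z" j] by (simp add: z_def sj_def)
    then have "z + slope i * cnj z = si" using shift[of z] eq by simp
    then have "(Re z, Im z) \<in> edge_line k v v' i" unfolding edge_line_iff si_def .
    moreover have "w = (Re a, Im a) + (Re z, Im z)" by (simp add: z_def prod_eq_iff)
    ultimately show "w \<in> (+) (Re a, Im a) ` edge_line k v v' i" by blast
  next
    fix w assume "w \<in> (+) (Re a, Im a) ` edge_line k v v' i"
    then obtain x y where w: "w = (Re a, Im a) + (x, y)" and xy: "(x, y) \<in> edge_line k v v' i" by auto
    define z where "z = Complex x y"
    have "z + slope i * cnj z = si"
      using xy edge_line_iff[of z i] by (simp add: z_def si_def)
    then have "(a + z) + slope j * cnj (a + z) = sj" using shift[of z] eq by simp
    then have "(Re (a + z), Im (a + z)) \<in> edge_line k v v' j" unfolding edge_line_iff sj_def .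
    then show "w \<in> edge_line k v v' j" by (simp add: w z_def)
  qed
  then have "affine_parallel (edge_line k v v' i) (edge_line k v v' j)"
    unfolding affine_parallel_def by blast
  then show False
    using inscribed_polygon ij ne unfolding inscribed_polygon_def general_position_def by auto
qed

text \<open>Conjugating the equations shows that (cnj v, cnj u) lies on the same lines as (u, v).
  Two of them have different slopes and meet only once, so v = cnj u: the common point is real, and
  general position applies.\<close>

lemma no_triple:
  assumes ijl: "i < 2 * k" "j < 2 * k" "l < 2 * k" "i \<noteq> j" "j \<noteq> l" "i \<noteq> l"
    and q: "fst q + slope i * snd q = unit_vertex i + unit_vertex (Suc i)"
      "fst q + slope j * snd q = unit_vertex j + unit_vertex (Suc j)"
      "fst q + slope l * snd q = unit_vertex l + unit_vertex (Suc l)"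
  shows False
proof -
  have unit: "slope n * cnj (slope n) = 1" for n
    using complex_norm_square[of "slope n"] by (simp add: norm_mult)
  have conj: "cnj (snd q) + slope n * cnj (fst q) = unit_vertex n + unit_vertex (Suc n)"
    if "fst q + slope n * snd q = unit_vertex n + unit_vertex (Suc n)" for n
  proof -
    have "slope n * cnj (fst q + slope n * snd q) = slope n * cnj (fst q) + (slope n * cnj (slope n)) * cnj (snd q)"
      by (simp add: algebra_simps)
    then show ?thesis unfolding that cnj_sum unit by simp
  qed
  have "slope i \<noteq> slope j" using slope_inj ijl by blast
  moreover have "(slope i - slope j) * (snd q - cnj (fst q)) = 0"
  proof -
    have "cnj (snd q) + slope i * cnj (fst q) - (fst q + slope i * snd q) =
        cnj (snd q) + slope j * cnj (fst q) - (fst q + slope j * snd q)"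
      unfolding q(1,2) conj[OF q(1)] conj[OF q(2)] by simp
    then show ?thesis by (simp add: algebra_simps)
  qed
  ultimately have snd: "snd q = cnj (fst q)" by simp
  have "(Re (fst q), Im (fst q)) \<in> edge_line k v v' n"
    if "fst q + slope n * snd q = unit_vertex n + unit_vertex (Suc n)" for n
    using that unfolding edge_line_iff snd .
  then have "(Re (fst q), Im (fst q)) \<in> edge_line k v v' i \<inter> edge_line k v v' j \<inter> edge_line k v v' l"
    using q by blast
  then show False
    using inscribed_polygon ijl unfolding inscribed_polygon_def general_position_def by blast
qed

sublocale inscribed_general "2 * k" unit_vertex
proof
  show "6 \<le> 2 * k" using k by simp
  show "unit_vertex (j mod (2 * k)) = unit_vertex j" for j by (rule periodic)
  show "unit_vertex j \<noteq> 0" for j using norm_unit_vertex[of j] by (metis norm_zero zero_neq_one)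
  show "i = j" if "i < 2 * k" "j < 2 * k" "unit_vertex i = unit_vertex j" for i j
    using unit_vertex_inj that .
  show "i = j" if "i < 2 * k" "j < 2 * k" "slope i = slope j" for i j
    using slope_inj that .
  show "\<nexists>q. fst q + slope i * snd q = unit_vertex i + unit_vertex (Suc i) \<and>
      fst q + slope j * snd q = unit_vertex j + unit_vertex (Suc j) \<and>
      fst q + slope l * snd q = unit_vertex l + unit_vertex (Suc l)"
    if "i < 2 * k" "j < 2 * k" "l < 2 * k" "i \<noteq> j" "j \<noteq> l" "i \<noteq> l" for i j l
    using no_triple[OF that] by blast
qed simp

definition to_uv :: "complex \<times> complex \<Rightarrow> complex \<times> complex" where
  "to_uv q = (fst q + \<i> * snd q, fst q - \<i> * snd q)"

lemma to_uv_compl: "to_uv q \<in> compl \<longleftrightarrow> q \<notin> arrangement k v v'"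
proof -
  obtain X Y where q: "q = (X, Y)" by (cases q)
  have "q \<in> conic \<longleftrightarrow> eqn (2 * k) (to_uv q) = 0"
  proof -
    have "eqn (2 * k) (to_uv q) = (X + \<i> * Y) * (X - \<i> * Y) - 1" by (simp add: q eqn_def to_uv_def)
    also have "\<dots> = X\<^sup>2 + Y\<^sup>2 - 1" by (simp add: algebra_simps power2_eq_square)
    finally show ?thesis by (simp add: q conic_def)
  qed
  moreover have "q \<in> complex_edge_line k v v' j \<longleftrightarrow> eqn j (to_uv q) = 0" if "j < 2 * k" for j
    using that complex_edge_line_iff[of X Y j] by (simp add: q eqn_def to_uv_def)
  ultimately show ?thesis
    by (auto simp: arrangement_def compl_def le_less)
qed

lemma to_uv_image: "to_uv ` (- arrangement k v v') = compl"
proof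
  show "compl \<subseteq> to_uv ` (- arrangement k v v')"
  proof
    fix q assume q: "q \<in> compl"
    define x where "x = ((fst q + snd q) / 2, (fst q - snd q) / (2 * \<i>))"
    have "to_uv x = q" by (cases q) (simp add: to_uv_def x_def field_simps)
    then show "q \<in> to_uv ` (- arrangement k v v')" using q to_uv_compl[of x] by force
  qed
qed (use to_uv_compl in auto)

lemma fundamental_group_arrangement:
  assumes p: "p \<in> - arrangement k v v'"
  shows "\<not> fundamental_group (- arrangement k v v') p \<cong> free_abelian_sum_free r q m"
proof
  assume iso: "fundamental_group (- arrangement k v v') p \<cong> free_abelian_sum_free r q m"
  have "fundamental_group (- arrangement k v v') p \<cong> fundamental_group (to_uv ` (- arrangement k v v')) (to_uv p)"
  proof (rule fundamental_group_homeomorphic[where T' = "\<lambda>q. ((fst q + snd q) / 2, (fst q - snd q) / (2 * \<i>))"])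
    show "continuous_on (- arrangement k v v') to_uv"
      unfolding to_uv_def by (intro continuous_intros)
    show "continuous_on (to_uv ` (- arrangement k v v')) (\<lambda>q. ((fst q + snd q) / 2, (fst q - snd q) / (2 * \<i>)))"
      by (intro continuous_intros) auto
    show "((fst (to_uv x) + snd (to_uv x)) / 2, (fst (to_uv x) - snd (to_uv x)) / (2 * \<i>)) = x" for x
      by (simp add: to_uv_def prod_eq_iff)
  qed (rule p)
  then have "fundamental_group (- arrangement k v v') p \<cong> fundamental_group compl (to_uv p)"
    by (simp only: to_uv_image)
  then have "fundamental_group compl (to_uv p) \<cong> free_abelian_sum_free r q m"
    using iso group.iso_sym[OF group_fundamental_group[OF p]] iso_trans by blast
  moreover have "to_uv p \<in> compl" using p to_uv_compl by simp
  ultimately show False using not_free_abelian_sum_free by blast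
qed

end

theorem theorem4p6:
  fixes n k :: nat
    and v v' :: "nat \<Rightarrow> real \<times> real"
    and s1 s2 :: real
    and p :: "complex \<times> complex"
  assumes "n = 2 * k" and "n > 4"
    and "inscribed_polygon k v v' s1 s2"
    and "p \<in> - arrangement k v v'"
  shows "\<not> (\<exists>r q m. fundamental_group (- arrangement k v v') p \<cong> free_abelian_sum_free r q m)"
proof -
  interpret polygon k v v' s1 s2
    by unfold_locales (use assms in auto)
  show ?thesis using fundamental_group_arrangement[OF assms(4)] by blast
qed

end
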